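(* Let $u\in H^1_0(\Omega)$ be Lipschitz continuous on $\overline\Omega$, nondegenerate, and satisfy $-\Delta u=(u-1)_+^{p-1}$ in $\Omega\setminus\partial\{u>1\}$. Let $\delta_0:=\operatorname{dist}(\{u>1\},\partial\Omega)>0$. Then there exists a constant $C>0$ such that whenever $x_0\in\partial\{u>1\}$ and $0<r\le\delta_0/2$, $$\sigma(\partial\{u>1\}\cap B_r(x_0))\le C r^{N-1},$$ where $\sigma$ denotes $(N-1)$-dimensional Hausdorff measure. In particular, the free boundary $\partial\{u>1\}$ has finite $(N-1)$-dimensional Hausdorff measure.
   Context: $N\ge2$, $\Omega\subset\mathbb{R}^N$ is a bounded domain with smooth boundary; $2<p<\infty$ if $N=2$, $2<p<2N/(N-2)$ if $N\ge3$; $w_+=\max\{w,0\}$. A continuous function $u$ on $\overline\Omega$ is nondegenerate if there exist constants $r_0,c>0$ such that if $x_0\in\{u>1\}$ and $r:=\operatorname{dist}(x_0,\{u\le1\})\le r_0$, then $u(x_0)\ge1+cr$. *)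

theory Defs
  imports "HOL-Analysis.Analysis"
begin

section \<open>Smooth functions and smooth domains\<close>

primrec Ck :: "nat \<Rightarrow> ('a::euclidean_space \<Rightarrow> real) \<Rightarrow> bool" where
  "Ck 0 f \<longleftrightarrow> continuous_on UNIV f"
| "Ck (Suc k) f \<longleftrightarrow>
     (\<forall>x. f differentiable (at x)) \<and> (\<forall>v. Ck k (\<lambda>x. frechet_derivative f (at x) v))"

definition smooth :: "('a::euclidean_space \<Rightarrow> real) \<Rightarrow> bool" where
  "smooth f \<longleftrightarrow> (\<forall>k. Ck k f)"

definition test_function :: "'a::euclidean_space set \<Rightarrow> ('a \<Rightarrow> real) \<Rightarrow> bool" where
  "test_function U \<phi> \<longleftrightarrow>
     smooth \<phi> \<and> (\<exists>K. compact K \<and> K \<subseteq> U \<and> (\<forall>x. x \<notin> K \<longrightarrow> \<phi> x = 0))"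

text \<open>Near each boundary point the set is the strict epigraph of a smooth function over the
  hyperplane orthogonal to some unit vector \<open>e\<close>. Only the values of \<open>\<gamma>\<close> on that hyperplane
  matter; a smooth function on the hyperplane extends to the whole space by composition with
  the orthogonal projection.\<close>

definition smooth_boundary :: "'a::euclidean_space set \<Rightarrow> bool" where
  "smooth_boundary \<Omega> \<longleftrightarrow>
     (\<forall>x\<in>frontier \<Omega>. \<exists>r>0. \<exists>e \<gamma>. norm e = 1 \<and> smooth \<gamma> \<and>
        \<Omega> \<inter> ball x r = {y \<in> ball x r. \<gamma> (y - (y \<bullet> e) *\<^sub>R e) < y \<bullet> e})"

definition bounded_smooth_domain :: "'a::euclidean_space set \<Rightarrow> bool" where
  "bounded_smooth_domain \<Omega> \<longleftrightarrow>
     open \<Omega> \<and> connected \<Omega> \<and> \<Omega> \<noteq> {} \<and> bounded \<Omega> \<and> smooth_boundary \<Omega>"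


section \<open>The Sobolev space and the equation\<close>

definition grad :: "('a::euclidean_space \<Rightarrow> real) \<Rightarrow> 'a \<Rightarrow> 'a" where
  "grad \<phi> x = (\<Sum>b\<in>Basis. frechet_derivative \<phi> (at x) b *\<^sub>R b)"

definition laplacian :: "('a::euclidean_space \<Rightarrow> real) \<Rightarrow> 'a \<Rightarrow> real" where
  "laplacian \<phi> x =
     (\<Sum>b\<in>Basis. frechet_derivative (\<lambda>y. frechet_derivative \<phi> (at y) b) (at x) b)"

definition L2_on :: "'a::euclidean_space set \<Rightarrow> ('a \<Rightarrow> 'b::euclidean_space) \<Rightarrow> bool" where
  "L2_on U f \<longleftrightarrow>
     set_borel_measurable lebesgue U f \<and> set_integrable lebesgue U (\<lambda>x. (norm (f x))\<^sup>2)"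

definition weak_gradient :: "'a::euclidean_space set \<Rightarrow> ('a \<Rightarrow> real) \<Rightarrow> ('a \<Rightarrow> 'a) \<Rightarrow> bool" where
  "weak_gradient U u g \<longleftrightarrow>
     (\<forall>\<phi>. test_function U \<phi> \<longrightarrow> (\<forall>b\<in>Basis.
        (LINT x:U|lebesgue. u x * frechet_derivative \<phi> (at x) b)
          = - (LINT x:U|lebesgue. (g x \<bullet> b) * \<phi> x)))"

text \<open>The closure of the test functions in the norm of \<open>H\<^sup>1(U)\<close>. The values of \<open>u\<close> outside
  \<open>U\<close> are irrelevant.\<close>

definition H1_0 :: "'a::euclidean_space set \<Rightarrow> ('a \<Rightarrow> real) set" where
  "H1_0 U = {u. L2_on U u \<and>
     (\<exists>g. L2_on U g \<and> weak_gradient U u g \<and>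
       (\<exists>\<phi>::nat \<Rightarrow> 'a \<Rightarrow> real. (\<forall>k. test_function U (\<phi> k)) \<and>
         (\<lambda>k. LINT x:U|lebesgue. (u x - \<phi> k x)\<^sup>2) \<longlonglongrightarrow> 0 \<and>
         (\<lambda>k. LINT x:U|lebesgue. (norm (g x - grad (\<phi> k) x))\<^sup>2) \<longlonglongrightarrow> 0))}"

text \<open>The equation \<open>-\<Delta>u = f\<close> in the open set \<open>U\<close>, in the sense of distributions. For
  \<open>u \<in> H\<^sup>1(U)\<close> this is the usual weak formulation, and classical \<open>C\<^sup>2\<close> solutions satisfy it by
  Green's formula. It is meant for \<open>u\<close> and \<open>f\<close> locally integrable on \<open>U\<close>.\<close>

definition neg_laplacian_eq ::
  "'a::euclidean_space set \<Rightarrow> ('a \<Rightarrow> real) \<Rightarrow> ('a \<Rightarrow> real) \<Rightarrow> bool" where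
  "neg_laplacian_eq U u f \<longleftrightarrow>
     (\<forall>\<phi>. test_function U \<phi> \<longrightarrow>
        - (LINT x:U|lebesgue. u x * laplacian \<phi> x) = (LINT x:U|lebesgue. f x * \<phi> x))"


section \<open>The free boundary and nondegeneracy\<close>

definition superlevel :: "'a::euclidean_space set \<Rightarrow> ('a \<Rightarrow> real) \<Rightarrow> 'a set" where
  "superlevel \<Omega> u = {x \<in> closure \<Omega>. u x > 1}"

definition free_boundary :: "'a::euclidean_space set \<Rightarrow> ('a \<Rightarrow> real) \<Rightarrow> 'a set" where
  "free_boundary \<Omega> u = frontier (superlevel \<Omega> u)"

text \<open>If \<open>{u \<le> 1}\<close> is empty, the library convention \<open>infdist x {} = 0\<close> makes the condition
  trivially true, as does the convention \<open>dist(x, {}) = \<infinity>\<close>.\<close>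

definition nondegenerate :: "'a::euclidean_space set \<Rightarrow> ('a \<Rightarrow> real) \<Rightarrow> bool" where
  "nondegenerate \<Omega> u \<longleftrightarrow>
     continuous_on (closure \<Omega>) u \<and>
     (\<exists>r\<^sub>0>0. \<exists>c>0. \<forall>x\<^sub>0\<in>superlevel \<Omega> u.
        infdist x\<^sub>0 {x \<in> closure \<Omega>. u x \<le> 1} \<le> r\<^sub>0 \<longrightarrow>
        u x\<^sub>0 \<ge> 1 + c * infdist x\<^sub>0 {x \<in> closure \<Omega>. u x \<le> 1})"


section \<open>Hausdorff measure\<close>

text \<open>Normalised so that the measure in dimension \<open>s\<close> agrees with Lebesgue measure on
  \<open>\<real>\<^sup>s\<close>. The empty set has weight \<open>0\<close> also for \<open>s = 0\<close>. Covering sets are required to be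
  bounded since \<open>diameter\<close> is unspecified on unbounded sets.\<close>

definition hausdorff_weight :: "nat \<Rightarrow> 'a::metric_space set \<Rightarrow> ennreal" where
  "hausdorff_weight s U =
     (if U = {} then 0 else ennreal (unit_ball_vol (real s) * (diameter U / 2) ^ s))"

definition hausdorff_premeasure :: "nat \<Rightarrow> real \<Rightarrow> 'a::metric_space set \<Rightarrow> ennreal" where
  "hausdorff_premeasure s \<delta> A =
     (INF U \<in> {U :: nat \<Rightarrow> 'a set.
                 A \<subseteq> (\<Union>i. U i) \<and> (\<forall>i. bounded (U i) \<and> diameter (U i) \<le> \<delta>)}.
        \<Sum>i. hausdorff_weight s (U i))"

definition hausdorff_measure :: "nat \<Rightarrow> 'a::metric_space set \<Rightarrow> ennreal" where
  "hausdorff_measure s A = (SUP \<delta>\<in>{0<..}. hausdorff_premeasure s \<delta> A)"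

end

theory Submission
  imports Defs
begin

text \<open>
  Let \<open>v = (u - 1)\<^sup>+\<close>, extended by \<open>0\<close> outside \<open>\<Omega>\<close>, and let \<open>\<Gamma>\<close> be the boundary of \<open>{v > 0}\<close>.
  The idea is that the Laplacian of \<open>v\<close>, up to the bounded term \<open>f = v\<^sup>p\<^sup>-\<^sup>1\<close>, is a nonnegative
  measure, that this measure has mass at most \<open>C r\<^sup>N\<^sup>-\<^sup>1\<close> in a ball of radius \<open>r\<close> centred
  on \<open>\<Gamma>\<close>, because \<open>v \<le> 2 L r\<close> on the doubled ball, and that it has mass at least
  \<open>c \<epsilon>\<^sup>N\<^sup>-\<^sup>1\<close> near every point of \<open>\<Gamma>\<close> at scale \<open>\<epsilon>\<close>. Hence at most
  \<open>C (r / \<epsilon>)\<^sup>N\<^sup>-\<^sup>1\<close> points of \<open>\<Gamma>\<close> in such a ball can be \<open>\<epsilon>\<close>-separated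
  (\<open>separated_points_bound\<close>), and the balls of radius \<open>\<epsilon>\<close> around a maximal separated set
  are a covering that bounds the Hausdorff measure.

  The measure is used only through its values on test functions. Its nonnegativity is Kato's
  inequality \<open>kato_inequality\<close>: \<open>\<integral> v \<Delta>\<phi> + \<integral> f \<phi> \<ge> 0\<close> for all test functions \<open>\<phi> \<ge> 0\<close>, also
  those whose support meets \<open>\<Gamma>\<close>. It follows by mollifying \<open>v\<close> and composing with a smooth convex
  function that vanishes where the mollified function does not yet satisfy the equation.

  The lower bound comes from one family of test functions, \<open>subharmonic_kernel_exists\<close>: smooth
  truncations of \<open>|y|\<^sup>-\<^sup>k\<close> with \<open>N - 2 < k < N - 1\<close>. These are subharmonic outside a tiny
  ball around the centre. The condition \<open>k < N - 1\<close> makes the negative part of their Laplacian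
  negligible when it is integrated against a Lipschitz function vanishing at the centre.
  Used at a point of \<open>\<Gamma>\<close>, such a kernel sees mass of order \<open>\<epsilon>\<^sup>N\<^sup>-\<^sup>1\<close> as soon as \<open>v\<close> is
  at least \<open>c \<epsilon>\<close> somewhere at distance at most \<open>\<epsilon>\<close>.

  That last property, \<open>weak_nondegeneracy\<close>, is more than the hypothesis, which bounds \<open>v(x)\<close> from
  below by the distance \<open>d\<close> of \<open>x\<close> from \<open>{v = 0}\<close> only. The same kernels centred at \<open>x\<close> show
  that \<open>v\<close> increases by a multiple of \<open>d\<close> within distance \<open>2 d\<close> (\<open>growth\<close>). Maximising \<open>v\<close>
  minus a small cone then produces a point at the right distance, without iteration.

  All this requires \<open>{v > 0}\<close> to stay away from the boundary of \<open>\<Omega>\<close>, that is, \<open>u = 0\<close> there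
  (\<open>H1_0_zero_on_frontier\<close>). A test function of \<open>\<Omega>\<close> has square integral \<open>O(t\<^sup>2)\<close> over a
  boundary strip of width \<open>t\<close>, and this passes to the limit in \<open>H\<^sup>1\<close>; the strip has volume of
  order \<open>t\<close>, so that a function bounded away from \<open>0\<close> on it has a square integral of
  order at least \<open>t\<close>.
\<close>

section \<open>Calculus of smooth functions\<close>


text \<open>The point is the last argument, so that \<open>dd f v\<close> is again a function to be differentiated.\<close>
abbreviation dd :: "('a::euclidean_space \<Rightarrow> real) \<Rightarrow> 'a \<Rightarrow> 'a \<Rightarrow> real" where
  "dd f v x \<equiv> frechet_derivative f (at x) v"

lemma dd_eqI: "(f has_derivative f') (at x) \<Longrightarrow> dd f v x = f' v"
  using frechet_derivative_at by metis

lemma Ck_mono_Suc: "Ck (Suc k) f \<Longrightarrow> Ck k f"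
proof (induction k arbitrary: f)
  case 0
  then show ?case
    by (auto simp: continuous_on_eq_continuous_at intro: differentiable_imp_continuous_within)
next
  case (Suc k)
  then show ?case by (simp del: Ck.simps(2) add: Ck.simps(2)[of "Suc k"] Ck.simps(2)[of k f])
qed

lemma Ck_SucI:
  assumes "\<And>x. (f has_derivative f' x) (at x)" "\<And>v. Ck k (\<lambda>x. f' x v)"
  shows "Ck (Suc k) f"
proof -
  have "dd f v x = f' x v" for x v using assms(1) by (rule dd_eqI)
  then show ?thesis using assms by (auto simp: differentiable_def)
qed

lemma Ck_SucD: "Ck (Suc k) f \<Longrightarrow> (f has_derivative (\<lambda>v. dd f v x)) (at x)"
  by (simp add: frechet_derivative_works)

lemma Ck_const: "Ck k (\<lambda>x. c)"
proof (induction k arbitrary: c)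
  case (Suc k)
  show ?case by (rule Ck_SucI[where f' = "\<lambda>x v. 0"]) (use Suc in auto)
qed auto

lemma Ck_add: "Ck k f \<Longrightarrow> Ck k g \<Longrightarrow> Ck k (\<lambda>x. f x + g x)"
proof (induction k arbitrary: f g)
  case 0 then show ?case by (auto intro: continuous_intros)
next
  case (Suc k)
  show ?case
    by (rule Ck_SucI[where f' = "\<lambda>x v. dd f v x + dd g v x"])
      (use Suc in \<open>auto intro!: has_derivative_add simp: frechet_derivative_works\<close>)
qed

lemma Ck_mult: "Ck k f \<Longrightarrow> Ck k g \<Longrightarrow> Ck k (\<lambda>x. f x * g x)"
proof (induction k arbitrary: f g)
  case 0 then show ?case by (auto intro: continuous_intros)
next
  case (Suc k)
  note fg = Ck_mono_Suc[OF Suc.prems(1)] Ck_mono_Suc[OF Suc.prems(2)]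
  show ?case
  proof (rule Ck_SucI[where f' = "\<lambda>x v. f x * dd g v x + dd f v x * g x"])
    fix x
    show "((\<lambda>x. f x * g x) has_derivative (\<lambda>v. f x * dd g v x + dd f v x * g x)) (at x)"
      by (rule has_derivative_mult) (use Suc in \<open>auto intro: Ck_SucD\<close>)
  next
    fix v show "Ck k (\<lambda>x. f x * dd g v x + dd f v x * g x)"
      using Suc.prems fg by (intro Ck_add Suc.IH) auto
  qed
qed

lemma Ck_linear:
  assumes "bounded_linear f" shows "Ck k f"
proof (cases k)
  case 0
  then show ?thesis using assms by (simp add: linear_continuous_on)
next
  case (Suc m)
  show ?thesis unfolding Suc
    by (rule Ck_SucI[where f' = "\<lambda>x. f"])
      (use assms in \<open>auto intro: Ck_const bounded_linear_imp_has_derivative\<close>)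
qed

text \<open>The outer function comes with the list of all its derivatives, which is simpler to provide than a
  proof of smoothness; the open set \<open>S\<close> admits powers, which are smooth on the positive axis only.\<close>
lemma Ck_compose:
  fixes h :: "nat \<Rightarrow> real \<Rightarrow> real"
  assumes h: "\<And>n t. t \<in> S \<Longrightarrow> (h n has_real_derivative h (Suc n) t) (at t)"
    and w: "Ck k w" "\<And>x. w x \<in> S"
  shows "Ck k (\<lambda>x. h n (w x))"
  using w
proof (induction k arbitrary: n)
  case 0
  have "isCont (h n) (w x)" for x using h[OF 0(2)] DERIV_isCont by blast
  moreover have "isCont w x" for x
    using 0(1) by (simp add: continuous_on_eq_continuous_at)
  ultimately have "isCont (\<lambda>x. h n (w x)) x" for x
    by (rule isCont_o2[rotated])
  then show ?case by (simp add: continuous_at_imp_continuous_on)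
next
  case (Suc k)
  show ?case
  proof (rule Ck_SucI[where f' = "\<lambda>x v. dd w v x * h (Suc n) (w x)"])
    fix x
    show "((\<lambda>x. h n (w x)) has_derivative (\<lambda>v. dd w v x * h (Suc n) (w x))) (at x)"
      using h[OF Suc.prems(2), of n x] Ck_SucD[OF Suc.prems(1), of x]
      by (rule DERIV_compose_FDERIV)
  next
    fix v
    have "Ck k (\<lambda>x. dd w v x)" using Suc.prems by simp
    then show "Ck k (\<lambda>x. dd w v x * h (Suc n) (w x))"
      by (rule Ck_mult) (rule Suc.IH[OF Ck_mono_Suc[OF Suc.prems(1)] Suc.prems(2)])
  qed
qed

lemma has_derivative_affine:
  assumes "f differentiable (at (c *\<^sub>R y + d))"
  shows "((\<lambda>y. f (c *\<^sub>R y + d)) has_derivative (\<lambda>v. c * dd f v (c *\<^sub>R y + d))) (at y)"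
proof -
  have D: "(f has_derivative (\<lambda>v. dd f v (c *\<^sub>R y + d))) (at (c *\<^sub>R y + d))"
    using assms by (simp add: frechet_derivative_works)
  have "((\<lambda>y. f (c *\<^sub>R y + d)) has_derivative (\<lambda>v. dd f (c *\<^sub>R v) (c *\<^sub>R y + d))) (at y)"
    by (rule has_derivative_compose[where f = "\<lambda>y. c *\<^sub>R y + d", OF _ D])
      (auto intro!: derivative_eq_intros)
  moreover have "dd f (c *\<^sub>R v) (c *\<^sub>R y + d) = c * dd f v (c *\<^sub>R y + d)" for v
    using linear_cmul[OF linear_frechet_derivative[OF assms]] by simp
  ultimately show ?thesis by simp
qed

lemma dd_affine:
  assumes "f differentiable (at (c *\<^sub>R y + d))"
  shows "dd (\<lambda>y. f (c *\<^sub>R y + d)) v y = c * dd f v (c *\<^sub>R y + d)"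
  by (rule dd_eqI[OF has_derivative_affine[OF assms]])

lemma Ck_affine: "Ck k f \<Longrightarrow> Ck k (\<lambda>y. f (c *\<^sub>R y + d))"
proof (induction k arbitrary: f)
  case 0
  have "continuous_on UNIV (\<lambda>y. c *\<^sub>R y + d)" by (intro continuous_intros)
  with 0 show ?case
    using continuous_on_compose2[of UNIV f UNIV "\<lambda>y. c *\<^sub>R y + d"] by simp
next
  case (Suc k)
  show ?case
  proof (rule Ck_SucI[where f' = "\<lambda>y v. c * dd f v (c *\<^sub>R y + d)"])
    fix y
    show "((\<lambda>y. f (c *\<^sub>R y + d)) has_derivative (\<lambda>v. c * dd f v (c *\<^sub>R y + d))) (at y)"
      using Suc.prems by (intro has_derivative_affine) simp
  next
    fix v
    show "Ck k (\<lambda>y. c * dd f v (c *\<^sub>R y + d))"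
      by (intro Ck_mult Ck_const Suc.IH) (use Suc.prems in simp)
  qed
qed

lemma smooth_const: "smooth (\<lambda>x. c)"
  by (simp add: smooth_def Ck_const)

lemma smooth_add: "smooth f \<Longrightarrow> smooth g \<Longrightarrow> smooth (\<lambda>x. f x + g x)"
  unfolding smooth_def by (blast intro: Ck_add)

lemma smooth_mult: "smooth f \<Longrightarrow> smooth g \<Longrightarrow> smooth (\<lambda>x. f x * g x)"
  unfolding smooth_def by (blast intro: Ck_mult)

lemma smooth_affine:
  assumes "smooth f" shows "smooth (\<lambda>y. f (r *\<^sub>R y + d))"
  unfolding smooth_def
proof
  fix k show "Ck k (\<lambda>y. f (r *\<^sub>R y + d))"
    by (rule Ck_affine[of k f r d]) (use assms in \<open>simp add: smooth_def\<close>)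
qed

lemmas smooth_intros = smooth_const smooth_add smooth_mult

lemma smooth_Suc: "smooth f \<Longrightarrow> Ck (Suc k) f"
  by (simp only: smooth_def)

lemma smooth_dd: "smooth f \<Longrightarrow> smooth (\<lambda>x. dd f v x)"
  unfolding smooth_def[of "\<lambda>x. dd f v x"] using smooth_Suc[of f] by simp

lemma smooth_differentiable: "smooth f \<Longrightarrow> f differentiable (at x)"
  using smooth_Suc[of f 0] by simp

lemma smooth_has_derivative: "smooth f \<Longrightarrow> (f has_derivative (\<lambda>v. dd f v x)) (at x)"
  using smooth_differentiable[of f x] by (simp add: frechet_derivative_works)

lemma smooth_continuous: "smooth f \<Longrightarrow> continuous_on A f"
  using Ck.simps(1)[of f] continuous_on_subset[of UNIV f A] by (simp add: smooth_def)

lemma smooth_diff: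
  assumes "smooth f" "smooth g" shows "smooth (\<lambda>x. f x - g x)"
  using smooth_add[OF assms(1) smooth_mult[OF smooth_const[of "-1"] assms(2)]] by simp

lemma smooth_sum: "(\<And>i. i \<in> I \<Longrightarrow> smooth (f i)) \<Longrightarrow> smooth (\<lambda>x. \<Sum>i\<in>I. f i x)"
  by (induction I rule: infinite_finite_induct) (auto intro: smooth_intros)

lemma smooth_compose:
  fixes h :: "nat \<Rightarrow> real \<Rightarrow> real"
  assumes "\<And>n t. t \<in> S \<Longrightarrow> (h n has_real_derivative h (Suc n) t) (at t)"
    and "smooth w" "\<And>x. w x \<in> S"
  shows "smooth (\<lambda>x. h n (w x))"
  unfolding smooth_def
proof
  fix k show "Ck k (\<lambda>x. h n (w x))"
    by (rule Ck_compose[of S h, OF assms(1) _ assms(3)]) (use assms(2) in \<open>simp_all add: smooth_def\<close>)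
qed

lemma dd_add:
  "smooth f \<Longrightarrow> smooth g \<Longrightarrow> dd (\<lambda>x. f x + g x) v x = dd f v x + dd g v x"
  by (rule dd_eqI[OF has_derivative_add]) (auto intro: smooth_has_derivative)

lemma dd_mult:
  "smooth f \<Longrightarrow> smooth g \<Longrightarrow> dd (\<lambda>x. f x * g x) v x = f x * dd g v x + dd f v x * g x"
  by (rule dd_eqI[OF has_derivative_mult]) (auto intro: smooth_has_derivative)

lemma dd_const: "dd (\<lambda>x. c) v x = 0"
  by (rule dd_eqI) simp

lemma laplacian_add:
  assumes "smooth f" "smooth g"
  shows "laplacian (\<lambda>x. f x + g x) x = laplacian f x + laplacian g x"
  using assms by (simp add: laplacian_def dd_add smooth_dd sum.distrib)

lemma laplacian_cmult:
  assumes "smooth f"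
  shows "laplacian (\<lambda>x. c * f x) x = c * laplacian f x"
  using assms by (simp add: laplacian_def dd_mult smooth_intros dd_const smooth_dd sum_distrib_left)

lemma laplacian_diff:
  assumes "smooth f" "smooth g"
  shows "laplacian (\<lambda>x. f x - g x) x = laplacian f x - laplacian g x"
  using laplacian_add[OF assms(1) smooth_mult[OF smooth_const[of "-1"] assms(2)]]
    laplacian_cmult[OF assms(2), of "-1"] by simp

lemma laplacian_const: "laplacian (\<lambda>x. c) x = 0"
  by (simp add: laplacian_def dd_const)

lemma laplacian_sum:
  "(\<And>i. i \<in> I \<Longrightarrow> smooth (f i)) \<Longrightarrow> laplacian (\<lambda>x. \<Sum>i\<in>I. f i x) x = (\<Sum>i\<in>I. laplacian (f i) x)"
  by (induction I rule: infinite_finite_induct) (auto simp: laplacian_const laplacian_add smooth_sum)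

lemma laplacian_affine:
  assumes f: "smooth f"
  shows "laplacian (\<lambda>y. f (c *\<^sub>R y + d)) y = c\<^sup>2 * laplacian f (c *\<^sub>R y + d)"
proof -
  have 1: "dd (\<lambda>y. f (c *\<^sub>R y + d)) b = (\<lambda>y. c * dd f b (c *\<^sub>R y + d))" for b
    using dd_affine[OF smooth_differentiable[OF f]] by blast
  have "dd (\<lambda>y. c * dd f b (c *\<^sub>R y + d)) b y = c * (c * dd (dd f b) b (c *\<^sub>R y + d))" for b
    using dd_mult[OF smooth_const[of c] smooth_affine[OF smooth_dd[OF f, of b], of c d], of y b]
      dd_affine[where f = "dd f b" and v = b, OF smooth_differentiable[OF smooth_dd[OF f]]]
    by (simp add: dd_const)
  then show ?thesis
    by (simp add: laplacian_def 1 sum_distrib_left power2_eq_square mult.assoc)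
qed

lemma smooth_laplacian: "smooth f \<Longrightarrow> smooth (laplacian f)"
  unfolding laplacian_def[abs_def] by (intro smooth_sum smooth_dd)

lemma laplacian_compose:
  fixes h :: "nat \<Rightarrow> real \<Rightarrow> real"
  assumes h: "\<And>n t. t \<in> S \<Longrightarrow> (h n has_real_derivative h (Suc n) t) (at t)"
    and w: "smooth w" "\<And>x. w x \<in> S"
  shows "laplacian (\<lambda>x. h n (w x)) x
    = h (Suc (Suc n)) (w x) * (\<Sum>b\<in>Basis. (dd w b x)\<^sup>2) + h (Suc n) (w x) * laplacian w x"
proof -
  have c: "dd (\<lambda>x. h n (w x)) b = (\<lambda>x. dd w b x * h (Suc n) (w x))" for b n
  proof
    fix x show "dd (\<lambda>x. h n (w x)) b x = dd w b x * h (Suc n) (w x)"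
      by (rule dd_eqI[OF DERIV_compose_FDERIV[OF h[OF w(2)] smooth_has_derivative[OF w(1)]]])
  qed
  have "dd (\<lambda>y. dd w b y * h (Suc n) (w y)) b x
      = h (Suc (Suc n)) (w x) * (dd w b x)\<^sup>2 + h (Suc n) (w x) * dd (dd w b) b x" for b
  proof -
    have "dd (\<lambda>y. dd w b y * h (Suc n) (w y)) b x
        = dd w b x * dd (\<lambda>y. h (Suc n) (w y)) b x + dd (dd w b) b x * h (Suc n) (w x)"
      by (intro dd_mult smooth_dd w(1) smooth_compose[of S h, OF h w])
    then show ?thesis by (simp add: fun_cong[OF c] power2_eq_square)
  qed
  then show ?thesis by (simp add: laplacian_def c sum.distrib sum_distrib_left)
qed

lemma smooth_sqnorm: "smooth (\<lambda>y::'a::euclidean_space. (norm y)\<^sup>2)"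
proof -
  have "smooth (\<lambda>y::'a. \<Sum>b\<in>Basis. (y \<bullet> b) * (y \<bullet> b))"
    by (intro smooth_sum smooth_intros; simp add: smooth_def Ck_linear bounded_linear_inner_left)
  then show ?thesis
    by (simp add: power2_norm_eq_inner euclidean_inner[symmetric])
qed

lemma dd_sqnorm: "dd (\<lambda>y. (norm y)\<^sup>2) v x = 2 * (x \<bullet> v)"
  unfolding power2_norm_eq_inner
  by (rule dd_eqI) (auto intro!: derivative_eq_intros simp: inner_commute)

lemma laplacian_sqnorm: "laplacian (\<lambda>y::'a::euclidean_space. (norm y)\<^sup>2) x = 2 * DIM('a)"
proof -
  have "dd (\<lambda>y::'a. 2 * (y \<bullet> b)) b x = 2" if "b \<in> Basis" for b
    using that by (intro dd_eqI[THEN trans, of _ "\<lambda>v. 2 * (v \<bullet> b)"])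
      (auto intro!: derivative_eq_intros)
  then show ?thesis by (simp add: laplacian_def dd_sqnorm)
qed

section \<open>A smooth function supported on a half-line\<close>

text \<open>A family closed under differentiation, all of whose members are flat at \<open>0\<close>: differentiating
  turns the polynomial \<open>P\<close> into \<open>flat_step P\<close>.\<close>
definition flat_exp :: "real poly \<Rightarrow> real \<Rightarrow> real" where
  "flat_exp P t = (if t > 0 then poly P (1 / t) * exp (- (1 / t)) else 0)"

definition flat_step :: "real poly \<Rightarrow> real poly" where
  "flat_step P = [:0, 0, 1:] * (P - pderiv P)"

lemma poly_over_exp_tendsto_0: "((\<lambda>x. poly P x * exp (- x)) \<longlongrightarrow> 0) (at_top :: real filter)"
proof (induction P)
  case 0 then show ?case by simp
next
  case (pCons a P)
  have "((\<lambda>x. x ^ n * exp (- x)) \<longlongrightarrow> 0) (at_top :: real filter)" for n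
    using tendsto_power_div_exp_0[of n] by (simp add: exp_minus field_simps)
  then have *: "((\<lambda>x. \<Sum>i\<le>degree (pCons a P). coeff (pCons a P) i * (x ^ i * exp (- x))) \<longlongrightarrow>
      (\<Sum>i\<le>degree (pCons a P). coeff (pCons a P) i * 0)) at_top"
    by (intro tendsto_sum tendsto_mult tendsto_const)
  show ?case
    unfolding poly_altdef sum_distrib_right mult.assoc using * by simp
qed

text \<open>At \<open>0\<close> the exponential beats every polynomial in \<open>1 / t\<close>, so the derivative there is \<open>0\<close>.\<close>
lemma DERIV_flat_exp: "(flat_exp P has_real_derivative flat_exp (flat_step P) t) (at t)"
proof -
  consider "t > 0" | "t < 0" | "t = 0" by linarith
  then show ?thesis
  proof cases
    case 1
    have D: "((\<lambda>t. poly P (1 / t) * exp (- (1 / t))) has_real_derivative flat_exp (flat_step P) t) (at t)"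
      using 1 by (auto intro!: derivative_eq_intros poly_DERIV[THEN DERIV_chain2]
          simp: flat_exp_def flat_step_def field_simps power2_eq_square)
    have "\<forall>\<^sub>F x in nhds t. x > 0"
      using eventually_nhds_in_open[of "{0<..}" t] 1 by simp
    then have ev: "\<forall>\<^sub>F x in nhds t. flat_exp P x = poly P (1 / x) * exp (- (1 / x))"
      by eventually_elim (simp add: flat_exp_def)
    from DERIV_cong_ev[OF refl ev refl] D show ?thesis by (rule iffD2)
  next
    case 2
    have "\<forall>\<^sub>F x in nhds t. x < 0"
      using eventually_nhds_in_open[of "{..<0}" t] 2 by simp
    then have ev: "\<forall>\<^sub>F x in nhds t. flat_exp P x = 0"
      by eventually_elim (simp add: flat_exp_def)
    have "((\<lambda>x. 0) has_real_derivative flat_exp (flat_step P) t) (at t)"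
      using 2 by (simp add: flat_exp_def)
    with DERIV_cong_ev[OF refl ev refl] show ?thesis by (rule iffD2)
  next
    case 3
    have "((\<lambda>y. flat_exp P y / y) \<longlongrightarrow> 0) (at_left 0)"
      by (rule tendsto_eventually) (auto simp: flat_exp_def eventually_at_left_field intro: exI[of _ "-1"])
    moreover have "((\<lambda>y. flat_exp P y / y) \<longlongrightarrow> 0) (at_right 0)"
    proof -
      have "((\<lambda>x. poly (pCons 0 P) x * exp (- x)) \<longlongrightarrow> 0) (at_top :: real filter)"
        by (rule poly_over_exp_tendsto_0)
      from filterlim_compose[OF this filterlim_inverse_at_top_right]
      have *: "((\<lambda>x. poly (pCons 0 P) (inverse x) * exp (- inverse x)) \<longlongrightarrow> 0) (at_right 0)" .
      have "\<forall>\<^sub>F x in at_right 0. poly (pCons 0 P) (inverse x) * exp (- inverse x) = flat_exp P x / x"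
        by (auto simp: flat_exp_def eventually_at_right_field field_simps intro!: exI[of _ 1])
      from Lim_transform_eventually[OF * this] show ?thesis .
    qed
    ultimately have "((\<lambda>y. flat_exp P y / y) \<longlongrightarrow> 0) (at 0)"
      by (simp add: filterlim_split_at_real)
    then show ?thesis
      unfolding 3 by (simp add: has_field_derivative_iff flat_exp_def)
  qed
qed

text \<open>The \<open>n\<close>-th derivative of \<open>t exp (-1/t)\<close>, continued by \<open>0\<close> to \<open>t \<le> 0\<close>. In contrast to
  \<open>exp (-1/t)\<close> this function is convex on the whole line, with slope between \<open>0\<close> and \<open>1\<close>: a smooth
  positive part that is exactly \<open>0\<close> on the negative axis. By convexity the Laplacian of a
  composition \<open>G \<circ> w\<close> with it is at least \<open>G'(w) \<Delta>w\<close>. The formula is Leibniz' rule for the factor \<open>t\<close>.\<close>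
definition soft_pos :: "nat \<Rightarrow> real \<Rightarrow> real" where
  "soft_pos n t = t * flat_exp ((flat_step ^^ n) 1) t + of_nat n * flat_exp ((flat_step ^^ (n - 1)) 1) t"

lemma DERIV_soft_pos: "(soft_pos n has_real_derivative soft_pos (Suc n) t) (at t)"
proof (cases n)
  case 0
  then show ?thesis
    unfolding soft_pos_def[abs_def] by (auto intro!: derivative_eq_intros DERIV_flat_exp)
next
  case (Suc m)
  then show ?thesis
    unfolding soft_pos_def[abs_def]
    by (auto intro!: derivative_eq_intros DERIV_flat_exp simp: algebra_simps)
qed

lemma soft_pos_0: "soft_pos 0 t = (if t > 0 then t * exp (- (1 / t)) else 0)"
  by (simp add: soft_pos_def flat_exp_def)

lemma soft_pos_1: "soft_pos (Suc 0) t = (if t > 0 then (1 + 1 / t) * exp (- (1 / t)) else 0)"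
  by (simp add: soft_pos_def flat_exp_def flat_step_def field_simps)

lemma soft_pos_2: "soft_pos (Suc (Suc 0)) t = (if t > 0 then exp (- (1 / t)) / t ^ 3 else 0)"
proof -
  have "pderiv [:0, 0, 1:] = [:0, 2::real:]"
    by (simp add: pderiv_pCons)
  then show ?thesis
    by (simp add: soft_pos_def flat_exp_def flat_step_def field_simps power2_eq_square power3_eq_cube)
qed

lemma soft_pos_bounds:
  "0 \<le> soft_pos 0 t" "soft_pos 0 t \<le> max t 0" "max t 0 - 1 \<le> soft_pos 0 t"
  "0 \<le> soft_pos (Suc 0) t" "soft_pos (Suc 0) t \<le> 1" "0 \<le> soft_pos (Suc (Suc 0)) t"
proof -
  show "0 \<le> soft_pos 0 t" "soft_pos 0 t \<le> max t 0" "0 \<le> soft_pos (Suc 0) t" "0 \<le> soft_pos (Suc (Suc 0)) t"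
    by (auto simp: soft_pos_0 soft_pos_1 soft_pos_2)
  have "(1 - 1/t) \<le> exp (- (1/t))" using exp_ge_add_one_self[of "- (1/t)"] by simp
  then have "t > 0 \<Longrightarrow> t * (1 - 1/t) \<le> t * exp (- (1/t))" by (intro mult_left_mono) auto
  moreover have "t > 0 \<Longrightarrow> t * (1 - 1/t) = t - 1" by (simp add: right_diff_distrib)
  ultimately show "max t 0 - 1 \<le> soft_pos 0 t" by (auto simp: soft_pos_0)
  have "(1 + 1/t) \<le> exp (1/t)" using exp_ge_add_one_self[of "1/t"] by simp
  then have "(1 + 1/t) * exp (-(1/t)) \<le> exp (1/t) * exp (-(1/t))" by (intro mult_right_mono) auto
  then show "soft_pos (Suc 0) t \<le> 1" by (auto simp: soft_pos_1 simp flip: exp_add)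
qed


section \<open>Integration by parts\<close>

lemma integrable_compact_support:
  fixes f :: "'a::euclidean_space \<Rightarrow> real"
  assumes "continuous_on UNIV f" "compact K" "\<And>x. x \<notin> K \<Longrightarrow> f x = 0"
  shows "integrable lborel f"
proof -
  have "integrable lborel (\<lambda>x. indicator K x *\<^sub>R f x)"
    using assms by (intro borel_integrable_compact) (auto intro: continuous_on_subset)
  also have "(\<lambda>x. indicator K x *\<^sub>R f x) = f"
    using assms(3) by (intro ext) (auto simp: indicator_def)
  finally show ?thesis .
qed

lemma bounded_compact_support:
  fixes f :: "'a::euclidean_space \<Rightarrow> real"
  assumes "continuous_on UNIV f" "compact K" "\<And>x. x \<notin> K \<Longrightarrow> f x = 0"
  obtains B where "B > 0" "\<And>x. \<bar>f x\<bar> \<le> B"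
proof -
  have "bounded (f ` K)"
    using assms by (intro compact_imp_bounded compact_continuous_image) (auto intro: continuous_on_subset)
  then obtain B where B: "B > 0" "\<And>x. x \<in> K \<Longrightarrow> \<bar>f x\<bar> \<le> B"
    unfolding bounded_pos by auto
  have "\<bar>f x\<bar> \<le> B" for x by (cases "x \<in> K") (use B assms(3) in auto)
  with B(1) show ?thesis by (rule that)
qed

lemma integrable_cball:
  fixes x :: "'a::euclidean_space"
  shows "integrable lborel (\<lambda>y. c * indicator (cball x r) y :: real)"
  using emeasure_lborel_cball_finite[of x r]
  by (intro integrable_mult_right integrable_real_indicator) auto

lemma integral_lborel_translation:
  fixes f :: "'a::euclidean_space \<Rightarrow> real"
  assumes "f \<in> borel_measurable borel"
  shows "(LINT x|lborel. f (x + a)) = (LINT x|lborel. f x)"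
proof -
  have "(LINT x|lborel. f x) = (LINT x|distr lborel borel ((+) a). f x)"
    by (simp add: lborel_distr_plus)
  also have "\<dots> = (LINT x|lborel. f (a + x))"
    using assms by (intro integral_distr) auto
  finally show ?thesis by (simp add: add.commute)
qed

lemma smooth_line_derivative:
  assumes "smooth f"
  shows "((\<lambda>t. f (x + t *\<^sub>R b)) has_real_derivative dd f b (x + t *\<^sub>R b)) (at t)"
proof -
  have "((\<lambda>t. f (x + t *\<^sub>R b)) has_derivative (\<lambda>h. dd f (h *\<^sub>R b) (x + t *\<^sub>R b))) (at t)"
    by (rule has_derivative_compose[OF _ smooth_has_derivative[OF assms]])
      (auto intro!: derivative_eq_intros)
  moreover have "dd f (h *\<^sub>R b) (x + t *\<^sub>R b) = dd f b (x + t *\<^sub>R b) * h" for h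
    using linear_cmul[OF linear_frechet_derivative[OF smooth_differentiable[OF assms]]] by simp
  ultimately show ?thesis by (simp add: has_field_derivative_def)
qed

lemma dd_outside_support:
  assumes "closed K" "\<And>x. x \<notin> K \<Longrightarrow> f x = 0" "x \<notin> K"
  shows "dd f v x = 0"
proof -
  have "(f has_derivative (\<lambda>v. 0)) (at x)"
  proof (rule has_derivative_transform_within_open)
    show "((\<lambda>x. 0) has_derivative (\<lambda>v. 0)) (at x)" by simp
    show "open (- K)" "x \<in> - K" using assms by auto
  qed (use assms in auto)
  then show ?thesis by (rule dd_eqI)
qed

lemma laplacian_outside_support:
  assumes "closed K" "\<And>x. x \<notin> K \<Longrightarrow> f x = 0" "x \<notin> K"
  shows "laplacian f x = 0"
proof -
  have "dd f v x = 0" if "x \<notin> K" for v x by (rule dd_outside_support[OF assms(1,2) that])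
  then have "dd (dd f v) w x = 0" for v w by (rule dd_outside_support[OF assms(1) _ assms(3)])
  then show ?thesis by (simp add: laplacian_def)
qed

text \<open>The difference quotients have integral \<open>0\<close> by translation invariance, and they are dominated because
  the derivative is bounded.\<close>
lemma integral_dd_eq_0:
  fixes f :: "'a::euclidean_space \<Rightarrow> real"
  assumes f: "smooth f" and K: "compact K" "\<And>x. x \<notin> K \<Longrightarrow> f x = 0"
  shows "(LINT x|lborel. dd f b x) = 0"
proof -
  have Kc: "closed K" using K(1) compact_imp_closed by blast
  obtain M where M: "M > 0" "\<And>x. \<bar>dd f b x\<bar> \<le> M"
    by (rule bounded_compact_support[OF smooth_continuous[OF smooth_dd[OF f]] K(1)
      dd_outside_support[OF Kc K(2)]]) (blast+)
  obtain R where R: "K \<subseteq> cball 0 R"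
    using compact_imp_bounded[OF K(1)] unfolding bounded_iff by (auto simp: subset_eq)
  define s where "s n x = (f (x + (1 / real (Suc n)) *\<^sub>R b) - f x) / (1 / real (Suc n))" for n x
  have bm: "f \<in> borel_measurable borel" "(\<lambda>x. dd f b x) \<in> borel_measurable borel"
    using f by (auto intro!: borel_measurable_continuous_onI smooth_continuous smooth_dd)
  have "(\<lambda>n. LINT x|lborel. s n x) \<longlonglongrightarrow> (LINT x|lborel. dd f b x)"
  proof (rule integral_dominated_convergence)
    show "integrable lborel (\<lambda>x. M * indicator (cball 0 (R + norm b)) x :: real)" by (rule integrable_cball)
    show "(\<lambda>x. dd f b x) \<in> borel_measurable lborel" using bm by simp
    show "s n \<in> borel_measurable lborel" for n using bm unfolding s_def by measurable
    show "AE x in lborel. (\<lambda>n. s n x) \<longlonglongrightarrow> dd f b x"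
    proof (rule AE_I2)
      fix x
      have "((\<lambda>t. (f (x + t *\<^sub>R b) - f x) / t) \<longlongrightarrow> dd f b x) (at 0)"
        using smooth_line_derivative[OF f, of x b 0] by (simp add: has_field_derivative_iff)
      moreover have "filterlim (\<lambda>n. 1 / real (Suc n)) (at 0) sequentially"
        using LIMSEQ_inverse_real_of_nat by (auto simp: filterlim_at inverse_eq_divide)
      ultimately show "(\<lambda>n. s n x) \<longlonglongrightarrow> dd f b x"
        unfolding s_def by (rule filterlim_compose)
    qed
    show "AE x in lborel. norm (s n x) \<le> M * indicator (cball 0 (R + norm b)) x" for n
    proof (rule AE_I2)
      fix x
      define h where "h = 1 / real (Suc n)"
      have h: "0 < h" "h \<le> 1" by (auto simp: h_def)
      have s: "s n x = (f (x + h *\<^sub>R b) - f x) / h" by (simp add: s_def h_def)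
      obtain z where "f (x + h *\<^sub>R b) - f (x + 0 *\<^sub>R b) = (h - 0) * dd f b (x + z *\<^sub>R b)"
        using MVT2[OF h(1), of "\<lambda>t. f (x + t *\<^sub>R b)" "\<lambda>t. dd f b (x + t *\<^sub>R b)"]
          smooth_line_derivative[OF f] by blast
      then have "\<bar>s n x\<bar> \<le> M" using M(2) h by (simp add: s abs_mult)
      moreover have "s n x = 0" if "x \<notin> cball 0 (R + norm b)"
      proof -
        have "norm x \<le> norm (x + h *\<^sub>R b) + norm (h *\<^sub>R b)"
          using norm_triangle_ineq4[of "x + h *\<^sub>R b" "h *\<^sub>R b"] by simp
        also have "norm (h *\<^sub>R b) \<le> norm b" using h by (simp add: mult_left_le_one_le)
        finally have "norm (x + h *\<^sub>R b) > R" using that by simp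
        moreover have "norm x > R" using that norm_ge_zero[of b] unfolding mem_cball_0 by linarith
        ultimately have "x + h *\<^sub>R b \<notin> K" "x \<notin> K" using R by auto
        then show ?thesis using K(2) by (simp add: s)
      qed
      ultimately show "norm (s n x) \<le> M * indicator (cball 0 (R + norm b)) x"
        by (cases "x \<in> cball 0 (R + norm b)") auto
    qed
  qed
  moreover have "(LINT x|lborel. s n x) = 0" for n
  proof -
    have i: "integrable lborel f"
      by (rule integrable_compact_support[OF smooth_continuous[OF f] K])
    have "(LINT x|lborel. f (x + a) - f x) = 0" for a
    proof -
      have "integrable lborel (\<lambda>x. f (a + x))"
        using i lborel_distr_plus[of a] integrable_distr[of "(+) a" lborel borel f] by simp
      then have "integrable lborel (\<lambda>x. f (x + a))" by (simp add: add.commute)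
      then show ?thesis using i by (simp add: integral_lborel_translation bm)
    qed
    then show ?thesis by (simp add: s_def)
  qed
  ultimately show ?thesis by (simp add: LIMSEQ_const_iff)
qed

text \<open>The difference of the two integrands is the divergence of \<open>W \<nabla>\<phi> - \<phi> \<nabla>W\<close>, a field with compact support.\<close>
lemma green_identity:
  fixes \<phi> W :: "'a::euclidean_space \<Rightarrow> real"
  assumes \<phi>: "smooth \<phi>" and K: "compact K" "\<And>x. x \<notin> K \<Longrightarrow> \<phi> x = 0" and W: "smooth W"
  shows "(LINT x|lborel. W x * laplacian \<phi> x) = (LINT x|lborel. \<phi> x * laplacian W x)"
proof -
  have Kc: "closed K" using K(1) compact_imp_closed by blast
  define X where "X b x = W x * dd \<phi> b x - \<phi> x * dd W b x" for b x
  have X: "smooth (X b)" for b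
    unfolding X_def[abs_def] by (intro smooth_diff smooth_mult smooth_dd \<phi> W)
  have X0: "X b x = 0" if "x \<notin> K" for b x
    using dd_outside_support[OF Kc K(2) that] K(2)[OF that] by (simp add: X_def)
  have Xd: "dd (X b) b x = W x * dd (dd \<phi> b) b x - \<phi> x * dd (dd W b) b x" for b x
  proof -
    have "(X b has_derivative (\<lambda>v. (W x * dd (dd \<phi> b) v x + dd W v x * dd \<phi> b x)
        - (\<phi> x * dd (dd W b) v x + dd \<phi> v x * dd W b x))) (at x)"
      unfolding X_def[abs_def]
      by (intro has_derivative_diff has_derivative_mult smooth_has_derivative smooth_dd \<phi> W)
    from dd_eqI[OF this] show ?thesis by simp
  qed
  have int: "integrable lborel (dd (X b) b)" for b
    by (rule integrable_compact_support[OF smooth_continuous[OF smooth_dd[OF X]] K(1)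
      dd_outside_support[OF Kc X0]])
  have i1: "integrable lborel (\<lambda>x. W x * laplacian \<phi> x)"
    by (rule integrable_compact_support[OF smooth_continuous[OF smooth_mult[OF W smooth_laplacian[OF \<phi>]]] K(1)])
      (simp add: laplacian_outside_support[OF Kc K(2)])
  have i2: "integrable lborel (\<lambda>x. \<phi> x * laplacian W x)"
    by (rule integrable_compact_support[OF smooth_continuous[OF smooth_mult[OF \<phi> smooth_laplacian[OF W]]] K(1)])
      (simp add: K(2))
  have "(LINT x|lborel. W x * laplacian \<phi> x) - (LINT x|lborel. \<phi> x * laplacian W x)
      = (LINT x|lborel. W x * laplacian \<phi> x - \<phi> x * laplacian W x)"
    by (rule Bochner_Integration.integral_diff[symmetric]) (rule i1 i2)+
  also have "\<dots> = (LINT x|lborel. (\<Sum>b\<in>Basis. dd (X b) b x))"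
    by (simp add: Xd laplacian_def sum_subtractf sum_distrib_left)
  also have "\<dots> = (\<Sum>b\<in>Basis. LINT x|lborel. dd (X b) b x)"
    by (rule Bochner_Integration.integral_sum) (rule int)
  also have "\<dots> = 0"
    using integral_dd_eq_0[OF X K(1) X0] by simp
  finally show ?thesis by simp
qed

lemma integral_laplacian_eq_0:
  fixes \<phi> :: "'a::euclidean_space \<Rightarrow> real"
  assumes "smooth \<phi>" "compact K" "\<And>x. x \<notin> K \<Longrightarrow> \<phi> x = 0"
  shows "(LINT x|lborel. laplacian \<phi> x) = 0"
  using green_identity[OF assms smooth_const[of 1]] by (simp add: laplacian_const)


section \<open>A compactly supported approximation of the fundamental solution\<close>

definition power_deriv :: "real \<Rightarrow> nat \<Rightarrow> real \<Rightarrow> real" where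
  "power_deriv q n t = (\<Prod>i<n. - q - real i) * t powr (- q - real n)"

lemma DERIV_power_deriv:
  assumes "t \<in> {0<..}"
  shows "(power_deriv q n has_real_derivative power_deriv q (Suc n) t) (at t)"
  using assms unfolding power_deriv_def[abs_def]
  by (auto intro!: derivative_eq_intros has_real_derivative_powr simp: algebra_simps)

text \<open>Test functions that are subharmonic outside a small bad ball, of radius \<open>s\<close>, and strictly
  subharmonic on a fixed shell. As the integral of the Laplacian is \<open>0\<close>, a bad ball is inevitable.\<close>
definition subharmonic_kernel ::
  "real \<Rightarrow> real \<Rightarrow> real \<Rightarrow> real \<Rightarrow> real \<Rightarrow> ('a::euclidean_space \<Rightarrow> real) \<Rightarrow> bool" where
  "subharmonic_kernel a c s B D \<phi> \<longleftrightarrow>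
     smooth \<phi> \<and> 0 < s \<and> s < a \<and> 0 < B \<and> 0 < D \<and>
       (\<forall>y. 0 \<le> \<phi> y \<and> \<phi> y \<le> B) \<and> (\<forall>y. 2 \<le> norm y \<longrightarrow> \<phi> y = 0) \<and>
       (\<forall>y. s \<le> norm y \<longrightarrow> 0 \<le> laplacian \<phi> y) \<and> (\<forall>y. - D \<le> laplacian \<phi> y) \<and>
       (\<forall>y. a \<le> norm y \<and> norm y \<le> 3/2 \<longrightarrow> c \<le> laplacian \<phi> y)"

text \<open>The order of the quantifiers matters: \<open>c\<close> depends on the shell only, while \<open>D s\<^sup>N\<^sup>+\<^sup>1\<close> is arbitrarily
  small. This product bounds the contribution of the bad ball to \<open>\<integral> w \<Delta>\<phi>\<close> when \<open>0 \<le> w \<le> s\<close> there, since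
  the ball has volume of order \<open>s\<^sup>N\<close>.

  With \<open>T = |y|\<^sup>2 + \<sigma>\<^sup>2\<close> the kernel is the smooth positive part of \<open>T\<^sup>-\<^sup>q - 4\<^sup>-\<^sup>q\<close>. The Laplacian of
  \<open>T\<^sup>-\<^sup>q\<close> is \<open>2 q T\<^sup>-\<^sup>q\<^sup>-\<^sup>2 ((2 q + 2 - N) |y|\<^sup>2 - N \<sigma>\<^sup>2)\<close>, which is positive for \<open>|y|\<close> larger than a multiple
  of \<open>\<sigma>\<close> provided \<open>2 q > N - 2\<close>, and never below \<open>- C \<sigma>\<^sup>-\<^sup>2\<^sup>q\<^sup>-\<^sup>2\<close>. Thus \<open>D s\<^sup>N\<^sup>+\<^sup>1\<close> is of order
  \<open>\<sigma>\<^sup>N\<^sup>-\<^sup>1\<^sup>-\<^sup>2\<^sup>q\<close> and tends to \<open>0\<close> provided \<open>2 q < N - 1\<close>.\<close>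
lemma subharmonic_kernel_exists:
  fixes a :: real
  assumes dim: "DIM('a::euclidean_space) \<ge> 2" and a: "0 < a"
  obtains c where "c > 0"
    "\<And>\<eta>. \<eta> > 0 \<Longrightarrow> \<exists>(\<phi>::'a \<Rightarrow> real) s B D. subharmonic_kernel a c s B D \<phi> \<and> D * s ^ (DIM('a) + 1) \<le> \<eta>"
proof -
  define n where "n = DIM('a)"
  \<comment> \<open>the midpoint choice: \<open>2 q = N - 3/2\<close> lies strictly between \<open>N - 2\<close> and
    \<open>N - 1\<close>\<close>
  define q where "q = real n / 2 - 3/4"
  have n: "real n \<ge> 2" using dim by (simp add: n_def)
  have q: "q > 0" using n by (simp add: q_def)
  have split1: "- q - 1 = (- q - 2) + 1" by simp
  \<comment> \<open>a lower bound, uniform in \<open>\<sigma> \<le> 1/2\<close>, for the truncated power where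
    \<open>|y| \<le> 3/2\<close>\<close>
  define t0 where "t0 = (5/2) powr (-q) - 4 powr (-q)"
  have t0: "t0 > 0" using q by (simp add: t0_def powr_less_mono2_neg)
  define c where "c = exp (- (1 / t0)) * (2 * q * 4 powr (- q - 2) * (a\<^sup>2 / 4))"
  have "c > 0" using a q by (simp add: c_def)
  moreover
  have "\<exists>(\<phi>::'a \<Rightarrow> real) s B D. subharmonic_kernel a c s B D \<phi> \<and> D * s ^ (DIM('a) + 1) \<le> \<eta>" if \<eta>: "\<eta> > 0" for \<eta>
  proof -
    define C where "C = 2 * q * real n * sqrt (2 * real n) ^ (n + 1)"
    have C: "C > 0" using q n by (simp add: C_def)
    \<comment> \<open>the three bounds give \<open>T \<le> 5/2\<close> on the shell, subharmonicity on the shell, and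
      \<open>C \<sigma>\<^sup>1\<^sup>/\<^sup>2 \<le> \<eta>\<close>\<close>
    define \<sigma> where "\<sigma> = min (1/2) (min (a / (2 * sqrt (real n))) ((\<eta> / C)\<^sup>2))"
    have \<sigma>: "\<sigma> > 0" "\<sigma> \<le> 1/2" "\<sigma> \<le> a / (2 * sqrt (real n))" "\<sigma> \<le> (\<eta> / C)\<^sup>2"
      using a n \<eta> C by (auto simp: \<sigma>_def)
    define s where "s = sqrt (2 * real n) * \<sigma>"
    define B where "B = (\<sigma>\<^sup>2) powr (- q)"
    define D where "D = 2 * q * real n * (\<sigma>\<^sup>2) powr (- q - 1)"
    have s: "s > 0" and B: "B > 0" and D: "D > 0" using \<sigma> n q by (auto simp: s_def B_def D_def)
    have s2: "s\<^sup>2 = 2 * real n * \<sigma>\<^sup>2" by (simp add: s_def power_mult_distrib)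
    have a2: "4 * real n * \<sigma>\<^sup>2 \<le> a\<^sup>2"
    proof -
      have "(2 * sqrt (real n) * \<sigma>)\<^sup>2 \<le> a\<^sup>2"
        using \<sigma> n a by (intro power_mono) (auto simp: field_simps)
      then show ?thesis by (simp add: power_mult_distrib)
    qed
    have "s\<^sup>2 < a\<^sup>2" 
    proof -
      have "0 < real n * \<sigma>\<^sup>2" using \<sigma>(1) n by simp
      then show ?thesis using a2 s2 by linarith
    qed
    then have sa: "s < a" using a by (simp add: power2_less_imp_less)
    define T where "T y = (norm y)\<^sup>2 + \<sigma>\<^sup>2" for y :: 'a
    have T: "smooth T" unfolding T_def[abs_def] by (intro smooth_add smooth_sqnorm smooth_const)
    have Tpos: "T y \<in> {0<..}" for y using \<sigma>(1) by (simp add: T_def add_nonneg_pos)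
    have ddT: "dd T b y = 2 * (y \<bullet> b)" for b y
      using dd_add[OF smooth_sqnorm smooth_const, of "\<sigma>\<^sup>2" y b] by (simp add: T_def[abs_def] dd_sqnorm dd_const)
    have lapT: "laplacian T y = 2 * real n" for y
      using laplacian_add[OF smooth_sqnorm smooth_const, of "\<sigma>\<^sup>2" y]
      by (simp add: T_def[abs_def] laplacian_sqnorm laplacian_const n_def)
    have gradT: "(\<Sum>b\<in>Basis. (dd T b y)\<^sup>2) = 4 * (norm y)\<^sup>2" for y
      by (simp add: ddT power_mult_distrib power2_norm_eq_inner euclidean_inner[of y y]
          flip: sum_distrib_left power2_eq_square)
    define P where "P y = power_deriv q 0 (T y)" for y
    have P: "smooth P"
      unfolding P_def[abs_def] by (rule smooth_compose[of "{0<..}" "power_deriv q" T, OF DERIV_power_deriv T Tpos])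
    have lapP: "laplacian P y = 2 * q * T y powr (- q - 2) * ((norm y)\<^sup>2 / 2 - real n * \<sigma>\<^sup>2)" for y
    proof -
      have "laplacian P y = power_deriv q (Suc (Suc 0)) (T y) * (4 * (norm y)\<^sup>2)
          + power_deriv q (Suc 0) (T y) * (2 * real n)"
        unfolding P_def[abs_def]
        by (subst laplacian_compose[of "{0<..}" "power_deriv q" T, OF DERIV_power_deriv T Tpos]) (simp_all add: gradT lapT)
      moreover have "power_deriv q (Suc (Suc 0)) (T y) = q * (q + 1) * T y powr (- q - 2)"
        by (simp add: power_deriv_def lessThan_Suc algebra_simps)
      moreover have "power_deriv q (Suc 0) (T y) = - q * (T y powr (- q - 2) * T y)"
      proof -
        have "T y powr (- q - 1) = T y powr (- q - 2) * T y"
          unfolding split1 powr_add using Tpos[of y] by simp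
        then show ?thesis by (simp add: power_deriv_def)
      qed
      moreover have "q * (q + 1) * E * (4 * A) + - q * (E * (A + S)) * (2 * real n)
          = 2 * q * E * (A / 2 - real n * S)" for E A S :: real
      proof -
        have "real n = 2 * q + 3/2" by (simp add: q_def)
        then show ?thesis by (simp add: field_simps)
      qed
      ultimately show ?thesis by (simp add: T_def)
    qed
    define w where "w y = P y - 4 powr (- q)" for y
    have w: "smooth w" unfolding w_def[abs_def] by (intro smooth_diff P smooth_const)
    have lapw: "laplacian w y = laplacian P y" for y
      unfolding w_def[abs_def] by (simp add: laplacian_diff P smooth_const laplacian_const)
    define \<phi> where "\<phi> y = soft_pos 0 (w y)" for y
    have \<phi>: "smooth \<phi>"
      unfolding \<phi>_def[abs_def] by (rule smooth_compose[of UNIV soft_pos w, OF DERIV_soft_pos w]) simp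
    have lap\<phi>: "soft_pos (Suc 0) (w y) * laplacian P y \<le> laplacian \<phi> y" for y
    proof -
      have "laplacian \<phi> y = soft_pos (Suc (Suc 0)) (w y) * (\<Sum>b\<in>Basis. (dd w b y)\<^sup>2)
        + soft_pos (Suc 0) (w y) * laplacian w y"
        unfolding \<phi>_def[abs_def] by (rule laplacian_compose[of UNIV soft_pos w, OF DERIV_soft_pos w]) simp
      then show ?thesis by (simp add: lapw soft_pos_bounds sum_nonneg)
    qed
    have Pval: "P y = T y powr (- q)" for y by (simp add: P_def power_deriv_def)
    have "\<phi> y \<le> B" for y
    proof -
      have "P y \<le> B" unfolding Pval B_def
        using \<sigma> q by (intro powr_mono2') (auto simp: T_def)
      then have "max (w y) 0 \<le> B" using B powr_ge_zero[of 4 "- q"] unfolding w_def by linarith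
      then show ?thesis unfolding \<phi>_def using soft_pos_bounds(2)[of "w y"] by linarith
    qed
    moreover have "0 \<le> \<phi> y" for y by (simp add: \<phi>_def soft_pos_bounds)
    moreover have "\<phi> y = 0" if "2 \<le> norm y" for y
    proof -
      have "2\<^sup>2 \<le> (norm y)\<^sup>2" using that by (intro power_mono) auto
      then have "4 \<le> T y" by (simp add: T_def add_increasing2)
      then have "P y \<le> 4 powr (- q)" unfolding Pval using q by (intro powr_mono2') auto
      then show ?thesis by (simp add: \<phi>_def soft_pos_0 w_def)
    qed
    moreover have "0 \<le> laplacian \<phi> y" if "s \<le> norm y" for y
    proof -
      have "s\<^sup>2 \<le> (norm y)\<^sup>2" using that s by (intro power_mono) auto
      then have "0 \<le> laplacian P y" unfolding lapP s2 using q by simp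
      then show ?thesis using lap\<phi>[of y] soft_pos_bounds(4)[of "w y"]
        by (meson mult_nonneg_nonneg order_trans)
    qed
    moreover have "- D \<le> laplacian \<phi> y" for y
    proof -
      have "T y powr (- q - 2) \<le> (\<sigma>\<^sup>2) powr (- q - 2)"
        using \<sigma> q by (intro powr_mono2') (auto simp: T_def)
      then have "2 * q * (real n * \<sigma>\<^sup>2) * T y powr (- q - 2) \<le> 2 * q * (real n * \<sigma>\<^sup>2) * (\<sigma>\<^sup>2) powr (- q - 2)"
        using q by (intro mult_left_mono) auto
      also have "\<dots> = D" using \<sigma>(1) unfolding D_def split1 powr_add by simp
      finally have "2 * q * (real n * \<sigma>\<^sup>2) * T y powr (- q - 2) \<le> D" .
      moreover have "0 \<le> 2 * q * T y powr (- q - 2) * ((norm y)\<^sup>2 / 2)" using q by simp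
      ultimately have 1: "- D \<le> laplacian P y" unfolding lapP by (simp add: algebra_simps)
      have "- D \<le> soft_pos (Suc 0) (w y) * (- D)"
        using D soft_pos_bounds(5)[of "w y"] by (simp add: mult_left_le_one_le soft_pos_bounds(4))
      also have "\<dots> \<le> soft_pos (Suc 0) (w y) * laplacian P y"
        using 1 by (intro mult_left_mono soft_pos_bounds(4))
      finally show ?thesis using lap\<phi>[of y] by linarith
    qed
    moreover have "c \<le> laplacian \<phi> y" if y: "a \<le> norm y" "norm y \<le> 3/2" for y
    proof -
      have ya: "a\<^sup>2 \<le> (norm y)\<^sup>2" using y(1) a by (intro power_mono) auto
      have "(norm y)\<^sup>2 \<le> (3/2)\<^sup>2" "\<sigma>\<^sup>2 \<le> (1/2)\<^sup>2" using y(2) \<sigma> by (auto intro!: power_mono)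
      then have T5: "T y \<le> 5/2" by (simp add: T_def power2_eq_square)
      then have "(5/2) powr (-q) \<le> P y" unfolding Pval
        using q Tpos[of y] by (intro powr_mono2') auto
      then have "t0 \<le> w y" by (simp add: w_def t0_def)
      then have "1 / w y \<le> 1 / t0" "w y > 0" using t0 by (auto simp: frac_le)
      then have e: "exp (- (1 / t0)) \<le> soft_pos (Suc 0) (w y)"
      proof -
        have "exp (- (1 / t0)) \<le> exp (- (1 / w y))" using \<open>1 / w y \<le> 1 / t0\<close> by simp
        also have "\<dots> \<le> (1 + 1 / w y) * exp (- (1 / w y))"
          using \<open>w y > 0\<close> by (simp add: distrib_right)
        finally show ?thesis using \<open>w y > 0\<close> by (simp add: soft_pos_1)
      qed
      have "4 powr (- q - 2) \<le> T y powr (- q - 2)"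
        using T5 q Tpos[of y] by (intro powr_mono2') auto
      moreover have "a\<^sup>2 / 4 \<le> (norm y)\<^sup>2 / 2 - real n * \<sigma>\<^sup>2" using ya a2 by linarith
      ultimately have "2 * q * 4 powr (- q - 2) * (a\<^sup>2 / 4) \<le> laplacian P y"
        unfolding lapP using q by (intro mult_mono) auto
      with e have "c \<le> soft_pos (Suc 0) (w y) * laplacian P y"
        unfolding c_def using q by (intro mult_mono) (auto simp: soft_pos_bounds)
      then show ?thesis using lap\<phi>[of y] by linarith
    qed
    moreover have "D * s ^ (DIM('a) + 1) \<le> \<eta>"
    proof -
      have "(\<sigma>\<^sup>2) powr (- q - 1) = (\<sigma> powr 2) powr (- q - 1)" using \<sigma>(1) by simp
      also have "\<dots> = \<sigma> powr (- 2 * q - 2)" by (simp add: powr_powr algebra_simps)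
      finally have "(\<sigma>\<^sup>2) powr (- q - 1) * \<sigma> ^ (n + 1) = \<sigma> powr (- 2 * q - 2) * \<sigma> powr (n + 1)"
        using \<sigma>(1) powr_realpow[of \<sigma> "n + 1"] by simp
      also have "\<dots> = \<sigma> powr (1/2)" unfolding powr_add[symmetric] by (simp add: q_def)
      also have "\<dots> = sqrt \<sigma>" using \<sigma>(1) by (simp add: powr_half_sqrt)
      also have "\<dots> \<le> \<eta> / C" using real_sqrt_le_mono[OF \<sigma>(4)] \<eta> C by simp
      finally have "C * ((\<sigma>\<^sup>2) powr (- q - 1) * \<sigma> ^ (n + 1)) \<le> \<eta>" using C by (simp add: field_simps)
      then show ?thesis by (simp add: D_def s_def C_def power_mult_distrib n_def mult_ac)
    qed
    ultimately show ?thesis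
      unfolding subharmonic_kernel_def using \<phi> s sa B D by blast
  qed
  ultimately show ?thesis by (rule that)
qed


section \<open>Mollification\<close>

lemma smooth_bump:
  obtains b :: "'a::euclidean_space \<Rightarrow> real" where
    "smooth b" "\<And>y. 0 \<le> b y" "\<And>y. norm y \<le> 3/2 \<Longrightarrow> 1 \<le> b y" "\<And>y. 2 \<le> norm y \<Longrightarrow> b y = 0"
    "\<And>y. b (- y) = b y"
proof -
  define m :: real where "m = 7/4 * exp (- (4/7))"
  have m: "m > 0" by (simp add: m_def)
  define w where "w y = 4 + (-1) * (norm y)\<^sup>2" for y :: 'a
  have w: "smooth w" unfolding w_def[abs_def] by (intro smooth_intros smooth_sqnorm)
  define b where "b y = (1 / m) * soft_pos 0 (w y)" for y
  have "smooth b"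
    unfolding b_def[abs_def]
    by (intro smooth_mult smooth_const smooth_compose[of UNIV soft_pos w, OF DERIV_soft_pos w]) simp
  moreover have "0 \<le> b y" for y using m by (simp add: b_def soft_pos_bounds)
  moreover have "1 \<le> b y" if "norm y \<le> 3/2" for y
  proof -
    have "(norm y)\<^sup>2 \<le> (3/2)\<^sup>2" using that by (intro power_mono) auto
    then have 1: "7/4 \<le> w y" by (simp add: w_def power2_eq_square)
    then have "m \<le> w y * exp (- (1 / w y))"
      unfolding m_def by (intro mult_mono) (auto simp: field_simps)
    with 1 m show ?thesis by (simp add: b_def soft_pos_0)
  qed
  moreover have "b y = 0" if "2 \<le> norm y" for y
  proof -
    have "2\<^sup>2 \<le> (norm y)\<^sup>2" using that by (intro power_mono) auto
    then show ?thesis by (simp add: b_def w_def soft_pos_0)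
  qed
  moreover have "b (- y) = b y" for y by (simp add: b_def w_def)
  ultimately show ?thesis by (rule that)
qed

text \<open>The bump is even, so that averaging around \<open>x\<close> has total weight \<open>1\<close> by translation invariance alone.\<close>
lemma mollifier:
  assumes \<delta>: "\<delta> > 0"
  obtains \<rho> :: "'a::euclidean_space \<Rightarrow> real" where
    "smooth \<rho>" "\<And>y. 0 \<le> \<rho> y" "\<And>y. \<delta> \<le> norm y \<Longrightarrow> \<rho> y = 0"
    "\<And>x. (LINT y|lborel. \<rho> (x - y)) = 1"
proof -
  obtain b :: "'a \<Rightarrow> real" where b: "smooth b" "\<And>y. 0 \<le> b y" "\<And>y. norm y \<le> 3/2 \<Longrightarrow> 1 \<le> b y"
    "\<And>y. 2 \<le> norm y \<Longrightarrow> b y = 0" "\<And>y. b (- y) = b y"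
    using smooth_bump by metis
  define g where "g y = b ((2 / \<delta>) *\<^sub>R y + 0)" for y
  have g: "smooth g" unfolding g_def[abs_def] by (rule smooth_affine[OF b(1)])
  have g0: "g y = 0" if "\<delta> \<le> norm y" for y
    unfolding g_def using that \<delta> by (intro b(4)) (simp add: field_simps)
  have gs: "g (- y) = g y" for y using b(5)[of "(2 / \<delta>) *\<^sub>R y"] by (simp add: g_def)
  have ig: "integrable lborel g"
    by (rule integrable_compact_support[OF smooth_continuous[OF g], of "cball 0 \<delta>"]) (auto intro!: g0)
  define I where "I = (LINT y|lborel. g y)"
  have "0 < measure lborel (ball (0::'a) (\<delta>/2))" using \<delta> by simp
  also have "\<dots> = (LINT y|lborel. indicator (ball (0::'a) (\<delta>/2)) y)" by simp
  also have "\<dots> \<le> I" unfolding I_def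
  proof (rule integral_mono[OF _ ig])
    show "integrable lborel (indicator (ball (0::'a) (\<delta>/2)) :: 'a \<Rightarrow> real)"
      by (intro integrable_real_indicator) (use emeasure_lborel_ball_finite[of "0::'a" "\<delta>/2"] in auto)
    show "indicator (ball 0 (\<delta>/2)) y \<le> g y" for y
    proof (cases "y \<in> ball 0 (\<delta>/2)")
      case True
      then show ?thesis using b(3)[of "(2 / \<delta>) *\<^sub>R y"] \<delta> by (simp add: g_def field_simps)
    qed (simp add: g_def b(2))
  qed
  finally have I: "I > 0" .
  define \<rho> where "\<rho> y = (1 / I) * g y" for y
  have "smooth \<rho>" unfolding \<rho>_def[abs_def] by (intro smooth_mult smooth_const g)
  moreover have "0 \<le> \<rho> y" for y using I by (simp add: \<rho>_def g_def b(2))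
  moreover have "\<rho> y = 0" if "\<delta> \<le> norm y" for y using g0[OF that] by (simp add: \<rho>_def)
  moreover have "(LINT y|lborel. \<rho> (x - y)) = 1" for x
  proof -
    have "(LINT y|lborel. \<rho> (x - y)) = (LINT y|lborel. \<rho> (y + (- x)))"
      using gs by (intro Bochner_Integration.integral_cong refl) (metis \<rho>_def minus_diff_eq uminus_add_conv_diff add.commute)
    also have "\<dots> = (LINT y|lborel. \<rho> y)"
      by (intro integral_lborel_translation borel_measurable_continuous_onI smooth_continuous \<open>smooth \<rho>\<close>)
    also have "\<dots> = 1" using I by (simp add: \<rho>_def I_def)
    finally show ?thesis .
  qed
  ultimately show ?thesis by (rule that)
qed

definition convolve :: "('a::euclidean_space \<Rightarrow> real) \<Rightarrow> ('a \<Rightarrow> real) \<Rightarrow> 'a \<Rightarrow> real" where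
  "convolve v \<rho> x = (LINT y|lborel. v y * \<rho> (x - y))"

context
  fixes v :: "'a::euclidean_space \<Rightarrow> real" and K :: "'a set"
  assumes v: "continuous_on UNIV v" and K: "compact K" and v0: "\<And>x. x \<notin> K \<Longrightarrow> v x = 0"
begin

lemma continuous_convolve_integrand:
  assumes "continuous_on UNIV \<rho>" shows "continuous_on UNIV (\<lambda>y. v y * \<rho> (x - y))"
  by (intro continuous_intros v continuous_on_compose2[OF assms]) auto

lemma integrable_convolve:
  assumes "continuous_on UNIV \<rho>" shows "integrable lborel (\<lambda>y. v y * \<rho> (x - y))"
  by (rule integrable_compact_support[OF continuous_convolve_integrand[OF assms] K]) (simp add: v0)

text \<open>Differentiation under the integral sign over a box containing the support of \<open>v\<close>. The derivative is
  again a convolution, so smoothness follows by induction.\<close>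
lemma convolve_has_derivative:
  assumes \<rho>: "smooth \<rho>"
  shows "(convolve v \<rho> has_derivative (\<lambda>h. convolve v (dd \<rho> h) x)) (at x)"
proof -
  obtain a where a: "K \<subseteq> cbox (- a) a"
    using bounded_subset_cbox_symmetric[OF compact_imp_bounded[OF K]] by blast
  have eq: "convolve v \<rho>' x = integral (cbox (- a) a) (\<lambda>y. v y * \<rho>' (x - y))"
    if \<rho>': "continuous_on UNIV \<rho>'" for \<rho>' x
  proof -
    have "(\<lambda>y. v y * \<rho>' (x - y)) integrable_on cbox (- a) a"
      by (intro integrable_continuous continuous_on_subset[OF continuous_convolve_integrand[OF \<rho>']]) auto
    then have "((\<lambda>y. v y * \<rho>' (x - y)) has_integral integral (cbox (- a) a) (\<lambda>y. v y * \<rho>' (x - y))) UNIV"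
      using a v0 by (intro has_integral_on_superset[OF integrable_integral]) auto
    from integral_unique[OF this] show ?thesis
      by (simp only: convolve_def integral_lborel[OF integrable_convolve[OF \<rho>']])
  qed
  define D where "D x t = Blinfun (\<lambda>h. v t * dd \<rho> h (x - t))" for x t
  have D: "blinfun_apply (D x t) = (\<lambda>h. v t * dd \<rho> h (x - t))" for x t
    unfolding D_def
    by (rule bounded_linear_Blinfun_apply)
      (intro bounded_linear_const_mult has_derivative_bounded_linear[OF smooth_has_derivative[OF \<rho>]])
  have cD: "continuous_on (UNIV \<times> cbox (- a) a) (\<lambda>(x, t). D x t)"
    unfolding case_prod_beta
  proof (rule continuous_on_blinfun_componentwise)
    fix i :: 'a
    show "continuous_on (UNIV \<times> cbox (- a) a) (\<lambda>p. blinfun_apply (D (fst p) (snd p)) i)"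
      unfolding D
      by (intro continuous_intros continuous_on_compose2[OF v]
          continuous_on_compose2[OF smooth_continuous[OF smooth_dd[OF \<rho>], of UNIV i]]) auto
  qed
  have "((\<lambda>x. integral (cbox (- a) a) (\<lambda>y. v y * \<rho> (x - y)))
      has_derivative integral (cbox (- a) a) (D x)) (at x within UNIV)"
  proof (rule leibniz_rule[OF _ _ cD])
    fix x t
    have "((\<lambda>x. \<rho> (x - t)) has_derivative (\<lambda>h. dd \<rho> h (x - t))) (at x)"
      by (rule has_derivative_compose[OF _ smooth_has_derivative[OF \<rho>]])
        (auto intro!: derivative_eq_intros)
    then show "((\<lambda>x. v t * \<rho> (x - t)) has_derivative blinfun_apply (D x t)) (at x within UNIV)"
      unfolding D by (auto intro: has_derivative_mult_right)
  next
    fix x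
    show "(\<lambda>y. v y * \<rho> (x - y)) integrable_on cbox (- a) a"
      by (intro integrable_continuous continuous_on_subset[OF continuous_convolve_integrand[OF smooth_continuous[OF \<rho>]]]) auto
  qed auto
  moreover have "blinfun_apply (integral (cbox (- a) a) (D x)) = (\<lambda>h. convolve v (dd \<rho> h) x)"
  proof
    fix h
    have "D x integrable_on cbox (- a) a"
      by (intro integrable_continuous continuous_on_compose2[OF cD, where f = "\<lambda>t. (x, t)", simplified])
        (auto intro!: continuous_intros)
    then show "blinfun_apply (integral (cbox (- a) a) (D x)) h = convolve v (dd \<rho> h) x"
      by (subst blinfun_apply_integral) (simp_all add: D eq smooth_continuous[OF smooth_dd[OF \<rho>]])
  qed
  ultimately show ?thesis
    by (simp add: eq[OF smooth_continuous[OF \<rho>], abs_def])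
qed

lemma dd_convolve: "smooth \<rho> \<Longrightarrow> dd (convolve v \<rho>) h x = convolve v (dd \<rho> h) x"
  by (rule dd_eqI[OF convolve_has_derivative])

lemma Ck_convolve: "smooth \<rho> \<Longrightarrow> Ck k (convolve v \<rho>)"
proof (induction k arbitrary: \<rho>)
  case 0
  have "convolve v \<rho> differentiable (at x)" for x
    using convolve_has_derivative[OF 0] unfolding differentiable_def by blast
  then show ?case
    by (auto simp: continuous_on_eq_continuous_at intro: differentiable_imp_continuous_within)
next
  case (Suc k)
  show ?case
    by (rule Ck_SucI[OF convolve_has_derivative[OF Suc.prems]]) (rule Suc.IH[OF smooth_dd[OF Suc.prems]])
qed

lemma smooth_convolve: "smooth \<rho> \<Longrightarrow> smooth (convolve v \<rho>)"
  by (simp add: smooth_def[of "convolve v \<rho>"] Ck_convolve)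

lemma laplacian_convolve:
  assumes \<rho>: "smooth \<rho>"
  shows "laplacian (convolve v \<rho>) x = convolve v (laplacian \<rho>) x"
proof -
  have 1: "dd (convolve v \<rho>) b = convolve v (dd \<rho> b)" for b by (rule ext) (rule dd_convolve[OF \<rho>])
  have "dd (dd (convolve v \<rho>) b) b x = convolve v (dd (dd \<rho> b) b) x" for b
    unfolding 1 by (rule dd_convolve[OF smooth_dd[OF \<rho>]])
  then have "laplacian (convolve v \<rho>) x = (\<Sum>b\<in>Basis. LINT y|lborel. v y * dd (dd \<rho> b) b (x - y))"
    by (simp add: laplacian_def convolve_def)
  also have "\<dots> = (LINT y|lborel. (\<Sum>b\<in>Basis. v y * dd (dd \<rho> b) b (x - y)))"
    by (intro Bochner_Integration.integral_sum[symmetric] integrable_convolve smooth_continuous smooth_dd \<rho>)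
  finally show ?thesis by (simp add: convolve_def laplacian_def sum_distrib_left)
qed

lemma convolve_close:
  assumes \<rho>: "smooth \<rho>" "\<And>y. 0 \<le> \<rho> y" "\<And>y. \<delta> \<le> norm y \<Longrightarrow> \<rho> y = 0" "\<And>x. (LINT y|lborel. \<rho> (x - y)) = 1"
    and \<epsilon>: "\<And>x y. dist x y < \<delta> \<Longrightarrow> \<bar>v x - v y\<bar> \<le> \<epsilon>"
  shows "\<bar>convolve v \<rho> x - v x\<bar> \<le> \<epsilon>"
proof -
  have i: "integrable lborel (\<lambda>y. \<rho> (x - y))"
    using \<rho>(4)[of x] not_integrable_integral_eq by fastforce
  have iv: "integrable lborel (\<lambda>y. v y * \<rho> (x - y))"
    by (rule integrable_convolve[OF smooth_continuous[OF \<rho>(1)]])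
  have "convolve v \<rho> x - v x = (LINT y|lborel. v y * \<rho> (x - y)) - (LINT y|lborel. v x * \<rho> (x - y))"
    by (simp add: convolve_def \<rho>(4))
  also have "\<dots> = (LINT y|lborel. v y * \<rho> (x - y) - v x * \<rho> (x - y))"
    by (rule Bochner_Integration.integral_diff[symmetric]) (auto intro: i iv)
  also have "\<bar>\<dots>\<bar> \<le> (LINT y|lborel. \<epsilon> * \<rho> (x - y))"
  proof (rule order_trans[OF integral_abs_bound integral_mono])
    show "integrable lborel (\<lambda>y. \<bar>v y * \<rho> (x - y) - v x * \<rho> (x - y)\<bar>)"
      by (intro integrable_abs Bochner_Integration.integrable_diff iv integrable_mult_right i)
    show "integrable lborel (\<lambda>y. \<epsilon> * \<rho> (x - y))" by (intro integrable_mult_right i)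
    show "\<bar>v y * \<rho> (x - y) - v x * \<rho> (x - y)\<bar> \<le> \<epsilon> * \<rho> (x - y)" for y
    proof (cases "norm (x - y) < \<delta>")
      case True
      then have "\<bar>v y - v x\<bar> \<le> \<epsilon>" using \<epsilon>[of y x] by (simp add: dist_norm norm_minus_commute)
      then show ?thesis
        using \<rho>(2)[of "x - y"] by (simp add: abs_mult mult_right_mono flip: left_diff_distrib)
    qed (use \<rho>(3)[of "x - y"] in auto)
  qed
  also have "\<dots> = \<epsilon>" by (simp add: \<rho>(4))
  finally show ?thesis .
qed

lemma uniform_modulus:
  assumes "\<epsilon> > 0"
  obtains \<delta> where "\<delta> > 0" "\<And>x y. dist x y < \<delta> \<Longrightarrow> \<bar>v x - v y\<bar> \<le> \<epsilon>"
proof -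
  define K' where "K' = {x + y |x y. x \<in> K \<and> y \<in> cball 0 1}"
  have "compact K'" unfolding K'_def by (intro compact_sums K compact_cball)
  then have "uniformly_continuous_on K' v"
    by (intro compact_uniformly_continuous continuous_on_subset[OF v]) auto
  then obtain d where d: "d > 0" "\<And>x y. x \<in> K' \<Longrightarrow> y \<in> K' \<Longrightarrow> dist x y < d \<Longrightarrow> dist (v x) (v y) < \<epsilon>"
    using assms unfolding uniformly_continuous_on_def by metis
  have K'I: "x \<in> K'" if "z \<in> K" "dist z x \<le> 1" for x z
  proof -
    have "x = z + (x - z)" "x - z \<in> cball 0 1"
      using that(2) by (auto simp: dist_norm norm_minus_commute)
    then show ?thesis unfolding K'_def using that(1) by blast
  qed
  have "\<bar>v x - v y\<bar> \<le> \<epsilon>" if "dist x y < min d 1" for x y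
  proof (cases "x \<in> K \<or> y \<in> K")
    case True
    then have "x \<in> K'" "y \<in> K'"
      using that K'I[of x x] K'I[of x y] K'I[of y x] K'I[of y y] by (auto simp: dist_commute)
    then show ?thesis using d(2)[of x y] that by (auto simp: dist_real_def)
  qed (use v0[of x] v0[of y] assms in auto)
  moreover have "min d 1 > 0" using d(1) by simp
  ultimately show ?thesis using that by blast
qed

end

section \<open>The differential inequality across the free boundary\<close>

text \<open>The equation is known in \<open>{v > 0}\<close> only, but the inequality holds for all nonnegative test functions.
  Let \<open>V\<close> and \<open>F\<close> be mollifications that differ from \<open>v\<close> and \<open>f\<close> by at most \<open>\<epsilon>\<close>. Where \<open>V > 2 \<epsilon>\<close>, the
  function \<open>v\<close> is positive on the whole ball of averaging, so \<open>\<Delta>V = - F\<close> there. The smooth positive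
  part \<open>W\<close> of \<open>V - 2 \<epsilon>\<close> vanishes everywhere else, and by convexity \<open>\<Delta>W \<ge> - F\<close> everywhere. Moving the
  Laplacian from \<open>W\<close> to \<open>\<phi>\<close> gives the claim up to an error of order \<open>\<epsilon>\<close>.\<close>
lemma kato_inequality:
  fixes v f :: "'a::euclidean_space \<Rightarrow> real"
  assumes v: "continuous_on UNIV v" "\<And>x. 0 \<le> v x" and f: "continuous_on UNIV f" "\<And>x. 0 \<le> f x"
    and K: "compact K" "\<And>x. x \<notin> K \<Longrightarrow> v x = 0" "\<And>x. x \<notin> K \<Longrightarrow> f x = 0"
    and eq: "\<And>\<psi>. test_function {x. 0 < v x} \<psi> \<Longrightarrow>
      (LINT x|lborel. v x * laplacian \<psi> x) = - (LINT x|lborel. f x * \<psi> x)"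
    and \<phi>: "smooth \<phi>" "compact S" "\<And>x. x \<notin> S \<Longrightarrow> \<phi> x = 0" "\<And>x. 0 \<le> \<phi> x"
  shows "0 \<le> (LINT x|lborel. v x * laplacian \<phi> x) + (LINT x|lborel. f x * \<phi> x)"
proof -
  define I where "I = (LINT x|lborel. 4 * \<bar>laplacian \<phi> x\<bar> + \<phi> x)"
  have Sc: "closed S" using \<phi>(2) compact_imp_closed by blast
  note lap0 = laplacian_outside_support[OF Sc \<phi>(3)]
  note c\<phi> = smooth_continuous[OF \<phi>(1)] smooth_continuous[OF smooth_laplacian[OF \<phi>(1)]]
  have int: "integrable lborel g" if "continuous_on UNIV g" "\<And>x. x \<notin> S \<Longrightarrow> g x = 0" for g :: "'a \<Rightarrow> real"
    using integrable_compact_support[OF that(1) \<phi>(2) that(2)] .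
  have iv: "integrable lborel (\<lambda>x. v x * laplacian \<phi> x)"
    and if': "integrable lborel (\<lambda>x. f x * \<phi> x)"
    and iI: "integrable lborel (\<lambda>x. 4 * \<bar>laplacian \<phi> x\<bar> + \<phi> x)"
    by (rule int; (intro continuous_intros v f c\<phi>)?; simp add: lap0 \<phi>(3))+
  have I: "0 \<le> I" unfolding I_def by (rule integral_nonneg_AE) (simp add: \<phi>(4))
  have main: "- (\<epsilon> * I) \<le> (LINT x|lborel. v x * laplacian \<phi> x) + (LINT x|lborel. f x * \<phi> x)"
    if \<epsilon>: "\<epsilon> > 0" for \<epsilon>
  proof -
    obtain d1 where d1: "d1 > 0" "\<And>x y. dist x y < d1 \<Longrightarrow> \<bar>v x - v y\<bar> \<le> \<epsilon>"
      using uniform_modulus[OF v(1) K(1,2) \<epsilon>] by metis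
    obtain d2 where d2: "d2 > 0" "\<And>x y. dist x y < d2 \<Longrightarrow> \<bar>f x - f y\<bar> \<le> \<epsilon>"
      using uniform_modulus[OF f(1) K(1,3) \<epsilon>] by metis
    define \<delta> where "\<delta> = min d1 d2 / 2"
    have \<delta>: "\<delta> > 0" "\<delta> < d1" "\<delta> < d2" using d1(1) d2(1) by (auto simp: \<delta>_def)
    obtain \<rho> :: "'a \<Rightarrow> real" where \<rho>: "smooth \<rho>" "\<And>y. 0 \<le> \<rho> y" "\<And>y. \<delta> \<le> norm y \<Longrightarrow> \<rho> y = 0"
      "\<And>x. (LINT y|lborel. \<rho> (x - y)) = 1" using mollifier[OF \<delta>(1)] by metis
    define V where "V = convolve v \<rho>"
    define F where "F = convolve f \<rho>"
    have V: "smooth V" unfolding V_def by (rule smooth_convolve[OF v(1) K(1,2) \<rho>(1)])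
    have Vv: "\<bar>V x - v x\<bar> \<le> \<epsilon>" for x
      unfolding V_def by (rule convolve_close[OF v(1) K(1,2) \<rho>]) (use d1(2) \<delta> in auto)
    have Ff: "\<bar>F x - f x\<bar> \<le> \<epsilon>" for x
      unfolding F_def by (rule convolve_close[OF f(1) K(1,3) \<rho>]) (use d2(2) \<delta> in auto)
    have F0: "0 \<le> F x" for x
      unfolding F_def convolve_def by (rule integral_nonneg_AE) (simp add: f(2) \<rho>(2))
    have lapV: "laplacian V x = - F x" if "V x > 2 * \<epsilon>" for x
    proof -
      \<comment> \<open>the mollifier centred at \<open>x\<close>, as a test function in the equation\<close>
      define \<psi> where "\<psi> y = \<rho> ((-1) *\<^sub>R y + x)" for y
      have \<psi>: "smooth \<psi>" unfolding \<psi>_def[abs_def] by (rule smooth_affine[OF \<rho>(1)])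
      have "v y > 0" if "y \<in> cball x \<delta>" for y
      proof -
        have "\<bar>v x - v y\<bar> \<le> \<epsilon>" using d1(2)[of x y] that \<delta> by simp
        then show ?thesis using Vv[of x] \<open>V x > 2 * \<epsilon>\<close> by linarith
      qed
      moreover have "\<psi> y = 0" if "y \<notin> cball x \<delta>" for y
        using \<rho>(3)[of "x - y"] that by (simp add: \<psi>_def dist_norm)
      ultimately have "test_function {x. 0 < v x} \<psi>"
        unfolding test_function_def using \<psi> by (intro conjI exI[of _ "cball x \<delta>"]) auto
      from eq[OF this] have "(LINT y|lborel. v y * laplacian \<psi> y) = - (LINT y|lborel. f y * \<psi> y)" .
      moreover have "laplacian \<psi> y = laplacian \<rho> (x - y)" for y
        unfolding \<psi>_def[abs_def] by (simp add: laplacian_affine[OF \<rho>(1), of "-1" x y, simplified])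
      ultimately show ?thesis
        by (simp add: V_def F_def laplacian_convolve[OF v(1) K(1,2) \<rho>(1)]) (simp add: convolve_def \<psi>_def)
    qed
    define w where "w x = (1/\<epsilon>) * V x - 2" for x
    have w: "smooth w" unfolding w_def[abs_def] by (intro smooth_diff smooth_mult smooth_const V)
    have lapw: "laplacian w x = laplacian V x / \<epsilon>" for x
    proof -
      have "laplacian w x = laplacian (\<lambda>x. (1/\<epsilon>) * V x) x - laplacian (\<lambda>x. 2) x"
        unfolding w_def[abs_def] by (rule laplacian_diff[OF smooth_mult[OF smooth_const V] smooth_const])
      then show ?thesis by (simp only: laplacian_cmult[OF V] laplacian_const) simp
    qed
    define W where "W x = \<epsilon> * soft_pos 0 (w x)" for x
    have sw: "smooth (\<lambda>x. soft_pos 0 (w x))"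
      by (rule smooth_compose[of UNIV soft_pos w, OF DERIV_soft_pos w]) simp
    have W: "smooth W" unfolding W_def[abs_def] by (intro smooth_mult smooth_const sw)
    have Wv: "\<bar>W x - v x\<bar> \<le> 4 * \<epsilon>" for x
    proof -
      define M where "M = max (V x - 2 * \<epsilon>) 0"
      have "\<epsilon> * soft_pos 0 (w x) \<le> \<epsilon> * max (w x) 0" "\<epsilon> * (max (w x) 0 - 1) \<le> \<epsilon> * soft_pos 0 (w x)"
        using \<epsilon> soft_pos_bounds(2,3)[of "w x"] by (auto intro: mult_left_mono)
      moreover have "\<epsilon> * max (w x) 0 = M"
        using \<epsilon> by (auto simp: M_def w_def max_def field_simps)
      ultimately have "W x \<le> M" "M - \<epsilon> \<le> W x" by (simp_all add: W_def right_diff_distrib)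
      moreover have "M = 0 \<and> V x \<le> 2 * \<epsilon> \<or> M = V x - 2 * \<epsilon>" by (auto simp: M_def max_def)
      ultimately show ?thesis using Vv[of x] v(2)[of x] \<epsilon> by linarith
    qed
    have lapW: "- F x \<le> laplacian W x" for x
    proof -
      have "laplacian W x = \<epsilon> * laplacian (\<lambda>x. soft_pos 0 (w x)) x"
        unfolding W_def[abs_def] by (rule laplacian_cmult[OF sw])
      also have "laplacian (\<lambda>x. soft_pos 0 (w x)) x = soft_pos (Suc (Suc 0)) (w x) * (\<Sum>b\<in>Basis. (dd w b x)\<^sup>2)
          + soft_pos (Suc 0) (w x) * laplacian w x"
        by (rule laplacian_compose[of UNIV soft_pos w, OF DERIV_soft_pos w]) simp
      finally have "soft_pos (Suc 0) (w x) * laplacian V x \<le> laplacian W x"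
        using \<epsilon> by (simp add: lapw distrib_left soft_pos_bounds sum_nonneg)
      moreover have "- F x \<le> soft_pos (Suc 0) (w x) * laplacian V x"
      proof (cases "w x > 0")
        case True
        then have "V x > 2 * \<epsilon>" using \<epsilon> by (simp add: w_def field_simps)
        then show ?thesis using lapV F0[of x] soft_pos_bounds(4,5)[of "w x"] by (simp add: mult_left_le_one_le)
      next
        case False
        then show ?thesis using F0[of x] by (simp add: soft_pos_1)
      qed
      ultimately show ?thesis by linarith
    qed
    have iW: "integrable lborel (\<lambda>x. W x * laplacian \<phi> x)"
      "integrable lborel (\<lambda>x. \<phi> x * laplacian W x)" "integrable lborel (\<lambda>x. \<epsilon> * (4 * \<bar>laplacian \<phi> x\<bar> + \<phi> x))"
      by (rule int; (intro continuous_intros smooth_continuous[OF W]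
         smooth_continuous[OF smooth_laplacian[OF W]] c\<phi>)?; simp add: lap0 \<phi>(3))+
    have "(LINT x|lborel. W x * laplacian \<phi> x - \<phi> x * laplacian W x - \<epsilon> * (4 * \<bar>laplacian \<phi> x\<bar> + \<phi> x))
       \<le> (LINT x|lborel. v x * laplacian \<phi> x + f x * \<phi> x)"
    proof (rule integral_mono)
      show "integrable lborel (\<lambda>x. W x * laplacian \<phi> x - \<phi> x * laplacian W x - \<epsilon> * (4 * \<bar>laplacian \<phi> x\<bar> + \<phi> x))"
        by (intro Bochner_Integration.integrable_diff iW)
      show "integrable lborel (\<lambda>x. v x * laplacian \<phi> x + f x * \<phi> x)"
        by (intro Bochner_Integration.integrable_add iv if')
      fix x
      have "(W x - v x) * laplacian \<phi> x \<le> (4 * \<epsilon>) * \<bar>laplacian \<phi> x\<bar>"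
        using abs_ge_self[of "(W x - v x) * laplacian \<phi> x"]
          mult_right_mono[OF Wv[of x] abs_ge_zero[of "laplacian \<phi> x"]]
        unfolding abs_mult by linarith
      moreover have "- ((f x + \<epsilon>) * \<phi> x) \<le> \<phi> x * laplacian W x"
      proof -
        have "- (f x + \<epsilon>) \<le> laplacian W x" using lapW[of x] Ff[of x] by linarith
        from mult_left_mono[OF this \<phi>(4)[of x]] show ?thesis by (simp add: algebra_simps)
      qed
      ultimately show "W x * laplacian \<phi> x - \<phi> x * laplacian W x - \<epsilon> * (4 * \<bar>laplacian \<phi> x\<bar> + \<phi> x)
        \<le> v x * laplacian \<phi> x + f x * \<phi> x" by (simp add: algebra_simps)
    qed
    moreover have "(LINT x|lborel. W x * laplacian \<phi> x) = (LINT x|lborel. \<phi> x * laplacian W x)"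
      by (rule green_identity[OF \<phi>(1-3) W])
    ultimately show ?thesis
      using iW iv if' by (simp add: I_def)
  qed
  have "- e \<le> (LINT x|lborel. v x * laplacian \<phi> x) + (LINT x|lborel. f x * \<phi> x)" if "e > 0" for e
  proof -
    have "(e / (I + 1)) * I \<le> e" using that I by (simp add: field_simps)
    then show ?thesis using main[of "e / (I + 1)"] that I by simp
  qed
  then have "0 \<le> (LINT x|lborel. v x * laplacian \<phi> x) + (LINT x|lborel. f x * \<phi> x) + e" if "e > 0" for e
    using that by fastforce
  then show ?thesis by (rule field_le_epsilon)
qed


section \<open>Rescaled kernels\<close>

definition rescale :: "('a::euclidean_space \<Rightarrow> real) \<Rightarrow> 'a \<Rightarrow> real \<Rightarrow> 'a \<Rightarrow> real" where
  "rescale \<phi> x R y = \<phi> ((1 / R) *\<^sub>R (y - x))"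

lemma norm_rescale: "R > 0 \<Longrightarrow> norm ((1 / R) *\<^sub>R (y - x)) = dist x y / R"
  by (simp add: dist_norm norm_minus_commute)

lemma rescale_affine: "rescale \<phi> x R = (\<lambda>y. \<phi> ((1 / R) *\<^sub>R y + - ((1 / R) *\<^sub>R x)))"
  by (simp add: rescale_def[abs_def] scaleR_diff_right)

lemma smooth_rescale: "smooth \<phi> \<Longrightarrow> smooth (rescale \<phi> x R)"
  unfolding rescale_affine by (rule smooth_affine)

lemma laplacian_rescale:
  assumes "smooth \<phi>"
  shows "laplacian (rescale \<phi> x R) y = rescale (laplacian \<phi>) x R y / R\<^sup>2"
  unfolding rescale_affine laplacian_affine[OF assms] by (simp add: power_divide)

lemma rescale_eq_0:
  assumes "R > 0" "\<And>y. 2 \<le> norm y \<Longrightarrow> \<phi> y = 0" "2 * R \<le> dist x y"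
  shows "rescale \<phi> x R y = 0"
proof -
  have "2 \<le> norm ((1 / R) *\<^sub>R (y - x))"
    unfolding norm_rescale[OF assms(1)] using assms(1,3) by (simp add: field_simps)
  then show ?thesis unfolding rescale_def by (rule assms(2))
qed

lemma integral_cball:
  fixes x :: "'a::euclidean_space"
  assumes "r \<ge> 0"
  shows "(LINT y|lborel. c * indicator (cball x r) y) = c * (unit_ball_vol DIM('a) * r ^ DIM('a))"
  using content_cball[OF assms, of x] by simp

text \<open>How kernels are used: \<open>W\<close> is large near one point of the shell and small near the centre, and
  the resulting lower bound for \<open>\<integral> W \<Delta>\<phi>\<close> has the scaling \<open>R\<^sup>N\<^sup>-\<^sup>2\<close>. The integrand is bounded below
  pointwise by a combination of the indicators of the two balls.\<close>
lemma kernel_comparison: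
  fixes x :: "'a::euclidean_space"
  assumes ker: "subharmonic_kernel a c s B D \<phi>" and R: "R > 0" and a: "a \<le> 1"
    and W: "continuous_on UNIV W" "\<And>y. y \<in> cball x (2 * R) \<Longrightarrow> 0 \<le> W y"
    and \<alpha>: "0 \<le> \<alpha>" "0 \<le> c" "0 \<le> \<kappa>"
      "\<And>y. y \<in> cball z (\<kappa> * R) \<Longrightarrow> \<alpha> \<le> W y \<and> a * R \<le> dist x y \<and> dist x y \<le> 3/2 * R"
    and \<beta>: "\<And>y. y \<in> cball x (s * R) \<Longrightarrow> W y \<le> \<beta>"
  shows "(\<alpha> * c * \<kappa> ^ DIM('a) - \<beta> * D * s ^ DIM('a)) * (unit_ball_vol DIM('a) * R ^ DIM('a) / R\<^sup>2)
    \<le> (LINT y|lborel. W y * laplacian (rescale \<phi> x R) y)"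
proof -
  note k = ker[unfolded subharmonic_kernel_def]
  have sm: "smooth \<phi>" and s: "0 < s" "s < a" and D: "0 < D" using k by auto
  have out: "laplacian \<phi> y = 0" if "2 < norm y" for y
    by (rule laplacian_outside_support[of "cball 0 2"]) (use k that in auto)
  define A where "A = \<alpha> * c / R\<^sup>2"
  define E where "E = \<beta> * D / R\<^sup>2"
  have "(LINT y|lborel. A * indicator (cball z (\<kappa> * R)) y - E * indicator (cball x (s * R)) y)
      \<le> (LINT y|lborel. W y * laplacian (rescale \<phi> x R) y)"
  proof (rule integral_mono)
    show "integrable lborel (\<lambda>y. A * indicator (cball z (\<kappa> * R)) y - E * indicator (cball x (s * R)) y)"
      by (intro Bochner_Integration.integrable_diff integrable_cball)
    show "integrable lborel (\<lambda>y. W y * laplacian (rescale \<phi> x R) y)"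
    proof (rule integrable_compact_support)
      show "continuous_on UNIV (\<lambda>y. W y * laplacian (rescale \<phi> x R) y)"
        by (intro continuous_intros W smooth_continuous smooth_laplacian smooth_rescale sm)
      show "W y * laplacian (rescale \<phi> x R) y = 0" if "y \<notin> cball x (2 * R)" for y
      proof -
        have "2 < norm ((1 / R) *\<^sub>R (y - x))"
          unfolding norm_rescale[OF R] using that R by (simp add: field_simps)
        from out[OF this] show ?thesis unfolding laplacian_rescale[OF sm] rescale_def by simp
      qed
    qed simp
    fix y
    define p where "p = (1 / R) *\<^sub>R (y - x)"
    have p: "norm p = dist x y / R" using norm_rescale[OF R] by (simp add: p_def)
    have lap: "laplacian (rescale \<phi> x R) y = laplacian \<phi> p / R\<^sup>2"
      by (simp add: laplacian_rescale[OF sm] rescale_def p_def)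
    consider "y \<in> cball z (\<kappa> * R)" | "y \<notin> cball z (\<kappa> * R)" "y \<in> cball x (s * R)"
      | "y \<notin> cball z (\<kappa> * R)" "y \<notin> cball x (s * R)" by blast
    then show "A * indicator (cball z (\<kappa> * R)) y - E * indicator (cball x (s * R)) y
      \<le> W y * laplacian (rescale \<phi> x R) y"
    proof cases
      case 1
      note y = \<alpha>(4)[OF 1]
      have "s * R < a * R" using s R by simp
      then have "y \<notin> cball x (s * R)" using y by auto
      moreover have "c \<le> laplacian \<phi> p" using k y R by (auto simp: p field_simps)
      then have "\<alpha> * c \<le> W y * laplacian \<phi> p" using y \<alpha> by (intro mult_mono) auto
      then have "A \<le> W y * (laplacian \<phi> p / R\<^sup>2)" using R by (simp add: A_def divide_right_mono)
      ultimately show ?thesis using 1 by (simp add: lap)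
    next
      case 2
      have "s * R \<le> 2 * R" using s a R by simp
      then have W0: "0 \<le> W y" using 2 by (intro W) auto
      have "- laplacian \<phi> p \<le> D" using k by (simp add: minus_le_iff)
      then have "W y * (- laplacian \<phi> p) \<le> W y * D" using W0 by (rule mult_left_mono)
      also have "\<dots> \<le> \<beta> * D" using \<beta>[OF 2(2)] D by (intro mult_right_mono) auto
      finally have "- (\<beta> * D) \<le> W y * laplacian \<phi> p" by simp
      then have "- (\<beta> * D) / R\<^sup>2 \<le> W y * laplacian \<phi> p / R\<^sup>2" by (intro divide_right_mono) auto
      then show ?thesis using 2 by (simp add: lap E_def)
    next
      case 3
      have "0 \<le> W y * laplacian \<phi> p"
      proof (cases "dist x y \<le> 2 * R")
        case True
        moreover have "0 \<le> laplacian \<phi> p" using k 3(2) R by (auto simp: p field_simps)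
        ultimately show ?thesis using W(2)[of y] by simp
      next
        case False
        then have "laplacian \<phi> p = 0" using R by (intro out) (simp add: p field_simps)
        then show ?thesis by simp
      qed
      then show ?thesis using 3 R by (simp add: lap)
    qed
  qed
  moreover have "(LINT y|lborel. A * indicator (cball z (\<kappa> * R)) y - E * indicator (cball x (s * R)) y)
    = (\<alpha> * c * \<kappa> ^ DIM('a) - \<beta> * D * s ^ DIM('a)) * (unit_ball_vol DIM('a) * R ^ DIM('a) / R\<^sup>2)"
  proof -
    have sR: "0 \<le> \<kappa> * R" "0 \<le> s * R" using R s \<alpha>(3) by auto
    have "(LINT y|lborel. A * indicator (cball z (\<kappa> * R)) y - E * indicator (cball x (s * R)) y)
      = A * (unit_ball_vol DIM('a) * (\<kappa> * R) ^ DIM('a)) - E * (unit_ball_vol DIM('a) * (s * R) ^ DIM('a))"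
      by (subst Bochner_Integration.integral_diff[OF integrable_cball integrable_cball])
        (simp only: integral_cball[OF sR(1)] integral_cball[OF sR(2)])
    then show ?thesis using R by (simp add: A_def E_def power_mult_distrib field_simps)
  qed
  ultimately show ?thesis by simp
qed

section \<open>Weak nondegeneracy\<close>

text \<open>The problem after extension by \<open>0\<close> to the whole space. The right-hand side is any bounded nonnegative
  continuous function: at small scales it is a lower order perturbation.\<close>
locale nondegenerate_solution =
  fixes v f :: "'a::euclidean_space \<Rightarrow> real" and K :: "'a set" and L M c r\<^sub>0 :: real
  assumes dim: "DIM('a) \<ge> 2"
    and K: "compact K" "\<And>x. x \<notin> K \<Longrightarrow> v x = 0" "\<And>x. x \<notin> K \<Longrightarrow> f x = 0"
    and v_nonneg: "\<And>x. 0 \<le> v x" and L: "0 < L" and v_lipschitz: "\<And>x y. \<bar>v x - v y\<bar> \<le> L * dist x y"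
    and f: "continuous_on UNIV f" "\<And>x. 0 \<le> f x" "\<And>x. f x \<le> M"
    and eq: "\<And>\<psi>. test_function {x. 0 < v x} \<psi> \<Longrightarrow>
      (LINT x|lborel. v x * laplacian \<psi> x) = - (LINT x|lborel. f x * \<psi> x)"
    and c: "0 < c" and r\<^sub>0: "0 < r\<^sub>0"
    and nondeg: "\<And>x. 0 < v x \<Longrightarrow> infdist x {x. v x = 0} \<le> r\<^sub>0 \<Longrightarrow> c * infdist x {x. v x = 0} \<le> v x"
begin

abbreviation "Z \<equiv> {x. v x = 0}"
abbreviation "\<Gamma> \<equiv> frontier {x. 0 < v x}"

lemma v_cont: "continuous_on A v"
proof -
  have "L-lipschitz_on A v"
    using L v_lipschitz by (auto simp: lipschitz_on_def dist_real_def)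
  then show ?thesis by (rule lipschitz_on_continuous_on)
qed

lemma M_nonneg: "0 \<le> M" using f(2,3) order_trans by blast

lemma open_pos: "open {x. 0 < v x}"
  using open_Collect_less[OF continuous_on_const v_cont] by simp

lemma \<Gamma>_zero: "x \<in> \<Gamma> \<Longrightarrow> v x = 0"
  using open_pos v_nonneg[of x] by (auto simp: frontier_def interior_open)

lemma zero_set_closed_nonempty: "closed Z" "Z \<noteq> {}"
proof -
  show "closed Z" using closed_Collect_eq[OF v_cont continuous_on_const, of 0] by simp
  have "K \<noteq> UNIV" using K(1) not_compact_UNIV by blast
  then show "Z \<noteq> {}" using K(2) by blast
qed

lemma subsolution:
  assumes "smooth \<phi>" "compact S" "\<And>x. x \<notin> S \<Longrightarrow> \<phi> x = 0" "\<And>x. 0 \<le> \<phi> x"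
  shows "0 \<le> (LINT x|lborel. v x * laplacian \<phi> x) + (LINT x|lborel. f x * \<phi> x)"
  by (rule kato_inequality[OF v_cont v_nonneg f(1,2) K eq assms])

text \<open>Let \<open>m\<close> be the maximum of \<open>v\<close> over the ball of radius \<open>2 d\<close> around \<open>x\<close>. Since a kernel \<open>\<phi>\<close> centred at
  \<open>x\<close> has \<open>\<integral> \<Delta>\<phi> = 0\<close>, Kato's inequality says that \<open>\<integral> (m - v) \<Delta>\<phi> \<le> \<integral> f \<phi>\<close>, which is of order
  \<open>d\<^sup>N\<close> and hence negligible for small \<open>d\<close>. Now \<open>m - v\<close> is at least \<open>c d / 2\<close> near a zero of \<open>v\<close> at distance
  \<open>d\<close>, so \<open>kernel_comparison\<close> does not allow \<open>m - v(x)\<close> to be small compared with \<open>d\<close>.\<close>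
lemma growth:
  obtains \<theta> r\<^sub>1 where "\<theta> > 0" "r\<^sub>1 > 0"
    "\<And>x. 0 < v x \<Longrightarrow> infdist x Z \<le> r\<^sub>1 \<Longrightarrow>
       0 < infdist x Z \<and> (\<exists>y\<in>cball x (2 * infdist x Z). v x + \<theta> * infdist x Z \<le> v y)"
proof -
  \<comment> \<open>within \<open>\<kappa> d\<close> of a zero, \<open>v \<le> c d / 2\<close>, and the distance from
    \<open>x\<close> is between \<open>d / 2\<close> and \<open>3 d / 2\<close>\<close>
  define \<kappa> where "\<kappa> = min (1/2) (c / (2 * L))"
  have \<kappa>: "0 < \<kappa>" "\<kappa> \<le> 1/2" "L * \<kappa> \<le> c / 2"
    using c L by (auto simp: \<kappa>_def min_def field_simps)
  obtain c1 where c1: "c1 > 0" and ker: "\<And>\<eta>. \<eta> > 0 \<Longrightarrow> \<exists>(\<phi>::'a \<Rightarrow> real) s B D.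
      subharmonic_kernel (1/2) c1 s B D \<phi> \<and> D * s ^ (DIM('a) + 1) \<le> \<eta>"
    using subharmonic_kernel_exists[OF dim, of "1/2"] by (metis half_gt_zero zero_less_one)
  define E where "E = c / 2 * c1 * \<kappa> ^ DIM('a)"
  have E: "E > 0" using c c1 \<kappa> by (simp add: E_def)
  \<comment> \<open>the bad ball and, by the choice of \<open>r\<^sub>1\<close>, the integral of \<open>f \<phi>\<close> each cost at
    most a quarter of the main term \<open>E d\<close>\<close>
  obtain \<phi> :: "'a \<Rightarrow> real" and s B D where k: "subharmonic_kernel (1/2) c1 s B D \<phi>"
    and \<eta>: "D * s ^ (DIM('a) + 1) \<le> E / (4 * L)" using ker[of "E / (4 * L)"] E L by auto
  note k' = k[unfolded subharmonic_kernel_def]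
  have sm: "smooth \<phi>" and s: "0 < s" "s < 1/2" and D: "0 < D" and B: "0 < B" using k' by auto
  have LD: "L * (D * s ^ (DIM('a) + 1)) \<le> E / 4" using \<eta> L by (simp add: field_simps)
  define Q where "Q = M * B * 2 ^ DIM('a)"
  have Q: "0 \<le> Q" using M_nonneg B by (simp add: Q_def)
  define r\<^sub>1 where "r\<^sub>1 = min r\<^sub>0 (E / (4 * (Q + 1)))"
  define \<theta> where "\<theta> = E / (2 * D * s ^ DIM('a))"
  have "\<theta> > 0" using E D s by (simp add: \<theta>_def)
  moreover have "r\<^sub>1 > 0" using r\<^sub>0 E Q by (simp add: r\<^sub>1_def)
  moreover have "0 < infdist x Z \<and> (\<exists>y\<in>cball x (2 * infdist x Z). v x + \<theta> * infdist x Z \<le> v y)"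
    if vx: "0 < v x" and dr: "infdist x Z \<le> r\<^sub>1" for x
  proof -
    define d where "d = infdist x Z"
    obtain z where z: "v z = 0" "dist x z = d"
      using infdist_attains_inf[OF zero_set_closed_nonempty, of x] unfolding d_def by (metis mem_Collect_eq)
    have d: "0 < d" using z vx by (metis dist_eq_0_iff less_irrefl zero_less_dist_iff)
    have cd: "c * d \<le> v x" unfolding d_def using dr by (intro nondeg vx) (simp add: r\<^sub>1_def)
    obtain y where y: "y \<in> cball x (2 * d)" "\<And>y'. y' \<in> cball x (2 * d) \<Longrightarrow> v y' \<le> v y"
      using continuous_attains_sup[of "cball x (2 * d)" v] v_cont d by auto
    have vxy: "v x \<le> v y" using y(2)[of x] d by simp
    define \<beta> where "\<beta> = v y - v x + L * (s * d)"
    define \<phi>d where "\<phi>d = rescale \<phi> x d"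
    have s\<phi>: "smooth \<phi>d" unfolding \<phi>d_def by (rule smooth_rescale[OF sm])
    have \<phi>0: "\<phi>d y' = 0" if "y' \<notin> cball x (2 * d)" for y'
      unfolding \<phi>d_def using that k' d by (intro rescale_eq_0) auto
    have \<phi>B: "0 \<le> \<phi>d y'" "\<phi>d y' \<le> B" for y' using k' by (auto simp: \<phi>d_def rescale_def)
    have lap0: "laplacian \<phi>d y' = 0" if "y' \<notin> cball x (2 * d)" for y'
      by (rule laplacian_outside_support[OF _ \<phi>0 that]) auto
    have "(c / 2 * d * c1 * \<kappa> ^ DIM('a) - \<beta> * D * s ^ DIM('a)) * (unit_ball_vol DIM('a) * d ^ DIM('a) / d\<^sup>2)
        \<le> (LINT y'|lborel. (v y - v y') * laplacian \<phi>d y')"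
      unfolding \<phi>d_def
    proof (rule kernel_comparison[OF k d])
      show "continuous_on UNIV (\<lambda>y'. v y - v y')" by (intro continuous_intros v_cont)
      show "0 \<le> v y - v y'" if "y' \<in> cball x (2 * d)" for y' using y(2)[OF that] by simp
      show "c / 2 * d \<le> v y - v y' \<and> 1/2 * d \<le> dist x y' \<and> dist x y' \<le> 3/2 * d"
        if "y' \<in> cball z (\<kappa> * d)" for y'
      proof -
        have "dist z y' \<le> \<kappa> * d" using that by simp
        moreover have "\<kappa> * d \<le> 1/2 * d" using \<kappa>(2) d by (intro mult_right_mono) auto
        moreover have "L * dist z y' \<le> L * (\<kappa> * d)" using that L by (intro mult_left_mono) auto
        moreover have "L * (\<kappa> * d) \<le> c / 2 * d"
          using mult_right_mono[OF \<kappa>(3), of d] d by (simp add: mult.assoc)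
        moreover have "v y' \<le> L * dist z y'" using v_lipschitz[of z y'] z by simp
        ultimately show ?thesis
          using cd vxy z(2) dist_triangle[of x z y'] dist_triangle[of x y' z] by (simp add: dist_commute)
      qed
      show "v y - v y' \<le> \<beta>" if "y' \<in> cball x (s * d)" for y'
      proof -
        have "L * dist x y' \<le> L * (s * d)" using that L by (intro mult_left_mono) auto
        then show ?thesis using v_lipschitz[of x y'] by (simp add: \<beta>_def)
      qed
    qed (use c c1 d \<kappa> in auto)
    also have "\<dots> = v y * (LINT y'|lborel. laplacian \<phi>d y') - (LINT y'|lborel. v y' * laplacian \<phi>d y')"
    proof -
      have "integrable lborel (laplacian \<phi>d)" "integrable lborel (\<lambda>y'. v y' * laplacian \<phi>d y')"
        by (rule integrable_compact_support[of _ "cball x (2 * d)"];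
            (intro continuous_intros v_cont smooth_continuous smooth_laplacian s\<phi>)?; simp add: lap0)+
      then show ?thesis by (simp add: left_diff_distrib)
    qed
    also have "\<dots> \<le> (LINT y'|lborel. f y' * \<phi>d y')"
      using subsolution[OF s\<phi> compact_cball[of x "2 * d"] \<phi>0 \<phi>B(1)]
        integral_laplacian_eq_0[OF s\<phi> compact_cball[of x "2 * d"] \<phi>0] by simp
    also have "\<dots> \<le> (LINT y'|lborel. M * B * indicator (cball x (2 * d)) y')"
    proof (rule integral_mono[OF _ integrable_cball])
      show "integrable lborel (\<lambda>y'. f y' * \<phi>d y')"
        by (rule integrable_compact_support[of _ "cball x (2 * d)"];
            (intro continuous_intros f smooth_continuous s\<phi>)?; simp add: \<phi>0)
      show "f y' * \<phi>d y' \<le> M * B * indicator (cball x (2 * d)) y'" for y'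
        using f(2,3)[of y'] \<phi>B[of y'] \<phi>0[of y'] M_nonneg by (cases "y' \<in> cball x (2 * d)") (auto intro: mult_mono)
    qed
    also have "\<dots> = Q * d\<^sup>2 * (unit_ball_vol DIM('a) * d ^ DIM('a) / d\<^sup>2)"
      using d by (subst integral_cball) (simp_all add: Q_def power_mult_distrib)
    finally have "c / 2 * d * c1 * \<kappa> ^ DIM('a) - \<beta> * D * s ^ DIM('a) \<le> Q * d\<^sup>2"
      by (rule mult_right_le_imp_le) (use d in \<open>simp add: unit_ball_vol_pos\<close>)
    moreover have "c / 2 * d * c1 * \<kappa> ^ DIM('a) = E * d" by (simp add: E_def)
    moreover have "\<beta> * D * s ^ DIM('a) = (v y - v x) * (D * s ^ DIM('a)) + L * (D * s ^ (DIM('a) + 1)) * d"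
      by (simp add: \<beta>_def algebra_simps)
    moreover have "L * (D * s ^ (DIM('a) + 1)) * d \<le> E / 4 * d" using LD d by (intro mult_right_mono) auto
    moreover have "Q * d\<^sup>2 \<le> E / 4 * d"
    proof -
      have "d \<le> E / (4 * (Q + 1))" using dr by (simp add: d_def r\<^sub>1_def)
      then have "(Q + 1) * d \<le> E / 4" using Q by (simp add: field_simps)
      then have "Q * d \<le> E / 4" using d by (simp add: distrib_right)
      from mult_right_mono[OF this, of d] show ?thesis using d by (simp add: power2_eq_square)
    qed
    ultimately have "E / 2 * d \<le> (v y - v x) * (D * s ^ DIM('a))" by linarith
    then have "\<theta> * d \<le> v y - v x" using D s by (simp add: \<theta>_def field_simps)
    then show ?thesis using y(1) d unfolding d_def by (intro conjI bexI[of _ y]) auto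
  qed
  ultimately show ?thesis by (rule that)
qed

text \<open>Take a point \<open>x0\<close> of \<open>{v > 0}\<close> close to \<open>x\<close> and maximise \<open>v(y) - (\<theta>/4) |y - x0|\<close> over a ball around
  \<open>x0\<close>. By \<open>growth\<close> one can gain \<open>\<theta> d\<close> by moving at most \<open>2 d\<close>, at a cost of at most \<open>\<theta> d / 2\<close>; so at
  the maximum this move must leave the ball. Then either the maximum is far from \<open>x0\<close>, and
  \<open>v\<close> is large there because the objective is at least \<open>v(x0) > 0\<close>, or its distance \<open>d\<close> from the zero set is
  comparable to \<open>r\<close>, and \<open>v\<close> is large by hypothesis.\<close>
lemma weak_nondegeneracy:
  obtains c\<^sub>2 r\<^sub>2 where "c\<^sub>2 > 0" "r\<^sub>2 > 0"
    "\<And>x r. x \<in> \<Gamma> \<Longrightarrow> 0 < r \<Longrightarrow> r \<le> r\<^sub>2 \<Longrightarrow> \<exists>y\<in>cball x r. c\<^sub>2 * r \<le> v y"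
proof -
  obtain \<theta> r\<^sub>1 where \<theta>: "\<theta> > 0" and r\<^sub>1: "r\<^sub>1 > 0"
    and gr: "\<And>x. 0 < v x \<Longrightarrow> infdist x Z \<le> r\<^sub>1 \<Longrightarrow>
       0 < infdist x Z \<and> (\<exists>y\<in>cball x (2 * infdist x Z). v x + \<theta> * infdist x Z \<le> v y)"
    using growth by metis
  define c\<^sub>2 where "c\<^sub>2 = min (\<theta> / 16) (c / 8)"
  have "c\<^sub>2 > 0" using \<theta> c by (simp add: c\<^sub>2_def)
  moreover have "min r\<^sub>0 r\<^sub>1 > 0" using r\<^sub>0 r\<^sub>1 by simp
  moreover have "\<exists>y\<in>cball x r. c\<^sub>2 * r \<le> v y" if x: "x \<in> \<Gamma>" and r: "0 < r" "r \<le> min r\<^sub>0 r\<^sub>1" for x r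
  proof -
    have "x \<in> closure {x. 0 < v x}" using x by (simp add: frontier_def)
    then obtain x0 where x0: "0 < v x0" "dist x0 x < r / 2"
      using r closure_approachable[of x "{x. 0 < v x}"] by (metis half_gt_zero mem_Collect_eq)
    define g where "g y = v y - \<theta> / 4 * dist y x0" for y
    have "continuous_on (cball x0 (r / 2)) g" unfolding g_def by (intro continuous_intros v_cont)
    then obtain y where y: "y \<in> cball x0 (r / 2)" "\<And>y'. y' \<in> cball x0 (r / 2) \<Longrightarrow> g y' \<le> g y"
      using continuous_attains_sup[of "cball x0 (r / 2)" g] r by auto
    have vy: "v x0 + \<theta> / 4 * dist y x0 \<le> v y" using y(2)[of x0] r by (simp add: g_def)
    moreover have "0 \<le> \<theta> / 4 * dist y x0" using \<theta> by simp
    ultimately have vy0: "0 < v y" using x0(1) by linarith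
    have yx: "dist x y \<le> r" using y(1) x0(2) dist_triangle[of x y x0] by (simp add: dist_commute)
    define d where "d = infdist y Z"
    have dr: "d \<le> min r\<^sub>0 r\<^sub>1"
      unfolding d_def using infdist_le[of x Z y] \<Gamma>_zero[OF x] yx r by (simp add: dist_commute)
    obtain y' where y': "y' \<in> cball y (2 * d)" "v y + \<theta> * d \<le> v y'" and d: "0 < d"
      using gr[OF vy0] dr unfolding d_def by auto
    have "\<not> dist y x0 + 2 * d \<le> r / 2"
    proof
      assume "dist y x0 + 2 * d \<le> r / 2"
      moreover have dd: "dist y' x0 \<le> dist y x0 + 2 * d"
        using y'(1) dist_triangle[of y' x0 y] by (simp add: dist_commute)
      ultimately have "g y' \<le> g y" by (intro y(2)) (simp add: dist_commute)
      moreover have "\<theta> / 4 * dist y' x0 \<le> \<theta> / 4 * (dist y x0 + 2 * d)"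
        using dd \<theta> by (intro mult_left_mono) auto
      moreover have "0 < \<theta> * d" using \<theta> d by simp
      ultimately show False using y'(2) by (simp add: g_def algebra_simps)
    qed
    then consider "r / 4 \<le> dist y x0" | "r / 8 \<le> d" by linarith
    then have "c\<^sub>2 * r \<le> v y"
    proof cases
      case 1
      have "c\<^sub>2 * r \<le> \<theta> / 16 * r" using r by (intro mult_right_mono) (auto simp: c\<^sub>2_def)
      also have "\<dots> = \<theta> / 4 * (r / 4)" by simp
      also have "\<dots> \<le> \<theta> / 4 * dist y x0" using 1 \<theta> by (intro mult_left_mono) auto
      finally show ?thesis using vy x0(1) by linarith
    next
      case 2
      have "c\<^sub>2 * r \<le> c / 8 * r" using r by (intro mult_right_mono) (auto simp: c\<^sub>2_def)
      also have "\<dots> = c * (r / 8)" by simp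
      also have "\<dots> \<le> c * d" using 2 c by (intro mult_left_mono) auto
      also have "\<dots> \<le> v y" unfolding d_def using dr by (intro nondeg vy0) (simp add: d_def)
      finally show ?thesis .
    qed
    then show ?thesis using yx by auto
  qed
  ultimately show ?thesis by (rule that)
qed

section \<open>Counting separated points of the free boundary\<close>

text \<open>Here \<open>v\<close> vanishes at the centre \<open>x\<close> of the kernel, and by weak nondegeneracy \<open>v(y) \<ge> c\<^sub>2 R\<close> for some
  \<open>y\<close> at distance at most \<open>R\<close>. As \<open>v\<close> is Lipschitz, \<open>y\<close> is at distance at least \<open>c\<^sub>2 R / L\<close> from \<open>x\<close>, so
  that the shell can be fixed before the kernel is chosen.\<close>
lemma kernel_mass_lower_bound:
  obtains \<phi> B c\<^sub>3 r\<^sub>3 where "smooth \<phi>" "B > 0" "\<And>y. 0 \<le> \<phi> y" "\<And>y. \<phi> y \<le> B"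
    "\<And>y. 2 \<le> norm y \<Longrightarrow> \<phi> y = 0" "c\<^sub>3 > 0" "r\<^sub>3 > 0"
    "\<And>x R. x \<in> \<Gamma> \<Longrightarrow> 0 < R \<Longrightarrow> R \<le> r\<^sub>3 \<Longrightarrow>
      c\<^sub>3 * R ^ (DIM('a) - 1) \<le> (LINT y|lborel. v y * laplacian (rescale \<phi> x R) y)"
proof -
  obtain c\<^sub>2 r\<^sub>2 where c\<^sub>2: "c\<^sub>2 > 0" and r\<^sub>2: "r\<^sub>2 > 0"
    and nd: "\<And>x r. x \<in> \<Gamma> \<Longrightarrow> 0 < r \<Longrightarrow> r \<le> r\<^sub>2 \<Longrightarrow> \<exists>y\<in>cball x r. c\<^sub>2 * r \<le> v y"
    using weak_nondegeneracy by metis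
  define \<kappa> where "\<kappa> = min (1/2) (c\<^sub>2 / (2 * L))"
  have \<kappa>: "0 < \<kappa>" "\<kappa> \<le> 1/2" "L * \<kappa> \<le> c\<^sub>2 / 2"
    using c\<^sub>2 L by (auto simp: \<kappa>_def min_def field_simps)
  define a where "a = \<kappa>"
  have a: "0 < a" "a \<le> 1" using \<kappa> by (auto simp: a_def)
  obtain c1 where c1: "c1 > 0" and ker: "\<And>\<eta>. \<eta> > 0 \<Longrightarrow> \<exists>(\<phi>::'a \<Rightarrow> real) s B D.
      subharmonic_kernel a c1 s B D \<phi> \<and> D * s ^ (DIM('a) + 1) \<le> \<eta>"
    using subharmonic_kernel_exists[OF dim a(1)] by metis
  define E where "E = c\<^sub>2 / 2 * c1 * \<kappa> ^ DIM('a)"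
  have E: "E > 0" using c\<^sub>2 c1 \<kappa> by (simp add: E_def)
  obtain \<phi> :: "'a \<Rightarrow> real" and s B D where k: "subharmonic_kernel a c1 s B D \<phi>"
    and \<eta>: "D * s ^ (DIM('a) + 1) \<le> E / (2 * L)" using ker[of "E / (2 * L)"] E L by auto
  note k' = k[unfolded subharmonic_kernel_def]
  have s: "0 < s" using k' by auto
  have LD: "L * (D * s ^ (DIM('a) + 1)) \<le> E / 2" using \<eta> L by (simp add: field_simps)
  have mass: "E / 2 * unit_ball_vol DIM('a) * R ^ (DIM('a) - 1) \<le> (LINT y|lborel. v y * laplacian (rescale \<phi> x R) y)"
    if x: "x \<in> \<Gamma>" and R: "0 < R" "R \<le> r\<^sub>2" for x R
  proof -
    obtain y where y: "y \<in> cball x R" "c\<^sub>2 * R \<le> v y" using nd[OF x R] by blast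
    have vx: "v x = 0" by (rule \<Gamma>_zero[OF x])
    have "(c\<^sub>2 / 2 * R * c1 * \<kappa> ^ DIM('a) - L * (s * R) * D * s ^ DIM('a)) * (unit_ball_vol DIM('a) * R ^ DIM('a) / R\<^sup>2)
      \<le> (LINT y|lborel. v y * laplacian (rescale \<phi> x R) y)"
    proof (rule kernel_comparison[OF k R(1) a(2) v_cont v_nonneg])
      show "c\<^sub>2 / 2 * R \<le> v y' \<and> a * R \<le> dist x y' \<and> dist x y' \<le> 3/2 * R"
        if "y' \<in> cball y (\<kappa> * R)" for y'
      proof -
        have 1: "dist y y' \<le> \<kappa> * R" using that by simp
        have 2: "\<kappa> * R \<le> 1/2 * R" using \<kappa>(2) R by (intro mult_right_mono) auto
        have "L * dist y y' \<le> L * (\<kappa> * R)" using that L by (intro mult_left_mono) auto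
        also have 3: "\<dots> \<le> c\<^sub>2 / 2 * R"
          using mult_right_mono[OF \<kappa>(3), of R] R by (simp add: mult.assoc)
        finally have 4: "c\<^sub>2 / 2 * R \<le> v y'" using v_lipschitz[of y y'] y(2) by simp
        have "L * (\<kappa> * R) \<le> L * dist x y'" using 3 4 v_lipschitz[of x y'] vx by simp
        then have "a * R \<le> dist x y'" using L by (simp add: a_def)
        moreover have "dist x y' \<le> 3/2 * R" using 1 2 y(1) dist_triangle[of x y' y] by simp
        ultimately show ?thesis using 4 by simp
      qed
      show "v y' \<le> L * (s * R)" if "y' \<in> cball x (s * R)" for y'
      proof -
        have "L * dist x y' \<le> L * (s * R)" using that L by (intro mult_left_mono) auto
        then show ?thesis using v_lipschitz[of x y'] vx by simp
      qed
    qed (use c\<^sub>2 c1 R \<kappa> in auto)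
    moreover have "E / 2 * R \<le> c\<^sub>2 / 2 * R * c1 * \<kappa> ^ DIM('a) - L * (s * R) * D * s ^ DIM('a)"
    proof -
      have "L * (D * s ^ (DIM('a) + 1)) * R \<le> E / 2 * R" using LD R by (intro mult_right_mono) auto
      then show ?thesis by (simp add: E_def algebra_simps)
    qed
    then have "E / 2 * R * (unit_ball_vol DIM('a) * R ^ DIM('a) / R\<^sup>2)
        \<le> (c\<^sub>2 / 2 * R * c1 * \<kappa> ^ DIM('a) - L * (s * R) * D * s ^ DIM('a)) * (unit_ball_vol DIM('a) * R ^ DIM('a) / R\<^sup>2)"
      using R unit_ball_vol_nonneg by (intro mult_right_mono) auto
    moreover have "E / 2 * R * (unit_ball_vol DIM('a) * R ^ DIM('a) / R\<^sup>2) = E / 2 * unit_ball_vol DIM('a) * R ^ (DIM('a) - 1)"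
    proof -
      have "R ^ DIM('a) = R * R ^ (DIM('a) - 1)" using dim by (metis power_minus_mult mult.commute DIM_positive)
      then show ?thesis using R by (simp add: power2_eq_square)
    qed
    ultimately show ?thesis by linarith
  qed
  show ?thesis
    by (rule that[of \<phi> B "E / 2 * unit_ball_vol DIM('a)" r\<^sub>2])
      (use k' mass r\<^sub>2 E in \<open>auto simp: unit_ball_vol_pos\<close>)
qed

text \<open>Kernels at scale \<open>\<epsilon> / 5\<close> around \<open>\<epsilon>\<close>-separated points have disjoint supports, so their sum is at most
  \<open>B\<close> times a bump \<open>\<beta>\<close> at scale \<open>r\<close>. Kato's inequality for the difference bounds the total mass they
  see by \<open>B (\<integral> v \<Delta>\<beta> + \<integral> f \<beta>)\<close>. Here \<open>v \<le> 2 L r\<close> and \<open>\<Delta>\<beta>\<close> is of order \<open>r\<^sup>-\<^sup>2\<close>, on a ball of volume of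
  order \<open>r\<^sup>N\<close>.\<close>
lemma separated_points_bound:
  assumes R\<^sub>0: "R\<^sub>0 > 0"
  obtains C \<epsilon>\<^sub>1 where "C > 0" "\<epsilon>\<^sub>1 > 0"
    "\<And>x0 r \<epsilon> S. x0 \<in> \<Gamma> \<Longrightarrow> 0 < r \<Longrightarrow> r \<le> R\<^sub>0 \<Longrightarrow> 0 < \<epsilon> \<Longrightarrow> \<epsilon> \<le> \<epsilon>\<^sub>1 \<Longrightarrow> \<epsilon> \<le> r \<Longrightarrow> finite S \<Longrightarrow>
       S \<subseteq> \<Gamma> \<inter> ball x0 r \<Longrightarrow> pairwise (\<lambda>x y. \<epsilon> \<le> dist x y) S \<Longrightarrow>
       real (card S) * \<epsilon> ^ (DIM('a) - 1) \<le> C * r ^ (DIM('a) - 1)"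
proof -
  obtain \<phi> B c\<^sub>3 r\<^sub>3 where \<phi>: "smooth \<phi>" "B > 0" "\<And>y. 0 \<le> \<phi> y" "\<And>y. \<phi> y \<le> B"
    "\<And>y. 2 \<le> norm y \<Longrightarrow> \<phi> y = 0" and c\<^sub>3: "c\<^sub>3 > 0" and r\<^sub>3: "r\<^sub>3 > 0"
    and mass: "\<And>x R. x \<in> \<Gamma> \<Longrightarrow> 0 < R \<Longrightarrow> R \<le> r\<^sub>3 \<Longrightarrow>
      c\<^sub>3 * R ^ (DIM('a) - 1) \<le> (LINT y|lborel. v y * laplacian (rescale \<phi> x R) y)"
    by (rule kernel_mass_lower_bound, rule that; assumption)
  obtain b :: "'a \<Rightarrow> real" where b: "smooth b" "\<And>y. 0 \<le> b y" "\<And>y. norm y \<le> 3/2 \<Longrightarrow> 1 \<le> b y"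
    "\<And>y. 2 \<le> norm y \<Longrightarrow> b y = 0" using smooth_bump by metis
  have b0: "y \<notin> cball 0 2 \<Longrightarrow> b y = 0" for y using b(4)[of y] by simp
  obtain B1 where B1: "B1 > 0" "\<And>y. \<bar>b y\<bar> \<le> B1"
    using bounded_compact_support[OF smooth_continuous[OF b(1)] compact_cball[of 0 2] b0] by metis
  have lapb0: "y \<notin> cball 0 2 \<Longrightarrow> laplacian b y = 0" for y
    by (rule laplacian_outside_support[OF closed_cball b0])
  obtain B2 where B2: "B2 > 0" "\<And>y. \<bar>laplacian b y\<bar> \<le> B2"
    using bounded_compact_support[OF smooth_continuous[OF smooth_laplacian[OF b(1)]] compact_cball[of 0 2] lapb0]
    by metis
  define C0 where "C0 = B * ((2 * L * B2 + M * B1 * R\<^sub>0) * (unit_ball_vol DIM('a) * 2 ^ DIM('a)))"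
  have C0: "C0 > 0" using \<phi>(2) L B1(1) B2(1) M_nonneg R\<^sub>0 by (simp add: C0_def add_pos_nonneg unit_ball_vol_pos)
  define C where "C = C0 * 5 ^ (DIM('a) - 1) / c\<^sub>3"
  have "C > 0" using C0 c\<^sub>3 by (simp add: C_def)
  moreover have "r\<^sub>3 > 0" by (rule r\<^sub>3)
  moreover have "real (card S) * \<epsilon> ^ (DIM('a) - 1) \<le> C * r ^ (DIM('a) - 1)"
    if x0: "x0 \<in> \<Gamma>" and r: "0 < r" "r \<le> R\<^sub>0" and \<epsilon>: "0 < \<epsilon>" "\<epsilon> \<le> r\<^sub>3" "\<epsilon> \<le> r"
      and S: "finite S" "S \<subseteq> \<Gamma> \<inter> ball x0 r" "pairwise (\<lambda>x y. \<epsilon> \<le> dist x y) S" for x0 r \<epsilon> S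
  proof -
    define R where "R = \<epsilon> / 5"
    have R: "0 < R" "R \<le> r\<^sub>3" using \<epsilon> by (auto simp: R_def)
    define \<beta> where "\<beta> = rescale b x0 r"
    define \<Phi> where "\<Phi> y = B * \<beta> y - (\<Sum>x\<in>S. rescale \<phi> x R y)" for y
    have s\<beta>: "smooth \<beta>" unfolding \<beta>_def by (rule smooth_rescale[OF b(1)])
    have s\<phi>: "smooth (rescale \<phi> x R)" for x by (rule smooth_rescale[OF \<phi>(1)])
    have s\<Sigma>: "smooth (\<lambda>y. \<Sum>x\<in>S. rescale \<phi> x R y)" by (intro smooth_sum s\<phi>)
    have s\<Phi>: "smooth \<Phi>" unfolding \<Phi>_def[abs_def] by (intro smooth_diff smooth_mult smooth_const s\<beta> s\<Sigma>)
    have \<beta>0: "\<beta> y = 0" if "y \<notin> cball x0 (2 * r)" for y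
      unfolding \<beta>_def using that b(4) r by (intro rescale_eq_0) auto
    have \<beta>n: "0 \<le> \<beta> y" "\<beta> y \<le> B1" for y
      using b(2) B1(2)[of "(1 / r) *\<^sub>R (y - x0)"] by (auto simp: \<beta>_def rescale_def abs_le_iff)
    have \<phi>0: "rescale \<phi> x R y = 0" if "2 * R \<le> dist x y" for x y
      using that \<phi>(5) R by (intro rescale_eq_0) auto
    have \<phi>n: "0 \<le> rescale \<phi> x R y" "rescale \<phi> x R y \<le> B" for x y by (auto simp: rescale_def \<phi>)
    have xS: "dist x0 x < r" if "x \<in> S" for x using S(2) that by auto
    have \<Phi>n: "0 \<le> \<Phi> y" for y
    proof (cases "\<exists>x\<in>S. dist x y < 2 * R")
      case True
      then obtain x where x: "x \<in> S" "dist x y < 2 * R" by blast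
      have "rescale \<phi> x' R y = 0" if "x' \<in> S - {x}" for x'
      proof (rule \<phi>0)
        have "\<epsilon> \<le> dist x' x" using S(3) that x(1) by (auto simp: pairwise_def)
        then show "2 * R \<le> dist x' y"
          using x(2) \<epsilon>(1) dist_triangle[of x' x y] by (simp add: R_def dist_commute)
      qed
      then have "(\<Sum>x\<in>S. rescale \<phi> x R y) = rescale \<phi> x R y"
        using S(1) x(1) by (simp add: sum.remove[of S x])
      moreover have "1 \<le> \<beta> y"
      proof -
        have "dist x0 y \<le> 3/2 * r"
          using x(2) xS[OF x(1)] \<epsilon> dist_triangle[of x0 y x] by (simp add: R_def)
        then have "norm ((1 / r) *\<^sub>R (y - x0)) \<le> 3/2"
          unfolding norm_rescale[OF r(1)] using r by (simp add: field_simps)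
        then show ?thesis unfolding \<beta>_def rescale_def by (rule b(3))
      qed
      then have "B * 1 \<le> B * \<beta> y" using \<phi>(2) by (intro mult_left_mono) auto
      ultimately show ?thesis using \<phi>n(2)[of x y] by (simp add: \<Phi>_def)
    next
      case False
      then have "(\<Sum>x\<in>S. rescale \<phi> x R y) = 0" by (intro sum.neutral ballI \<phi>0) auto
      then show ?thesis using \<phi>(2) \<beta>n(1) by (simp add: \<Phi>_def)
    qed
    have \<phi>2: "rescale \<phi> x R y = 0" if "x \<in> S" "y \<notin> cball x0 (2 * r)" for x y
    proof (rule \<phi>0)
      show "2 * R \<le> dist x y"
        using that(2) xS[OF that(1)] \<epsilon> dist_triangle[of x0 y x] by (simp add: R_def)
    qed
    have \<Phi>0: "\<Phi> y = 0" if "y \<notin> cball x0 (2 * r)" for y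
      using that \<beta>0 \<phi>2 by (simp add: \<Phi>_def)
    have int: "integrable lborel g" if "continuous_on UNIV g" "\<And>y. y \<notin> cball x0 (2 * r) \<Longrightarrow> g y = 0"
      for g :: "'a \<Rightarrow> real"
      by (rule integrable_compact_support[OF that(1) compact_cball that(2)])
    have lap: "laplacian \<Phi> y = B * laplacian \<beta> y - (\<Sum>x\<in>S. laplacian (rescale \<phi> x R) y)" for y
      unfolding \<Phi>_def[abs_def]
      using laplacian_diff[OF smooth_mult[OF smooth_const[of B] s\<beta>] s\<Sigma>, of y] laplacian_cmult[OF s\<beta>, of B y]
        laplacian_sum[of S "\<lambda>x. rescale \<phi> x R" y] s\<phi> by simp
    have lap\<beta>0: "y \<notin> cball x0 (2 * r) \<Longrightarrow> laplacian \<beta> y = 0" for y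
      by (rule laplacian_outside_support[OF closed_cball \<beta>0])
    have lap\<phi>0: "y \<notin> cball x0 (2 * r) \<Longrightarrow> x \<in> S \<Longrightarrow> laplacian (rescale \<phi> x R) y = 0" for x y
      by (rule laplacian_outside_support[OF closed_cball \<phi>2])
    have i\<beta>: "integrable lborel (\<lambda>y. v y * laplacian \<beta> y)" "integrable lborel (\<lambda>y. f y * \<beta> y)"
      "integrable lborel (\<lambda>y. f y * \<Phi> y)"
      by (rule int; (intro continuous_intros v_cont f smooth_continuous smooth_laplacian s\<beta> s\<Phi>)?;
          simp add: lap\<beta>0 \<beta>0 \<Phi>0)+
    have i\<phi>: "integrable lborel (\<lambda>y. v y * laplacian (rescale \<phi> x R) y)" if "x \<in> S" for x
      by (rule int; (intro continuous_intros v_cont smooth_continuous smooth_laplacian s\<phi>)?;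
          simp add: lap\<phi>0 that)
    have "0 \<le> (LINT y|lborel. v y * laplacian \<Phi> y) + (LINT y|lborel. f y * \<Phi> y)"
      by (rule subsolution[OF s\<Phi> compact_cball \<Phi>0 \<Phi>n])
    also have "(LINT y|lborel. v y * laplacian \<Phi> y)
        = (LINT y|lborel. B * (v y * laplacian \<beta> y) - (\<Sum>x\<in>S. v y * laplacian (rescale \<phi> x R) y))"
      by (simp add: lap right_diff_distrib sum_distrib_left mult.left_commute)
    also have "\<dots> = B * (LINT y|lborel. v y * laplacian \<beta> y)
        - (\<Sum>x\<in>S. LINT y|lborel. v y * laplacian (rescale \<phi> x R) y)"
      using i\<beta>(1) i\<phi> by (simp add: Bochner_Integration.integral_diff Bochner_Integration.integral_sum)
    finally have 1: "(\<Sum>x\<in>S. LINT y|lborel. v y * laplacian (rescale \<phi> x R) y)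
        \<le> B * (LINT y|lborel. v y * laplacian \<beta> y) + (LINT y|lborel. f y * \<Phi> y)" by simp
    have "(LINT y|lborel. f y * \<Phi> y) \<le> (LINT y|lborel. B * (f y * \<beta> y))"
    proof (rule integral_mono[OF i\<beta>(3) integrable_mult_right[OF i\<beta>(2)]])
      fix y
      have "\<Phi> y \<le> B * \<beta> y" using \<phi>n(1) by (simp add: \<Phi>_def sum_nonneg)
      from mult_left_mono[OF this f(2)[of y]] show "f y * \<Phi> y \<le> B * (f y * \<beta> y)" by (simp add: mult.left_commute)
    qed
    then have 2: "(LINT y|lborel. f y * \<Phi> y) \<le> B * (LINT y|lborel. f y * \<beta> y)" by simp
    define q where "q = 2 * L * B2 / r + M * B1"
    have "(LINT y|lborel. v y * laplacian \<beta> y + f y * \<beta> y) \<le> (LINT y|lborel. q * indicator (cball x0 (2 * r)) y)"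
    proof (rule integral_mono[OF Bochner_Integration.integrable_add[OF i\<beta>(1,2)] integrable_cball])
      fix y
      show "v y * laplacian \<beta> y + f y * \<beta> y \<le> q * indicator (cball x0 (2 * r)) y"
      proof (cases "y \<in> cball x0 (2 * r)")
        case True
        have "v y \<le> L * dist x0 y" using v_lipschitz[of x0 y] \<Gamma>_zero[OF x0] by simp
        also have "\<dots> \<le> L * (2 * r)" using True L by (intro mult_left_mono) auto
        finally have vy: "v y \<le> 2 * L * r" by simp
        have "laplacian \<beta> y \<le> B2 / r\<^sup>2"
          using B2(2)[of "(1 / r) *\<^sub>R (y - x0)"]
          by (simp add: \<beta>_def laplacian_rescale[OF b(1)] rescale_def abs_le_iff divide_right_mono)
        then have "v y * laplacian \<beta> y \<le> v y * (B2 / r\<^sup>2)" by (intro mult_left_mono v_nonneg)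
        also have "\<dots> \<le> 2 * L * r * (B2 / r\<^sup>2)" using vy B2(1) by (intro mult_right_mono) auto
        also have "\<dots> = 2 * L * B2 / r" using r by (simp add: power2_eq_square)
        finally have "v y * laplacian \<beta> y \<le> 2 * L * B2 / r" .
        moreover have "f y * \<beta> y \<le> M * B1" using f(2,3) \<beta>n M_nonneg by (intro mult_mono) auto
        ultimately show ?thesis using True by (simp add: q_def)
      qed (simp add: lap\<beta>0 \<beta>0)
    qed
    also have "\<dots> = q * (unit_ball_vol DIM('a) * (2 * r) ^ DIM('a))" using r by (subst integral_cball) auto
    also have "\<dots> = (q * r) * (unit_ball_vol DIM('a) * 2 ^ DIM('a)) * r ^ (DIM('a) - 1)"
    proof -
      have "r ^ DIM('a) = r * r ^ (DIM('a) - 1)" using dim by (metis power_minus_mult mult.commute DIM_positive)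
      then show ?thesis by (simp add: power_mult_distrib)
    qed
    also have "\<dots> \<le> (2 * L * B2 + M * B1 * R\<^sub>0) * (unit_ball_vol DIM('a) * 2 ^ DIM('a)) * r ^ (DIM('a) - 1)"
    proof -
      have "q * r \<le> 2 * L * B2 + M * B1 * R\<^sub>0"
        using r M_nonneg B1(1) by (simp add: q_def distrib_right mult_left_mono)
      then show ?thesis using r by (intro mult_right_mono) (auto simp: unit_ball_vol_nonneg)
    qed
    finally have 3: "B * (LINT y|lborel. v y * laplacian \<beta> y) + B * (LINT y|lborel. f y * \<beta> y) \<le> C0 * r ^ (DIM('a) - 1)"
      using i\<beta> \<phi>(2) by (simp add: C0_def mult.assoc flip: distrib_left)
    have "real (card S) * (c\<^sub>3 * R ^ (DIM('a) - 1)) = (\<Sum>x\<in>S. c\<^sub>3 * R ^ (DIM('a) - 1))" by simp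
    also have "\<dots> \<le> (\<Sum>x\<in>S. LINT y|lborel. v y * laplacian (rescale \<phi> x R) y)"
      using S(2) R by (intro sum_mono mass) auto
    also have "\<dots> \<le> C0 * r ^ (DIM('a) - 1)" using 1 2 3 by linarith
    finally have "real (card S) * (c\<^sub>3 * R ^ (DIM('a) - 1)) \<le> C0 * r ^ (DIM('a) - 1)" .
    then show ?thesis using c\<^sub>3 by (simp add: C_def R_def power_divide field_simps)
  qed
  ultimately show ?thesis by (rule that)
qed

end

section \<open>From separated points to Hausdorff measure\<close>

text \<open>A maximal \<open>\<epsilon>\<close>-separated set exists because the cardinalities are bounded, and its \<open>\<epsilon>\<close>-balls cover \<open>A\<close>.\<close>
lemma hausdorff_measure_le_separated:
  fixes A :: "'a::euclidean_space set" and Q \<epsilon>\<^sub>1 :: real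
  assumes \<epsilon>\<^sub>1: "\<epsilon>\<^sub>1 > 0" and Q: "0 \<le> Q"
    and sep: "\<And>\<epsilon> S. 0 < \<epsilon> \<Longrightarrow> \<epsilon> \<le> \<epsilon>\<^sub>1 \<Longrightarrow> finite S \<Longrightarrow> S \<subseteq> A \<Longrightarrow> pairwise (\<lambda>x y. \<epsilon> \<le> dist x y) S \<Longrightarrow>
      real (card S) * \<epsilon> ^ k \<le> Q"
  shows "hausdorff_measure k A \<le> ennreal (unit_ball_vol k * Q)"
  unfolding hausdorff_measure_def
proof (rule SUP_least)
  fix \<delta> :: real assume "\<delta> \<in> {0<..}"
  define \<epsilon> where "\<epsilon> = min \<epsilon>\<^sub>1 (\<delta> / 2)"
  have \<epsilon>: "0 < \<epsilon>" "\<epsilon> \<le> \<epsilon>\<^sub>1" "2 * \<epsilon> \<le> \<delta>" using \<epsilon>\<^sub>1 \<open>\<delta> \<in> _\<close> by (auto simp: \<epsilon>_def)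
  define P where "P S \<longleftrightarrow> finite S \<and> S \<subseteq> A \<and> pairwise (\<lambda>x y. \<epsilon> \<le> dist x y) S" for S
  have "P {}" by (simp add: P_def)
  moreover have "card S \<le> nat \<lceil>Q / \<epsilon> ^ k\<rceil>" if "P S" for S
  proof -
    have "real (card S) * \<epsilon> ^ k \<le> Q" using that sep \<epsilon> by (simp add: P_def)
    then have "real (card S) \<le> Q / \<epsilon> ^ k" using \<epsilon> by (simp add: field_simps)
    then show ?thesis by linarith
  qed
  ultimately obtain S where S: "P S" "\<And>T. P T \<Longrightarrow> card T \<le> card S"
    using ex_has_greatest_nat[of P "{}" card] by (metis le_imp_less_Suc)
  have cover: "A \<subseteq> (\<Union>s\<in>S. cball s \<epsilon>)"
  proof
    fix x assume "x \<in> A"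
    show "x \<in> (\<Union>s\<in>S. cball s \<epsilon>)"
    proof (rule ccontr)
      assume n: "x \<notin> (\<Union>s\<in>S. cball s \<epsilon>)"
      then have "x \<notin> S" using \<epsilon> by fastforce
      moreover have "P (insert x S)"
        using S(1) n \<open>x \<in> A\<close> unfolding P_def pairwise_insert by (auto simp: dist_commute less_imp_le not_le)
      ultimately show False using S(1) S(2)[of "insert x S"] by (simp add: P_def)
    qed
  qed
  have finS: "finite S" using S(1) by (simp add: P_def)
  obtain h where h: "bij_betw h {0..<card S} S" using ex_bij_betw_nat_finite[OF finS] by blast
  define U where "U i = (if i < card S then cball (h i) \<epsilon> else {})" for i
  have "A \<subseteq> (\<Union>i. U i)"
  proof
    fix x assume "x \<in> A"
    then obtain s where s: "s \<in> S" "x \<in> cball s \<epsilon>" using cover by blast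
    then obtain i where "i < card S" "h i = s" using h unfolding bij_betw_def by (metis imageE atLeastLessThan_iff)
    then show "x \<in> (\<Union>i. U i)" using s(2) by (intro UN_I[of i]) (auto simp: U_def)
  qed
  moreover have "bounded (U i) \<and> diameter (U i) \<le> \<delta>" for i
    using \<epsilon> by (auto simp: U_def)
  ultimately have "hausdorff_premeasure k \<delta> A \<le> (\<Sum>i. hausdorff_weight k (U i))"
    unfolding hausdorff_premeasure_def by (intro INF_lower) auto
  also have "\<dots> = (\<Sum>i<card S. hausdorff_weight k (U i))"
    by (rule suminf_finite) (auto simp: U_def hausdorff_weight_def)
  also have "\<dots> = (\<Sum>i<card S. ennreal (unit_ball_vol k * \<epsilon> ^ k))"
    using \<epsilon> by (intro sum.cong) (auto simp: U_def hausdorff_weight_def)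
  also have "\<dots> = ennreal (card S * (unit_ball_vol k * \<epsilon> ^ k))"
    using \<epsilon> by (simp add: ennreal_mult ennreal_of_nat_eq_real_of_nat unit_ball_vol_nonneg)
  also have "\<dots> \<le> ennreal (unit_ball_vol k * Q)"
  proof (rule ennreal_leI)
    have "real (card S) * \<epsilon> ^ k \<le> Q" using S(1) sep \<epsilon> by (simp add: P_def)
    from mult_left_mono[OF this unit_ball_vol_nonneg[of k]]
    show "real (card S) * (unit_ball_vol k * \<epsilon> ^ k) \<le> unit_ball_vol k * Q" by (simp add: mult_ac)
  qed
  finally show "hausdorff_premeasure k \<delta> A \<le> ennreal (unit_ball_vol k * Q)" .
qed

lemma (in nondegenerate_solution) hausdorff_measure_free_boundary:
  assumes "R\<^sub>0 > 0"
  obtains C where "C > 0" "\<And>x0 r. x0 \<in> \<Gamma> \<Longrightarrow> 0 < r \<Longrightarrow> r \<le> R\<^sub>0 \<Longrightarrow>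
    hausdorff_measure (DIM('a) - 1) (\<Gamma> \<inter> ball x0 r) \<le> ennreal (C * r ^ (DIM('a) - 1))"
proof -
  obtain C \<epsilon>\<^sub>1 where C: "C > 0" and \<epsilon>\<^sub>1: "\<epsilon>\<^sub>1 > 0" and count:
    "\<And>x0 r \<epsilon> S. x0 \<in> \<Gamma> \<Longrightarrow> 0 < r \<Longrightarrow> r \<le> R\<^sub>0 \<Longrightarrow> 0 < \<epsilon> \<Longrightarrow> \<epsilon> \<le> \<epsilon>\<^sub>1 \<Longrightarrow> \<epsilon> \<le> r \<Longrightarrow> finite S \<Longrightarrow>
       S \<subseteq> \<Gamma> \<inter> ball x0 r \<Longrightarrow> pairwise (\<lambda>x y. \<epsilon> \<le> dist x y) S \<Longrightarrow>
       real (card S) * \<epsilon> ^ (DIM('a) - 1) \<le> C * r ^ (DIM('a) - 1)"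
    using separated_points_bound[OF assms] by metis
  have "hausdorff_measure (DIM('a) - 1) (\<Gamma> \<inter> ball x0 r) \<le> ennreal ((unit_ball_vol (DIM('a) - 1) * C) * r ^ (DIM('a) - 1))"
    if "x0 \<in> \<Gamma>" "0 < r" "r \<le> R\<^sub>0" for x0 r
    using hausdorff_measure_le_separated[of "min \<epsilon>\<^sub>1 r" "C * r ^ (DIM('a) - 1)" "\<Gamma> \<inter> ball x0 r" "DIM('a) - 1"]
      count[OF that] C \<epsilon>\<^sub>1 that by (simp add: mult.assoc)
  moreover have "unit_ball_vol (DIM('a) - 1) * C > 0" using C by (simp add: unit_ball_vol_pos)
  ultimately show ?thesis using that by blast
qed


section \<open>The boundary values\<close>

lemma square_integral_le:
  fixes h :: "real \<Rightarrow> real"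
  assumes h: "continuous_on {0..t} h" and t: "0 < t"
  shows "(integral {0..t} h)\<^sup>2 \<le> t * integral {0..t} (\<lambda>s. (h s)\<^sup>2)"
proof -
  define m where "m = integral {0..t} h / t"
  have i: "h integrable_on {0..t}" "(\<lambda>s. (h s)\<^sup>2) integrable_on {0..t}"
    by (intro integrable_continuous_real continuous_intros h)+
  have "0 \<le> integral {0..t} (\<lambda>s. (h s - m)\<^sup>2)"
    by (intro integral_nonneg integrable_continuous_real continuous_intros h) auto
  also have "(\<lambda>s. (h s - m)\<^sup>2) = (\<lambda>s. (h s)\<^sup>2 - 2 * m * h s + m\<^sup>2)"
    by (simp add: power2_diff algebra_simps)
  also have "integral {0..t} \<dots> = integral {0..t} (\<lambda>s. (h s)\<^sup>2) - 2 * m * integral {0..t} h + m\<^sup>2 * t"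
    using i t by (subst integral_add integral_diff integral_mult_right;
      (intro integrable_add integrable_diff integrable_on_mult_right integrable_const_ivl i)?; simp)+
  finally show ?thesis using t by (simp add: m_def power2_eq_square field_simps)
qed

lemma nn_integral_lborel_translation:
  fixes g :: "'a::euclidean_space \<Rightarrow> ennreal"
  assumes "g \<in> borel_measurable borel"
  shows "(\<integral>\<^sup>+y. g (y + a) \<partial>lborel) = (\<integral>\<^sup>+y. g y \<partial>lborel)"
proof -
  have "(\<integral>\<^sup>+y. g y \<partial>lborel) = (\<integral>\<^sup>+y. g y \<partial>distr lborel borel ((+) a))"
    by (simp add: lborel_distr_plus)
  also have "\<dots> = (\<integral>\<^sup>+y. g (a + y) \<partial>lborel)"
    using assms by (intro nn_integral_distr) auto
  finally show ?thesis by (simp add: add.commute)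
qed

text \<open>The fundamental theorem of calculus and the Cauchy-Schwarz inequality on each segment of direction \<open>e\<close>,
  followed by Fubini's theorem.\<close>
lemma translation_estimate:
  fixes \<phi> :: "'a::euclidean_space \<Rightarrow> real"
  assumes \<phi>: "smooth \<phi>" and t: "0 < t"
  shows "(\<integral>\<^sup>+y. ennreal ((\<phi> y - \<phi> (y - t *\<^sub>R e))\<^sup>2) \<partial>lborel)
    \<le> ennreal (t\<^sup>2) * (\<integral>\<^sup>+y. ennreal ((dd \<phi> e y)\<^sup>2) \<partial>lborel)"
proof -
  have cont: "continuous_on UNIV (dd \<phi> e)" by (rule smooth_continuous[OF smooth_dd[OF \<phi>]])
  have m[measurable]: "dd \<phi> e \<in> borel_measurable borel"
    by (rule borel_measurable_continuous_onI[OF cont])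
  define F where "F y s = indicator {0..t} s * ennreal ((dd \<phi> e (y - s *\<^sub>R e))\<^sup>2)" for y s
  have F: "(\<lambda>(y, s). F y s) \<in> borel_measurable (lborel \<Otimes>\<^sub>M lborel)"
    unfolding F_def by measurable
  have "ennreal ((\<phi> y - \<phi> (y - t *\<^sub>R e))\<^sup>2) \<le> ennreal t * (\<integral>\<^sup>+s. F y s \<partial>lborel)" for y
  proof -
    define h where "h s = dd \<phi> e (y - s *\<^sub>R e)" for s
    have hc: "continuous_on A h" for A
      unfolding h_def by (intro continuous_on_compose2[OF cont] continuous_intros) auto
    have "((\<lambda>s. - \<phi> (y - s *\<^sub>R e)) has_real_derivative h s) (at s)" for s
    proof -
      have "dd \<phi> (- e) z = - dd \<phi> e z" for z
        by (rule linear_neg[OF linear_frechet_derivative[OF smooth_differentiable[OF \<phi>]]])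
      then show ?thesis
        using DERIV_minus[OF smooth_line_derivative[OF \<phi>, where x = y and t = s and b = "- e"]]
        by (simp add: h_def)
    qed
    then have "(h has_integral (- \<phi> (y - t *\<^sub>R e) - (- \<phi> (y - 0 *\<^sub>R e)))) {0..t}"
      using t by (intro fundamental_theorem_of_calculus)
        (auto simp: has_real_derivative_iff_has_vector_derivative[symmetric] intro: has_field_derivative_at_within)
    then have "\<phi> y - \<phi> (y - t *\<^sub>R e) = integral {0..t} h" by (simp add: integral_unique)
    then have 1: "(\<phi> y - \<phi> (y - t *\<^sub>R e))\<^sup>2 \<le> t * integral {0..t} (\<lambda>s. (h s)\<^sup>2)"
      using square_integral_le[OF hc t] by simp
    define H where "H s = (if s \<in> {0..t} then (h s)\<^sup>2 else 0)" for s
    have "(\<lambda>s. (h s)\<^sup>2) integrable_on {0..t}"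
      by (intro integrable_continuous_real continuous_intros hc)
    then have "(H has_integral integral {0..t} (\<lambda>s. (h s)\<^sup>2)) UNIV"
      unfolding H_def[abs_def] by (simp only: has_integral_restrict_UNIV integrable_integral)
    moreover have "H \<in> borel_measurable borel"
      using borel_measurable_continuous_onI[OF hc] unfolding H_def by measurable
    moreover have "0 \<le> H s" for s by (simp add: H_def)
    ultimately have "(\<integral>\<^sup>+s. ennreal (H s) \<partial>lborel) = ennreal (integral {0..t} (\<lambda>s. (h s)\<^sup>2))"
      by (intro nn_integral_has_integral_lborel)
    moreover have "ennreal (H s) = F y s" for s
      by (auto simp: H_def F_def h_def indicator_def)
    ultimately have 2: "(\<integral>\<^sup>+s. F y s \<partial>lborel) = ennreal (integral {0..t} (\<lambda>s. (h s)\<^sup>2))" by simp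
    show ?thesis
      unfolding 2 using ennreal_leI[OF 1] t by (simp add: ennreal_mult')
  qed
  then have "(\<integral>\<^sup>+y. ennreal ((\<phi> y - \<phi> (y - t *\<^sub>R e))\<^sup>2) \<partial>lborel)
      \<le> (\<integral>\<^sup>+y. ennreal t * (\<integral>\<^sup>+s. F y s \<partial>lborel) \<partial>lborel)"
    by (rule nn_integral_mono)
  also have "\<dots> = ennreal t * (\<integral>\<^sup>+y. (\<integral>\<^sup>+s. F y s \<partial>lborel) \<partial>lborel)"
    using F by (intro nn_integral_cmult) (auto intro: lborel.borel_measurable_nn_integral)
  also have "(\<integral>\<^sup>+y. (\<integral>\<^sup>+s. F y s \<partial>lborel) \<partial>lborel) = (\<integral>\<^sup>+s. (\<integral>\<^sup>+y. F y s \<partial>lborel) \<partial>lborel)"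
    by (rule lborel_pair.Fubini'[OF F, symmetric])
  also have "\<dots> = (\<integral>\<^sup>+s. indicator {0..t} s * (\<integral>\<^sup>+y. ennreal ((dd \<phi> e y)\<^sup>2) \<partial>lborel) \<partial>lborel)"
  proof (rule nn_integral_cong)
    fix s
    have "(\<integral>\<^sup>+y. F y s \<partial>lborel) = indicator {0..t} s * (\<integral>\<^sup>+y. ennreal ((dd \<phi> e (y + (- (s *\<^sub>R e))))\<^sup>2) \<partial>lborel)"
      unfolding F_def by (subst nn_integral_cmult) (auto simp: measurable_lborel1)
    also have "(\<integral>\<^sup>+y. ennreal ((dd \<phi> e (y + (- (s *\<^sub>R e))))\<^sup>2) \<partial>lborel) = (\<integral>\<^sup>+y. ennreal ((dd \<phi> e y)\<^sup>2) \<partial>lborel)"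
      by (rule nn_integral_lborel_translation) measurable
    finally show "(\<integral>\<^sup>+y. F y s \<partial>lborel) = indicator {0..t} s * (\<integral>\<^sup>+y. ennreal ((dd \<phi> e y)\<^sup>2) \<partial>lborel)" .
  qed
  also have "\<dots> = ennreal t * (\<integral>\<^sup>+y. ennreal ((dd \<phi> e y)\<^sup>2) \<partial>lborel)"
    using t by (subst nn_integral_multc) auto
  finally show ?thesis
    using t by (simp add: power2_eq_square ennreal_mult' mult.assoc)
qed

lemma dd_eq_grad_inner:
  assumes "smooth \<phi>"
  shows "dd \<phi> e x = grad \<phi> x \<bullet> e"
proof -
  have lin: "linear (\<lambda>v. dd \<phi> v x)"
    by (rule linear_frechet_derivative[OF smooth_differentiable[OF assms]])
  have "dd \<phi> e x = dd \<phi> (\<Sum>b\<in>Basis. (e \<bullet> b) *\<^sub>R b) x" by (simp add: euclidean_representation)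
  also have "\<dots> = (\<Sum>b\<in>Basis. (e \<bullet> b) * dd \<phi> b x)"
    by (simp add: linear_sum[OF lin] linear_cmul[OF lin])
  finally show ?thesis by (simp add: grad_def inner_sum_left inner_commute[of e] mult.commute)
qed

text \<open>Makes the distances to the approximating test functions in the definition of \<open>H1_0\<close> integrals of integrable
  functions, to which monotonicity applies.\<close>
lemma lebesgue_square_diff:
  fixes f g :: "'a::euclidean_space \<Rightarrow> 'b::euclidean_space"
  assumes \<Omega>: "\<Omega> \<in> sets borel" and f: "L2_on \<Omega> f"
    and g: "continuous_on UNIV g" "compact K" "\<And>x. x \<notin> K \<Longrightarrow> g x = 0"
  shows "integrable lebesgue (\<lambda>x. indicator \<Omega> x * (norm (f x - g x))\<^sup>2 :: real)"
proof (rule Bochner_Integration.integrable_bound)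
  have gi: "integrable lborel (\<lambda>x. (norm (g x))\<^sup>2)"
    by (rule integrable_compact_support[OF _ g(2)]) (auto intro!: continuous_intros g(1) simp: g(3))
  then have gi: "integrable lebesgue (\<lambda>x. (norm (g x))\<^sup>2)"
    by (subst integrable_completion) auto
  have fi: "integrable lebesgue (\<lambda>x. indicator \<Omega> x * (norm (f x))\<^sup>2 :: real)"
    using f by (simp add: L2_on_def set_integrable_def)
  show "integrable lebesgue (\<lambda>x. 2 * (indicator \<Omega> x * (norm (f x))\<^sup>2) + 2 * (norm (g x))\<^sup>2 :: real)"
    by (intro Bochner_Integration.integrable_add integrable_mult_right fi gi)
  have fm: "(\<lambda>x. indicator \<Omega> x *\<^sub>R f x) \<in> borel_measurable lebesgue"
    using f by (simp add: L2_on_def set_borel_measurable_def)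
  have gm: "g \<in> borel_measurable lebesgue"
    using borel_measurable_continuous_onI[OF g(1)] by (simp add: measurable_completion)
  have im: "indicator \<Omega> \<in> borel_measurable lebesgue" using \<Omega> by (auto intro!: borel_measurable_indicator sets_completionI_sets)
  have "(\<lambda>x. (norm (indicator \<Omega> x *\<^sub>R f x - indicator \<Omega> x *\<^sub>R g x))\<^sup>2) \<in> borel_measurable lebesgue"
    using fm gm im by measurable
  also have "(\<lambda>x. (norm (indicator \<Omega> x *\<^sub>R f x - indicator \<Omega> x *\<^sub>R g x))\<^sup>2)
      = (\<lambda>x. indicator \<Omega> x * (norm (f x - g x))\<^sup>2 :: real)"
    by (intro ext) (auto simp: indicator_def)
  finally show "(\<lambda>x. indicator \<Omega> x * (norm (f x - g x))\<^sup>2 :: real) \<in> borel_measurable lebesgue" .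
  have sq: "(norm (a - b))\<^sup>2 \<le> 2 * (norm a)\<^sup>2 + 2 * (norm b)\<^sup>2" for a b :: 'b
  proof -
    have "(norm (a - b))\<^sup>2 \<le> (norm a + norm b)\<^sup>2" by (intro power_mono norm_triangle_ineq4) auto
    also have "\<dots> \<le> 2 * (norm a)\<^sup>2 + 2 * (norm b)\<^sup>2"
      using sum_squares_bound[of "norm a" "norm b"] by (simp add: power2_sum)
    finally show ?thesis .
  qed
  show "AE x in lebesgue. norm (indicator \<Omega> x * (norm (f x - g x))\<^sup>2 :: real)
      \<le> norm (2 * (indicator \<Omega> x * (norm (f x))\<^sup>2) + 2 * (norm (g x))\<^sup>2 :: real)"
    by (rule AE_I2) (use sq in \<open>auto simp: indicator_def\<close>)
qed

lemma square_le_double: "(a::real)\<^sup>2 \<le> 2 * (a - b)\<^sup>2 + 2 * b\<^sup>2"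
  using zero_le_power2[of "a - 2 * b"] by (simp add: power2_eq_square algebra_simps)

text \<open>A test function of \<open>\<Omega>\<close> vanishes at \<open>y - t e\<close> for \<open>y\<close> in the strip \<open>S\<close>, so on \<open>S\<close> it equals its difference
  from a translate, and its square integral over \<open>S\<close> is at most \<open>t\<^sup>2\<close> times that of its gradient. The estimate
  passes to \<open>u\<close> in the limit.\<close>
lemma H1_0_strip_estimate:
  fixes u :: "'a::euclidean_space \<Rightarrow> real"
  assumes u: "u \<in> H1_0 \<Omega>" and \<Omega>: "open \<Omega>" "bounded \<Omega>"
  shows "\<exists>G\<ge>0. \<forall>e t S a. norm e = 1 \<longrightarrow> 0 < t \<longrightarrow> S \<in> sets borel \<longrightarrow> S \<subseteq> \<Omega> \<longrightarrow>
       (\<forall>y\<in>S. y - t *\<^sub>R e \<notin> \<Omega>) \<longrightarrow> 0 \<le> a \<longrightarrow> (\<forall>y\<in>S. a \<le> \<bar>u y\<bar>) \<longrightarrow>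
       a\<^sup>2 * measure lborel S \<le> t\<^sup>2 * G"
proof -
  obtain g \<phi> where L2u: "L2_on \<Omega> u" and L2g: "L2_on \<Omega> g" and \<phi>: "\<And>k::nat. test_function \<Omega> (\<phi> k)"
    and lim1: "(\<lambda>k. LINT x:\<Omega>|lebesgue. (u x - \<phi> k x)\<^sup>2) \<longlonglongrightarrow> 0"
    and lim2: "(\<lambda>k. LINT x:\<Omega>|lebesgue. (norm (g x - grad (\<phi> k) x))\<^sup>2) \<longlonglongrightarrow> 0"
    using u unfolding H1_0_def by blast
  have \<Omega>b: "\<Omega> \<in> sets borel" using \<Omega>(1) by simp
  define A where "A = (LINT x:\<Omega>|lebesgue. (norm (g x))\<^sup>2)"
  have A: "0 \<le> A" unfolding A_def set_lebesgue_integral_def by (rule integral_nonneg_AE) simp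
  define p where "p k = (LINT x:\<Omega>|lebesgue. (u x - \<phi> k x)\<^sup>2)" for k
  define q where "q k = (LINT x:\<Omega>|lebesgue. (norm (g x - grad (\<phi> k) x))\<^sup>2)" for k
  have est: "a\<^sup>2 * measure lborel S \<le> t\<^sup>2 * (4 * A)"
    if e: "norm e = 1" and t: "0 < t" and S: "S \<in> sets borel" "S \<subseteq> \<Omega>" "\<And>y. y \<in> S \<Longrightarrow> y - t *\<^sub>R e \<notin> \<Omega>"
      and a: "0 \<le> a" "\<And>y. y \<in> S \<Longrightarrow> a \<le> \<bar>u y\<bar>" for e t S a
  proof -
    have Sfin: "emeasure lborel S < \<infinity>"
      using emeasure_bounded_finite[of S] S(2) \<Omega>(2) bounded_subset by auto
    have main: "a\<^sup>2 * measure lborel S \<le> 2 * p k + 2 * (t\<^sup>2 * (2 * q k + 2 * A))" for k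
    proof -
      define \<psi> where "\<psi> = \<phi> k"
      obtain K where sm: "smooth \<psi>" and K: "compact K" "K \<subseteq> \<Omega>" "\<And>x. x \<notin> K \<Longrightarrow> \<psi> x = 0"
        using \<phi>[of k] unfolding test_function_def \<psi>_def by blast
      have dd0: "dd \<psi> v x = 0" if "x \<notin> K" for v x
        by (rule dd_outside_support[OF compact_imp_closed[OF K(1)] K(3) that])
      have cg: "continuous_on UNIV (grad \<psi>)"
        unfolding grad_def[abs_def] by (intro continuous_intros smooth_continuous smooth_dd sm)
      have g0: "grad \<psi> x = 0" if "x \<notin> K" for x using dd0[OF that] by (simp add: grad_def)
      have iu: "integrable lebesgue (\<lambda>x. indicator \<Omega> x * (u x - \<psi> x)\<^sup>2 :: real)"
        using lebesgue_square_diff[OF \<Omega>b L2u smooth_continuous[OF sm] K(1,3)] by simp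
      have ig: "integrable lebesgue (\<lambda>x. indicator \<Omega> x * (norm (g x - grad \<psi> x))\<^sup>2 :: real)"
        by (rule lebesgue_square_diff[OF \<Omega>b L2g cg K(1) g0])
      have ig0: "integrable lebesgue (\<lambda>x. indicator \<Omega> x * (norm (g x))\<^sup>2 :: real)"
        using L2g by (simp add: L2_on_def set_integrable_def)
      have i\<psi>: "integrable lborel (\<lambda>x. (\<psi> x)\<^sup>2)"
        by (rule integrable_compact_support[OF _ K(1)]) (auto intro!: continuous_on_power smooth_continuous[OF sm] simp: K(3))
      have iS\<psi>: "integrable lborel (\<lambda>x. indicator S x * (\<psi> x)\<^sup>2)"
        using integrable_mult_indicator[OF _ i\<psi>, of S] S(1) by simp
      have idd: "integrable lborel (\<lambda>x. (dd \<psi> e x)\<^sup>2)"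
        by (rule integrable_compact_support[OF _ K(1)])
          (auto intro!: continuous_on_power smooth_continuous[OF smooth_dd[OF sm]] simp: dd0)
      have 1: "(LINT x|lborel. indicator S x * (\<psi> x)\<^sup>2) \<le> t\<^sup>2 * (LINT x|lborel. (dd \<psi> e x)\<^sup>2)"
      proof -
        have "ennreal (LINT x|lborel. indicator S x * (\<psi> x)\<^sup>2) = (\<integral>\<^sup>+x. ennreal (indicator S x * (\<psi> x)\<^sup>2) \<partial>lborel)"
          by (rule nn_integral_eq_integral[symmetric, OF iS\<psi>]) auto
        also have "\<dots> \<le> (\<integral>\<^sup>+x. ennreal ((\<psi> x - \<psi> (x - t *\<^sub>R e))\<^sup>2) \<partial>lborel)"
        proof (rule nn_integral_mono)
          fix x
          show "ennreal (indicator S x * (\<psi> x)\<^sup>2) \<le> ennreal ((\<psi> x - \<psi> (x - t *\<^sub>R e))\<^sup>2)"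
          proof (cases "x \<in> S")
            case True
            then have "\<psi> (x - t *\<^sub>R e) = 0" using S(3) K(2,3) by blast
            then show ?thesis by (simp add: True)
          qed simp
        qed
        also have "\<dots> \<le> ennreal (t\<^sup>2) * (\<integral>\<^sup>+x. ennreal ((dd \<psi> e x)\<^sup>2) \<partial>lborel)"
          by (rule translation_estimate[OF sm t])
        also have "(\<integral>\<^sup>+x. ennreal ((dd \<psi> e x)\<^sup>2) \<partial>lborel) = ennreal (LINT x|lborel. (dd \<psi> e x)\<^sup>2)"
          by (rule nn_integral_eq_integral[OF idd]) auto
        finally show ?thesis by (simp flip: ennreal_mult')
      qed
      have "(LINT x|lborel. (dd \<psi> e x)\<^sup>2) = (LINT x|lebesgue. (dd \<psi> e x)\<^sup>2)"
        using idd by (intro integral_completion[symmetric]) auto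
      also have "\<dots> \<le> (LINT x|lebesgue. 2 * (indicator \<Omega> x * (norm (g x - grad \<psi> x))\<^sup>2)
          + 2 * (indicator \<Omega> x * (norm (g x))\<^sup>2))"
      proof (rule integral_mono)
        show "integrable lebesgue (\<lambda>x. (dd \<psi> e x)\<^sup>2)" using idd by (subst integrable_completion) auto
        show "integrable lebesgue (\<lambda>x. 2 * (indicator \<Omega> x * (norm (g x - grad \<psi> x))\<^sup>2)
          + 2 * (indicator \<Omega> x * (norm (g x))\<^sup>2))"
          by (intro Bochner_Integration.integrable_add integrable_mult_right ig ig0)
        fix x
        show "(dd \<psi> e x)\<^sup>2 \<le> 2 * (indicator \<Omega> x * (norm (g x - grad \<psi> x))\<^sup>2) + 2 * (indicator \<Omega> x * (norm (g x))\<^sup>2)"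
        proof (cases "x \<in> K")
          case True
          have "\<bar>dd \<psi> e x\<bar> \<le> norm (grad \<psi> x)"
            using Cauchy_Schwarz_ineq2[of "grad \<psi> x" e] e by (simp add: dd_eq_grad_inner[OF sm])
          also have "\<dots> \<le> norm (g x - grad \<psi> x) + norm (g x)"
            using norm_triangle_sub[of "grad \<psi> x" "g x"] by (simp add: norm_minus_commute)
          finally have "\<bar>dd \<psi> e x\<bar>\<^sup>2 \<le> (norm (g x - grad \<psi> x) + norm (g x))\<^sup>2" by (intro power_mono) auto
          also have "\<dots> \<le> 2 * (norm (g x - grad \<psi> x))\<^sup>2 + 2 * (norm (g x))\<^sup>2"
            using sum_squares_bound[of "norm (g x - grad \<psi> x)" "norm (g x)"] by (simp add: power2_sum)
          finally show ?thesis using True K(2) by (auto simp: indicator_def)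
        qed (simp add: dd0)
      qed
      also have "\<dots> = 2 * q k + 2 * A"
        using ig ig0 by (simp add: q_def A_def \<psi>_def set_lebesgue_integral_def)
      finally have 2: "(LINT x|lborel. (dd \<psi> e x)\<^sup>2) \<le> 2 * q k + 2 * A" .
      have iS: "integrable lborel (\<lambda>x. a\<^sup>2 * indicator S x :: real)"
        using S(1) Sfin by (intro integrable_mult_right integrable_real_indicator) auto
      have "a\<^sup>2 * measure lborel S = (LINT x|lborel. a\<^sup>2 * indicator S x)"
        using S(1) by simp
      also have "\<dots> = (LINT x|lebesgue. a\<^sup>2 * indicator S x)"
        using iS by (intro integral_completion[symmetric]) auto
      also have "\<dots> \<le> (LINT x|lebesgue. 2 * (indicator \<Omega> x * (u x - \<psi> x)\<^sup>2) + 2 * (indicator S x * (\<psi> x)\<^sup>2))"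
      proof (rule integral_mono)
        show "integrable lebesgue (\<lambda>x. a\<^sup>2 * indicator S x)" using iS by (subst integrable_completion) auto
        show "integrable lebesgue (\<lambda>x. 2 * (indicator \<Omega> x * (u x - \<psi> x)\<^sup>2) + 2 * (indicator S x * (\<psi> x)\<^sup>2))"
          using iS\<psi> by (intro Bochner_Integration.integrable_add integrable_mult_right iu)
            (subst integrable_completion; auto)
        fix x
        show "a\<^sup>2 * indicator S x \<le> 2 * (indicator \<Omega> x * (u x - \<psi> x)\<^sup>2) + 2 * (indicator S x * (\<psi> x)\<^sup>2)"
        proof (cases "x \<in> S")
          case True
          have "a\<^sup>2 \<le> \<bar>u x\<bar>\<^sup>2" using a(1) a(2)[OF True] by (intro power_mono) auto
          also have "\<dots> \<le> 2 * (u x - \<psi> x)\<^sup>2 + 2 * (\<psi> x)\<^sup>2" using square_le_double by simp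
          finally show ?thesis using True S(2) by (auto simp: indicator_def)
        qed simp
      qed
      also have "\<dots> = 2 * (LINT x|lebesgue. indicator \<Omega> x * (u x - \<psi> x)\<^sup>2) + 2 * (LINT x|lebesgue. indicator S x * (\<psi> x)\<^sup>2)"
      proof -
        have "integrable lebesgue (\<lambda>x. indicator S x * (\<psi> x)\<^sup>2)" using iS\<psi> by (subst integrable_completion) auto
        then show ?thesis using iu by simp
      qed
      also have "(LINT x|lebesgue. indicator \<Omega> x * (u x - \<psi> x)\<^sup>2) = p k"
        by (simp add: p_def \<psi>_def set_lebesgue_integral_def)
      also have "(LINT x|lebesgue. indicator S x * (\<psi> x)\<^sup>2) = (LINT x|lborel. indicator S x * (\<psi> x)\<^sup>2)"
        using iS\<psi> by (intro integral_completion) auto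
      finally show ?thesis
        using 1 mult_left_mono[OF 2, of "t\<^sup>2"] by simp
    qed
    have "(\<lambda>k. 2 * p k + 2 * (t\<^sup>2 * (2 * q k + 2 * A))) \<longlonglongrightarrow> 2 * 0 + 2 * (t\<^sup>2 * (2 * 0 + 2 * A))"
      using lim1 lim2 unfolding p_def[symmetric] q_def[symmetric] by (intro tendsto_intros)
    from LIMSEQ_le_const[OF this, of "a\<^sup>2 * measure lborel S"] main
    have "a\<^sup>2 * measure lborel S \<le> 2 * 0 + 2 * (t\<^sup>2 * (2 * 0 + 2 * A))" by blast
    then show ?thesis by simp
  qed
  show ?thesis
  proof (intro exI[of _ "4 * A"] conjI allI impI)
    fix e :: 'a and t a :: real and S :: "'a set"
    assume *: "norm e = 1" "0 < t" "S \<in> sets borel" "S \<subseteq> \<Omega>" "\<forall>y\<in>S. y - t *\<^sub>R e \<notin> \<Omega>" "0 \<le> a"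
      "\<forall>y\<in>S. a \<le> \<bar>u y\<bar>"
    show "a\<^sup>2 * measure lborel S \<le> t\<^sup>2 * (4 * A)"
      by (rule est[OF *(1-4) bspec[OF *(5)] *(6) bspec[OF *(7)]])
  qed (use A in simp)
qed

text \<open>If \<open>u x0 \<noteq> 0\<close>, then \<open>|u| \<ge> a > 0\<close> in \<open>\<Omega>\<close> near \<open>x0\<close>, and \<open>H1_0_strip_estimate\<close> bounds the volume of a
  boundary strip \<open>S\<close> of width \<open>t\<close> near \<open>x0\<close> by a multiple of \<open>t\<^sup>2\<close>. But about \<open>1 / t\<close> translates of \<open>S\<close> in
  the direction \<open>e\<close> cover the fixed open set \<open>U\<close>: starting in \<open>U\<close> and moving by steps \<open>- t e\<close>, one leaves
  the epigraph after at most that many steps, and the last position in \<open>\<Omega>\<close> is in \<open>S\<close>. So the volume of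
  \<open>S\<close> is at least a multiple of \<open>t\<close>.\<close>
lemma H1_0_zero_on_frontier:
  fixes u :: "'a::euclidean_space \<Rightarrow> real"
  assumes \<Omega>: "bounded_smooth_domain \<Omega>" and u: "u \<in> H1_0 \<Omega>" and cont: "continuous_on (closure \<Omega>) u"
    and x0: "x0 \<in> frontier \<Omega>"
  shows "u x0 = 0"
proof (rule ccontr)
  assume u0: "u x0 \<noteq> 0"
  have op: "open \<Omega>" and bd: "bounded \<Omega>" and sb: "smooth_boundary \<Omega>"
    using \<Omega> by (auto simp: bounded_smooth_domain_def)
  obtain G where G: "0 \<le> G" and strip:
    "\<forall>e t S a. norm e = 1 \<longrightarrow> 0 < t \<longrightarrow> S \<in> sets borel \<longrightarrow> S \<subseteq> \<Omega> \<longrightarrow>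
       (\<forall>y\<in>S. y - t *\<^sub>R e \<notin> \<Omega>) \<longrightarrow> 0 \<le> a \<longrightarrow> (\<forall>y\<in>S. a \<le> \<bar>u y\<bar>) \<longrightarrow>
       a\<^sup>2 * measure lborel S \<le> t\<^sup>2 * G"
    using H1_0_strip_estimate[OF u op bd] by blast
  have x0c: "x0 \<in> closure \<Omega>" "x0 \<notin> \<Omega>"
    using x0 op by (auto simp: frontier_def interior_open)
  obtain r e \<gamma> where r: "r > 0" and e: "norm e = 1" and \<gamma>: "smooth \<gamma>"
    and graph: "\<Omega> \<inter> ball x0 r = {y \<in> ball x0 r. \<gamma> (y - (y \<bullet> e) *\<^sub>R e) < y \<bullet> e}"
    using sb x0 unfolding smooth_boundary_def by blast
  \<comment> \<open>the height above the graph, which decreases by \<open>\<tau>\<close> when moving by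
    \<open>- \<tau> e\<close>\<close>
  define h where "h y = y \<bullet> e - \<gamma> (y - (y \<bullet> e) *\<^sub>R e)" for y
  have hc: "continuous_on UNIV h"
    unfolding h_def by (intro continuous_intros continuous_on_compose2[OF smooth_continuous[OF \<gamma>]]) auto
  have in\<Omega>: "y \<in> \<Omega> \<longleftrightarrow> 0 < h y" if "y \<in> ball x0 r" for y
    using graph that by (auto simp: h_def set_eq_iff)
  have ee: "e \<bullet> e = 1" using e by (simp add: power2_norm_eq_inner[symmetric])
  have hsh: "h (y - \<tau> *\<^sub>R e) = h y - \<tau>" for y \<tau>
    by (simp add: h_def inner_diff_left ee algebra_simps)
  define a where "a = \<bar>u x0\<bar> / 2"
  have a: "a > 0" using u0 by (simp add: a_def)
  obtain \<rho>1 where \<rho>1: "\<rho>1 > 0" "\<And>y. y \<in> closure \<Omega> \<Longrightarrow> dist y x0 < \<rho>1 \<Longrightarrow> dist (u y) (u x0) < a"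
    using cont x0c(1) a unfolding continuous_on_iff by metis
  define \<rho> where "\<rho> = min r \<rho>1"
  have \<rho>: "\<rho> > 0" "\<rho> \<le> r" "\<rho> \<le> \<rho>1" using r \<rho>1 by (auto simp: \<rho>_def)
  have ua: "a \<le> \<bar>u y\<bar>" if "y \<in> \<Omega>" "dist y x0 < \<rho>" for y
  proof -
    have "dist (u y) (u x0) < a" using that \<rho> closure_subset by (intro \<rho>1(2)) auto
    then show ?thesis unfolding dist_real_def a_def by (simp add: field_simps abs_if split: if_splits)
  qed
  define \<eta> where "\<eta> = \<rho> / 4"
  have \<eta>: "\<eta> > 0" using \<rho> by (simp add: \<eta>_def)
  have "h x0 \<le> 0" using in\<Omega>[of x0] x0c(2) r by simp
  moreover obtain \<delta>1 where \<delta>1: "\<delta>1 > 0" "\<And>y. dist y x0 < \<delta>1 \<Longrightarrow> dist (h y) (h x0) < \<eta>"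
    using hc \<eta> unfolding continuous_on_iff by (metis UNIV_I)
  ultimately have h\<eta>: "h y < \<eta>" if "dist y x0 < \<delta>1" for y
    using \<delta>1(2)[OF that] by (auto simp: dist_real_def)
  define \<delta> where "\<delta> = min \<delta>1 (\<rho> / 4)"
  have \<delta>: "\<delta> > 0" using \<delta>1 \<rho> by (simp add: \<delta>_def)
  define U where "U = \<Omega> \<inter> ball x0 \<delta>"
  have "open U" using op by (simp add: U_def open_Int)
  moreover have "U \<noteq> {}"
  proof -
    obtain z where "z \<in> \<Omega>" "dist z x0 < \<delta>" using x0c(1) \<delta> unfolding closure_approachable by blast
    then have "z \<in> U" by (simp add: U_def dist_commute)
    then show ?thesis by blast
  qed
  ultimately have mU: "0 < measure lborel U"
  proof -
    obtain z where "z \<in> U" using \<open>U \<noteq> {}\<close> by blast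
    then obtain d where d: "d > 0" "ball z d \<subseteq> U" using \<open>open U\<close> openE by blast
    have "0 < measure lborel (ball z d)" using d by simp
    also have "\<dots> \<le> measure lborel U"
    proof (rule measure_mono_fmeasurable[OF d(2)])
      show "U \<in> fmeasurable lborel"
        using \<open>open U\<close> emeasure_bounded_finite[of U] bd bounded_subset[of \<Omega> U]
        by (intro fmeasurableI) (auto simp: U_def)
    qed auto
    finally show ?thesis .
  qed
  have key: "a\<^sup>2 * measure lborel U \<le> 2 * \<eta> * t * G" if t: "0 < t" "t \<le> \<eta>" for t
  proof -
    define S where "S = {y \<in> \<Omega> \<inter> ball x0 \<rho>. y - t *\<^sub>R e \<notin> \<Omega>}"
    have Sb: "S \<in> sets borel"
    proof -
      have "closed ((\<lambda>y. y - t *\<^sub>R e) -` (- \<Omega>))"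
        using op by (intro continuous_closed_vimage) auto
      moreover have "S = (\<Omega> \<inter> ball x0 \<rho>) \<inter> ((\<lambda>y. y - t *\<^sub>R e) -` (- \<Omega>))" by (auto simp: S_def)
      ultimately show ?thesis using op by simp
    qed
    have Sfin: "emeasure lborel S < \<infinity>"
      using emeasure_bounded_finite[of S] bd bounded_subset[of \<Omega> S] by (auto simp: S_def)
    define N where "N = nat \<lceil>\<eta> / t\<rceil>"
    have N: "\<eta> \<le> real N * t" "real N * t \<le> 2 * \<eta>"
    proof -
      have "\<eta> / t \<le> real N" unfolding N_def by (rule real_nat_ceiling_ge)
      then show "\<eta> \<le> real N * t" using t by (simp add: field_simps)
      have "0 \<le> \<eta> / t" using \<eta> t by simp
      then have "real N \<le> \<eta> / t + 1" unfolding N_def by linarith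
      then have "real N * t \<le> \<eta> + t" using t by (simp add: field_simps)
      then show "real N * t \<le> 2 * \<eta>" using t by simp
    qed
    have UN: "U \<subseteq> (\<Union>k<N. (\<lambda>y. y + - ((real k * t) *\<^sub>R e)) -` S)"
    proof
      fix y assume y: "y \<in> U"
      have near: "y - (real j * t) *\<^sub>R e \<in> ball x0 \<rho>" if "j \<le> N" for j
      proof -
        have "real j * t \<le> real N * t" using that t by (intro mult_right_mono) auto
        also have "\<dots> \<le> \<rho> / 2" using N(2) by (simp add: \<eta>_def)
        finally have "norm ((real j * t) *\<^sub>R e) \<le> \<rho> / 2" using e t by simp
        moreover have "dist x0 y < \<rho> / 4" using y by (simp add: U_def \<delta>_def)
        moreover have "dist x0 (y - (real j * t) *\<^sub>R e) \<le> dist x0 y + norm ((real j * t) *\<^sub>R e)"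
          using dist_triangle[of x0 "y - (real j * t) *\<^sub>R e" y] by (simp add: dist_norm)
        ultimately show ?thesis using \<rho> by simp
      qed
      define j where "j = (LEAST j. y - (real j * t) *\<^sub>R e \<notin> \<Omega>)"
      have exN: "y - (real N * t) *\<^sub>R e \<notin> \<Omega>"
      proof -
        have "h y < \<eta>" using y by (intro h\<eta>) (simp add: U_def \<delta>_def dist_commute)
        then have "h (y - (real N * t) *\<^sub>R e) < 0" using N(1) by (simp add: hsh)
        then show ?thesis using in\<Omega>[of "y - (real N * t) *\<^sub>R e"] near[of N] \<rho> by auto
      qed
      have j: "y - (real j * t) *\<^sub>R e \<notin> \<Omega>" unfolding j_def by (rule LeastI[of _ N]) (rule exN)
      have jN: "j \<le> N" unfolding j_def by (rule Least_le) (rule exN)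
      have "j \<noteq> 0"
      proof
        assume "j = 0"
        with j y show False by (simp add: U_def)
      qed
      then obtain k where k: "j = Suc k" using not0_implies_Suc by blast
      have "y - (real k * t) *\<^sub>R e \<in> \<Omega>" 
        using not_less_Least[of k "\<lambda>j. y - (real j * t) *\<^sub>R e \<notin> \<Omega>"] k unfolding j_def by simp
      moreover have "(y - (real k * t) *\<^sub>R e) - t *\<^sub>R e \<notin> \<Omega>"
      proof -
        have "(y - (real k * t) *\<^sub>R e) - t *\<^sub>R e = y - (real j * t) *\<^sub>R e"
          by (simp add: k algebra_simps)
        with j show ?thesis by (simp only: not_False_eq_True)
      qed
      moreover have "y - (real k * t) *\<^sub>R e \<in> ball x0 \<rho>" using near[of k] jN k by simp
      ultimately have "y - (real k * t) *\<^sub>R e \<in> S" unfolding S_def by blast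
      then show "y \<in> (\<Union>k<N. (\<lambda>y. y + - ((real k * t) *\<^sub>R e)) -` S)" using jN k by auto
    qed
    have tr: "emeasure lborel ((\<lambda>y. y + b) -` S) = emeasure lborel S" for b
    proof -
      have "emeasure lborel S = emeasure (distr lborel borel ((+) b)) S" by (simp add: lborel_distr_plus)
      also have "\<dots> = emeasure lborel ((+) b -` S)" using Sb by (subst emeasure_distr) auto
      also have "(+) b -` S = (\<lambda>y. y + b) -` S" by (auto simp: add.commute)
      finally show ?thesis by simp
    qed
    have vm: "(\<lambda>y. y + b) -` S \<in> sets borel" for b
      using measurable_sets[of "\<lambda>y. y + b" borel borel S] Sb by simp
    define T where "T k = (\<lambda>y. y + - ((real k * t) *\<^sub>R e)) -` S" for k
    have T: "T k \<in> sets lborel" "emeasure lborel (T k) = emeasure lborel S" for k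
      unfolding T_def using vm[of "- ((real k * t) *\<^sub>R e)"] by (simp_all only: tr sets_lborel)
    have "emeasure lborel U \<le> emeasure lborel (\<Union>k<N. T k)"
      using T(1) UN by (intro emeasure_mono sets.finite_UN) (auto simp: T_def)
    also have "\<dots> \<le> (\<Sum>k<N. emeasure lborel (T k))"
      using T(1) by (intro emeasure_subadditive_finite) auto
    also have "\<dots> = of_nat N * emeasure lborel S" by (simp only: T(2) sum_constant card_lessThan)
    also have "\<dots> = ennreal (real N * measure lborel S)"
      using Sfin by (simp add: emeasure_eq_ennreal_measure ennreal_mult ennreal_of_nat_eq_real_of_nat)
    finally have "measure lborel U \<le> real N * measure lborel S"
      unfolding measure_def by (intro enn2real_leI) auto
    from mult_left_mono[OF this, of "a\<^sup>2"]
    have "a\<^sup>2 * measure lborel U \<le> real N * (a\<^sup>2 * measure lborel S)"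
      by (simp add: mult.left_commute)
    also have "\<dots> \<le> real N * (t\<^sup>2 * G)"
    proof (rule mult_left_mono)
      have "S \<subseteq> \<Omega>" "\<forall>y\<in>S. y - t *\<^sub>R e \<notin> \<Omega>" "\<forall>y\<in>S. a \<le> \<bar>u y\<bar>"
        using ua by (auto simp: S_def dist_commute)
      then show "a\<^sup>2 * measure lborel S \<le> t\<^sup>2 * G"
        using strip e t(1) Sb a by (metis less_imp_le)
    qed simp
    also have "\<dots> = real N * t * (t * G)" by (simp add: power2_eq_square)
    also have "\<dots> \<le> 2 * \<eta> * (t * G)" using N(2) t G by (intro mult_right_mono) auto
    finally show ?thesis by (simp add: mult.assoc)
  qed
  define m where "m = a\<^sup>2 * measure lborel U"
  have m: "m > 0" using a mU by (simp add: m_def)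
  define q where "q = 2 * \<eta> * G"
  have q: "q \<ge> 0" using \<eta> G by (simp add: q_def)
  define t where "t = min \<eta> (m / (2 * (q + 1)))"
  have t: "0 < t" "t \<le> \<eta>" using \<eta> m q by (auto simp: t_def)
  have "m \<le> q * t" using key[OF t] by (simp add: m_def q_def mult_ac)
  also have "\<dots> \<le> q * (m / (2 * (q + 1)))" using q by (intro mult_left_mono) (auto simp: t_def)
  also have "\<dots> < m" using q m by (simp add: field_simps add_nonneg_pos)
  finally show False by simp
qed


section \<open>Application to the free boundary problem\<close>

lemma frontier_point_on_segment:
  fixes x z :: "'a::euclidean_space"
  assumes "x \<in> S" "z \<notin> S"
  obtains w where "w \<in> frontier S" "dist x w \<le> dist x z"
proof -
  have "closed_segment x z \<inter> frontier S \<noteq> {}"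
    using assms by (intro connected_Int_frontier) auto
  then obtain w where w: "w \<in> closed_segment x z" "w \<in> frontier S" by blast
  then have "dist x w \<le> dist x z"
    using segment_bound(1)[of w x z] by (simp add: dist_norm norm_minus_commute)
  with w(2) show ?thesis by (rule that)
qed

lemma hausdorff_measure_empty: "hausdorff_measure k ({} :: 'a::euclidean_space set) = 0"
proof -
  have "hausdorff_measure k ({} :: 'a set) \<le> ennreal (unit_ball_vol k * 0)"
    by (rule hausdorff_measure_le_separated[of 1]) auto
  then show ?thesis by simp
qed

theorem proposition1p6:
  fixes \<Omega> :: "'a::euclidean_space set" and u :: "'a \<Rightarrow> real" and p :: real
  assumes "DIM('a) \<ge> 2"
    and "bounded_smooth_domain \<Omega>"
    and "2 < p"
    and "DIM('a) \<ge> 3 \<longrightarrow> p < 2 * real DIM('a) / (real DIM('a) - 2)"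
    and "u \<in> H1_0 \<Omega>"
    and "\<exists>L. L-lipschitz_on (closure \<Omega>) u"
    and "nondegenerate \<Omega> u"
    and "neg_laplacian_eq (\<Omega> - free_boundary \<Omega> u) u (\<lambda>x. max (u x - 1) 0 powr (p - 1))"
  shows "(superlevel \<Omega> u \<noteq> {} \<longrightarrow> setdist (superlevel \<Omega> u) (frontier \<Omega>) > 0) \<and>
    (\<exists>C>0. \<forall>x\<^sub>0\<in>free_boundary \<Omega> u. \<forall>r.
       0 < r \<and> r \<le> setdist (superlevel \<Omega> u) (frontier \<Omega>) / 2 \<longrightarrow>
       hausdorff_measure (DIM('a) - 1) (free_boundary \<Omega> u \<inter> ball x\<^sub>0 r)
         \<le> ennreal (C * r ^ (DIM('a) - 1))) \<and>
    hausdorff_measure (DIM('a) - 1) (free_boundary \<Omega> u) < \<infinity>"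
proof -
  have op: "open \<Omega>" and ne: "\<Omega> \<noteq> {}" and bd: "bounded \<Omega>"
    using assms(2) by (auto simp: bounded_smooth_domain_def)
  have comp: "compact (closure \<Omega>)" using bd by (simp add: compact_closure)
  obtain L0 where L0: "L0-lipschitz_on (closure \<Omega>) u" using assms(6) by blast
  have cu: "continuous_on (closure \<Omega>) u" by (rule lipschitz_on_continuous_on[OF L0])
  have u0: "u x = 0" if "x \<in> frontier \<Omega>" for x
    by (rule H1_0_zero_on_frontier[OF assms(2,5) cu that])
  have clos: "closure \<Omega> = \<Omega> \<union> frontier \<Omega>"
    using op closure_subset by (auto simp: frontier_def interior_open)
  define v where "v x = (if x \<in> \<Omega> then max (u x - 1) 0 else 0)" for x
  define f where "f x = v x powr (p - 1)" for x
  have vcl: "v x = max (u x - 1) 0" if "x \<in> closure \<Omega>" for x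
    using that u0[of x] clos by (auto simp: v_def)
  have v0: "v x = 0" if "x \<notin> \<Omega>" for x using that by (simp add: v_def)
  have vn: "0 \<le> v x" for x by (simp add: v_def)
  have super: "superlevel \<Omega> u = {x. 0 < v x}"
  proof -
    have "u x > 1 \<longleftrightarrow> 0 < v x" if "x \<in> closure \<Omega>" for x using vcl[OF that] by auto
    moreover have "x \<in> closure \<Omega>" if "0 < v x" for x
      using v0[of x] that closure_subset by force
    ultimately show ?thesis unfolding superlevel_def by blast
  qed
  have fb: "free_boundary \<Omega> u = frontier {x. 0 < v x}" by (simp add: free_boundary_def super)
  define L where "L = max L0 1"
  have L: "0 < L" by (simp add: L_def)
  have uL: "\<bar>u x - u y\<bar> \<le> L * dist x y" if "x \<in> closure \<Omega>" "y \<in> closure \<Omega>" for x y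
  proof -
    have "\<bar>u x - u y\<bar> \<le> L0 * dist x y" using lipschitz_onD[OF L0 that] by (simp add: dist_real_def)
    also have "\<dots> \<le> L * dist x y" by (intro mult_right_mono) (auto simp: L_def)
    finally show ?thesis .
  qed
  have vL1: "\<bar>v x - v y\<bar> \<le> L * dist x y" if "x \<in> closure \<Omega>" "y \<in> closure \<Omega>" for x y
    using uL[OF that] unfolding vcl[OF that(1)] vcl[OF that(2)] by (auto simp: max_def abs_if split: if_splits)
  have vL2: "\<bar>v x - v y\<bar> \<le> L * dist x y" if x: "x \<in> \<Omega>" and y: "y \<notin> \<Omega>" for x y
  proof -
    obtain w where w: "w \<in> frontier \<Omega>" "dist x w \<le> dist x y" by (rule frontier_point_on_segment[OF x y])
    have "w \<notin> \<Omega>" using w(1) op by (simp add: frontier_def interior_open)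
    moreover have "x \<in> closure \<Omega>" using x closure_subset by blast
    moreover have "w \<in> closure \<Omega>" using w(1) by (simp add: frontier_def)
    ultimately have "\<bar>v x - v y\<bar> \<le> L * dist x w" using vL1[of x w] v0 y by simp
    also have "\<dots> \<le> L * dist x y" using w(2) L by (intro mult_left_mono) auto
    finally show ?thesis .
  qed
  have vL: "\<bar>v x - v y\<bar> \<le> L * dist x y" for x y
  proof -
    consider "x \<in> \<Omega>" "y \<in> \<Omega>" | "x \<in> \<Omega>" "y \<notin> \<Omega>" | "x \<notin> \<Omega>" "y \<in> \<Omega>" | "x \<notin> \<Omega>" "y \<notin> \<Omega>" by blast
    then show ?thesis
    proof cases
      case 1
      then show ?thesis using closure_subset by (intro vL1) auto
    next
      case 2
      then show ?thesis by (rule vL2)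
    next
      case 3
      then show ?thesis using vL2[of y x] by (simp add: dist_commute abs_minus_commute)
    next
      case 4
      then show ?thesis using L by (simp add: v0)
    qed
  qed
  have vc: "continuous_on A v" for A
  proof -
    have "L-lipschitz_on A v" using L vL by (auto simp: lipschitz_on_def dist_real_def)
    then show ?thesis by (rule lipschitz_on_continuous_on)
  qed
  have K: "v x = 0" "f x = 0" if "x \<notin> closure \<Omega>" for x
  proof -
    show "v x = 0" using that closure_subset v0 by blast
    then show "f x = 0" by (simp add: f_def)
  qed
  have fc: "continuous_on UNIV f"
    unfolding f_def using assms(3) vn
    by (intro continuous_on_powr' vc continuous_on_const) auto
  obtain M where M: "\<And>x. \<bar>f x\<bar> \<le> M" using bounded_compact_support[OF fc comp K(2)] by metis
  have openpos: "open {x. 0 < v x}"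
    using open_Collect_less[OF continuous_on_const vc] by simp
  have pos\<Omega>: "{x. 0 < v x} \<subseteq> \<Omega> - free_boundary \<Omega> u"
    using openpos v0 by (auto simp: fb frontier_def interior_open) force
  have eq: "(LINT x|lborel. v x * laplacian \<psi> x) = - (LINT x|lborel. f x * \<psi> x)"
    if tf: "test_function {x. 0 < v x} \<psi>" for \<psi>
  proof -
    obtain S where \<psi>: "smooth \<psi>" and S: "compact S" "S \<subseteq> {x. 0 < v x}" "\<And>x. x \<notin> S \<Longrightarrow> \<psi> x = 0"
      using tf unfolding test_function_def by blast
    have Sc: "closed S" using S(1) compact_imp_closed by blast
    have lap0: "laplacian \<psi> x = 0" if "x \<notin> S" for x by (rule laplacian_outside_support[OF Sc S(3) that])
    define U where "U = \<Omega> - free_boundary \<Omega> u"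
    have "test_function U \<psi>"
      unfolding test_function_def using \<psi> S pos\<Omega> by (auto simp: U_def intro!: exI[of _ S])
    then have "- (LINT x:U|lebesgue. u x * laplacian \<psi> x) = (LINT x:U|lebesgue. max (u x - 1) 0 powr (p - 1) * \<psi> x)"
      using assms(8) unfolding neg_laplacian_eq_def U_def by blast
    moreover have uv: "u x = v x + 1" "x \<in> U" if "x \<in> S" for x
    proof -
      have "0 < v x" using S(2) that by blast
      then show "u x = v x + 1" "x \<in> U" using pos\<Omega> by (auto simp: U_def v_def split: if_splits)
    qed
    \<comment> \<open>\<open>u = v + 1\<close> on the support of \<open>\<psi>\<close>; the constant contributes
      \<open>\<integral> \<Delta>\<psi> = 0\<close>\<close>
    have "indicator U x *\<^sub>R (u x * laplacian \<psi> x) = v x * laplacian \<psi> x + laplacian \<psi> x" for x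
      using uv[of x] lap0[of x] by (cases "x \<in> S") (auto simp: algebra_simps)
    moreover have "indicator U x *\<^sub>R (max (u x - 1) 0 powr (p - 1) * \<psi> x) = f x * \<psi> x" for x
      using uv[of x] S(3)[of x] vn[of x] by (cases "x \<in> S") (auto simp: f_def max_def)
    ultimately have e: "- (LINT x|lebesgue. v x * laplacian \<psi> x + laplacian \<psi> x) = (LINT x|lebesgue. f x * \<psi> x)"
      by (simp only: set_lebesgue_integral_def)
    have cl: "continuous_on UNIV (laplacian \<psi>)" by (rule smooth_continuous[OF smooth_laplacian[OF \<psi>]])
    have c1: "continuous_on UNIV (\<lambda>x. v x * laplacian \<psi> x)" by (intro continuous_intros vc cl)
    have c2: "continuous_on UNIV (\<lambda>x. f x * \<psi> x)" by (intro continuous_intros fc smooth_continuous[OF \<psi>])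
    have i: "integrable lborel (\<lambda>x. v x * laplacian \<psi> x)" "integrable lborel (laplacian \<psi>)"
      by (rule integrable_compact_support[OF _ S(1)]; (intro c1 cl)?; simp add: lap0)+
    have "(LINT x|lebesgue. v x * laplacian \<psi> x + laplacian \<psi> x) = (LINT x|lborel. v x * laplacian \<psi> x + laplacian \<psi> x)"
      using c1 cl by (intro integral_completion) (auto intro!: borel_measurable_continuous_onI continuous_intros)
    also have "\<dots> = (LINT x|lborel. v x * laplacian \<psi> x)"
      using i integral_laplacian_eq_0[OF \<psi> S(1,3)] by simp
    finally have e1: "(LINT x|lebesgue. v x * laplacian \<psi> x + laplacian \<psi> x) = (LINT x|lborel. v x * laplacian \<psi> x)" .
    have e2: "(LINT x|lebesgue. f x * \<psi> x) = (LINT x|lborel. f x * \<psi> x)"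
      using c2 by (intro integral_completion) (auto intro!: borel_measurable_continuous_onI)
    show ?thesis using e unfolding e1 e2 by simp
  qed
  define Z where "Z = {x. v x = 0}"
  define Z' where "Z' = {x \<in> closure \<Omega>. u x \<le> 1}"
  have "\<Omega> \<noteq> UNIV" using bd not_bounded_UNIV by blast
  then have fne: "frontier \<Omega> \<noteq> {}" using ne by (rule frontier_not_empty[rotated])
  have sub: "Z' \<subseteq> Z" using vcl by (auto simp: Z_def Z'_def)
  have fZ': "frontier \<Omega> \<subseteq> Z'" using u0 clos by (auto simp: Z'_def)
  have Zc: "closed Z" unfolding Z_def using closed_Collect_eq[OF vc continuous_on_const, of 0] by simp
  \<comment> \<open>a zero outside \<open>\<Omega>\<close> is no closer than the boundary point on the segment to it, where
    \<open>u = 0\<close>\<close>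
  have inf: "infdist x Z' = infdist x Z" if x: "0 < v x" for x
  proof (rule antisym)
    show "infdist x Z \<le> infdist x Z'" using sub fZ' fne by (intro infdist_mono) auto
    have "Z \<noteq> {}" using sub fZ' fne by blast
    then obtain z where z: "z \<in> Z" "infdist x Z = dist x z"
      using infdist_attains_inf[OF Zc, of x] by metis
    have "\<exists>w\<in>Z'. dist x w \<le> dist x z"
    proof (cases "z \<in> \<Omega>")
      case True
      then have "z \<in> Z'" using z(1) closure_subset by (auto simp: Z_def Z'_def v_def)
      then show ?thesis by blast
    next
      case False
      have "x \<in> \<Omega>" using x v0[of x] by force
      then obtain w where "w \<in> frontier \<Omega>" "dist x w \<le> dist x z"
        using False by (rule frontier_point_on_segment)
      then show ?thesis using fZ' by blast
    qed
    then obtain w where "w \<in> Z'" "dist x w \<le> dist x z" by blast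
    then show "infdist x Z' \<le> infdist x Z" using z(2) infdist_le2[of w Z' x] by simp
  qed
  obtain r\<^sub>0 c where r\<^sub>0: "r\<^sub>0 > 0" and c: "c > 0" and nd:
    "\<And>x. x \<in> superlevel \<Omega> u \<Longrightarrow> infdist x Z' \<le> r\<^sub>0 \<Longrightarrow> u x \<ge> 1 + c * infdist x Z'"
    using assms(7) unfolding nondegenerate_def Z'_def by blast
  interpret nondegenerate_solution v f "closure \<Omega>" L M c r\<^sub>0
  proof
    show "c * infdist x {x. v x = 0} \<le> v x" if "0 < v x" "infdist x {x. v x = 0} \<le> r\<^sub>0" for x
      using nd[of x] inf[of x] that unfolding super Z_def by (auto simp: v_def split: if_splits)
    show "f x \<le> M" for x using M[of x] by (simp add: abs_le_iff)
    show "0 \<le> f x" for x by (simp add: f_def)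
  qed (use assms(1) comp K vn L vL fc eq r\<^sub>0 c in auto)
  define D where "D = setdist (superlevel \<Omega> u) (frontier \<Omega>)"
  have D0: "0 \<le> D" by (simp add: D_def)
  have Dpos: "D > 0" if "superlevel \<Omega> u \<noteq> {}"
  proof -
    define T where "T = {x \<in> closure \<Omega>. u x \<ge> 1}"
    have "compact T"
    proof -
      have "closed T"
        unfolding T_def using continuous_closed_preimage[OF cu closed_closure, of "{1..}"]
        by (simp add: vimage_def Int_def)
      moreover have "closure \<Omega> \<inter> T = T" by (auto simp: T_def)
      ultimately show ?thesis using compact_Int_closed[OF comp, of T] by metis
    qed
    moreover have "T \<inter> frontier \<Omega> = {}" using u0 by (auto simp: T_def)
    moreover have sT: "superlevel \<Omega> u \<subseteq> T" by (auto simp: T_def superlevel_def)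
    ultimately have "setdist T (frontier \<Omega>) \<noteq> 0"
      using that fne by (subst setdist_eq_0_compact_closed) auto
    then have "0 < setdist T (frontier \<Omega>)" using setdist_pos_le[of T "frontier \<Omega>"] by linarith
    also have "\<dots> \<le> D" unfolding D_def by (rule setdist_subset_left[OF that sT])
    finally show ?thesis .
  qed
  obtain R where R: "R > 0" "closure \<Omega> \<subseteq> ball 0 R"
    using compact_imp_bounded[OF comp] bounded_subset_ballD[of "closure \<Omega>" 0] by blast
  \<comment> \<open>large enough that one ball of radius \<open>R\<^sub>0\<close> contains the whole free boundary\<close>
  define R\<^sub>0 where "R\<^sub>0 = D / 2 + 2 * R"
  have R\<^sub>0: "R\<^sub>0 > 0" using D0 R by (simp add: R\<^sub>0_def)
  obtain C where C: "C > 0" and bound: "\<And>x0 r. x0 \<in> free_boundary \<Omega> u \<Longrightarrow> 0 < r \<Longrightarrow> r \<le> R\<^sub>0 \<Longrightarrow>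
    hausdorff_measure (DIM('a) - 1) (free_boundary \<Omega> u \<inter> ball x0 r) \<le> ennreal (C * r ^ (DIM('a) - 1))"
    using hausdorff_measure_free_boundary[OF R\<^sub>0] unfolding fb by metis
  have fin: "hausdorff_measure (DIM('a) - 1) (free_boundary \<Omega> u) < \<infinity>"
  proof (cases "free_boundary \<Omega> u = {}")
    case True
    then show ?thesis by (simp add: hausdorff_measure_empty)
  next
    case False
    then obtain x0 where x0: "x0 \<in> free_boundary \<Omega> u" by blast
    have "free_boundary \<Omega> u \<subseteq> closure \<Omega>"
      using pos\<Omega> closure_mono[of "{x. 0 < v x}" \<Omega>] by (auto simp: fb frontier_def)
    then have near: "free_boundary \<Omega> u \<subseteq> ball 0 R" using R(2) by blast
    have "dist x0 y < R\<^sub>0" if "y \<in> free_boundary \<Omega> u" for y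
    proof -
      have "dist 0 x0 < R" "dist 0 y < R" using near x0 that by (auto simp: subset_eq simp del: dist_0_norm)
      then show ?thesis using dist_triangle[of x0 y 0] D0 by (simp add: R\<^sub>0_def dist_commute)
    qed
    then have "free_boundary \<Omega> u \<inter> ball x0 R\<^sub>0 = free_boundary \<Omega> u" by auto
    then show ?thesis
      using bound[OF x0 R\<^sub>0 order_refl] by (metis ennreal_less_top infinity_ennreal_def order_le_less_trans)
  qed
  have "r \<le> R\<^sub>0" if "r \<le> D / 2" for r using that R(1) by (simp add: R\<^sub>0_def)
  then show ?thesis using Dpos fin C bound unfolding D_def by blast
qed

end
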